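(* Let $\mathcal C$ be a cogroupoid over a field $k$ and let $X_1,\ldots,X_n\in \mathrm{ob}(\mathcal C)$. For $i,j,l\in\{1,\ldots,n\}$ put $\mathcal C(i,j)=\mathcal C(X_i,X_j)$, $\Delta_{i,j}^l=\Delta_{X_i,X_j}^{X_l}$, $S_{i,j}=S_{X_i,X_j}$, $\varepsilon_i=\varepsilon_{X_i}$. Consider the direct sum of algebras $$H=\bigoplus_{i,j=1}^n \mathcal C(i,j).$$ Then $H$ is a weak Hopf algebra for the following structure: (1) the comultiplication $\Delta:H\to H\otimes H$ is the linear map defined by $\Delta(a)=\sum_{l=1}^n\Delta_{i,j}^l(a)$ for $a\in\mathcal C(i,j)$, where $\Delta^l_{i,j}(a)\in \mathcal C(i,l)\otimes\mathcal C(l,j)\subset H\otimes H$; (2) the counit $\varepsilon:H\to k$ is the linear map defined by $\varepsilon|_{\mathcal C(i,j)}=\delta_{ij}\varepsilon_i$; (3) the antipode $S:H\to H$ is the linear map defined by $S|_{\mathcal C(i,j)}=S_{i,j}$, with values in $\mathcal C(j,i)$.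
   Context: Algebras are associative unital $k$-algebras, tensor products are over $k$, $m$ denotes multiplication. A cocategory $\mathcal C$ consists of a set $\mathrm{ob}(\mathcal C)$; for all $X,Y\in \mathrm{ob}(\mathcal C)$ a $k$-algebra $\mathcal C(X,Y)$; and for all $X,Y,Z$ algebra morphisms $\Delta_{X,Y}^Z:\mathcal C(X,Y)\to\mathcal C(X,Z)\otimes\mathcal C(Z,Y)$ and $\varepsilon_X:\mathcal C(X,X)\to k$ such that $(\Delta_{X,Z}^T\otimes 1)\Delta_{X,Y}^Z=(1\otimes\Delta_{T,Y}^Z)\Delta_{X,Y}^T$ and $(1\otimes\varepsilon_Y)\Delta_{X,Y}^Y=\mathrm{id}=(\varepsilon_X\otimes 1)\Delta_{X,Y}^X$ for all objects $X,Y,Z,T$. A cogroupoid is a cocategory together with linear maps $S_{X,Y}:\mathcal C(X,Y)\to\mathcal C(Y,X)$ such that for all $X,Y$ and $a\in\mathcal C(X,X)$: $m(1\otimes S_{Y,X})\Delta_{X,X}^Y(a)=\varepsilon_X(a)1$ in $\mathcal C(X,Y)$ and $m(S_{X,Y}\otimes 1)\Delta_{X,X}^Y(a)=\varepsilon_X(a)1$ in $\mathcal C(Y,X)$. A weak Hopf algebra (Böhm–Nill–Szlachányi) is an algebra $H$ which is also a coalgebra $(H,\Delta,\varepsilon)$, with a linear map $S:H\to H$, such that $\Delta(xy)=\Delta(x)\Delta(y)$; $\varepsilon(xyz)=\varepsilon(xy_{(1)})\varepsilon(y_{(2)}z)=\varepsilon(xy_{(2)})\varepsilon(y_{(1)}z)$;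 $(\Delta\otimes 1)\Delta(1)=(\Delta(1)\otimes1)(1\otimes\Delta(1))=(1\otimes\Delta(1))(\Delta(1)\otimes 1)$; $x_{(1)}S(x_{(2)})=\varepsilon(1_{(1)}x)1_{(2)}$; $S(x_{(1)})x_{(2)}=1_{(1)}\varepsilon(x1_{(2)})$; $S(x_{(1)})x_{(2)}S(x_{(3)})=S(x)$, for all $x,y,z\in H$. *)

theory Defs
  imports "HOL-Algebra.Module"
begin

section \<open>Algebras and linear maps\<close>

text \<open>The library locale \<open>algebra\<close> is about commutative algebras; here the multiplication
  need not be commutative. The zero algebra is admitted.\<close>

locale unital_algebra = field K + module K A + A: ring A for K and A (structure) +
  assumes mult_smult_left:
      "\<lbrakk>c \<in> carrier K; x \<in> carrier A; y \<in> carrier A\<rbrakk>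
        \<Longrightarrow> (c \<odot>\<^bsub>A\<^esub> x) \<otimes>\<^bsub>A\<^esub> y = c \<odot>\<^bsub>A\<^esub> (x \<otimes>\<^bsub>A\<^esub> y)"
    and mult_smult_right:
      "\<lbrakk>c \<in> carrier K; x \<in> carrier A; y \<in> carrier A\<rbrakk>
        \<Longrightarrow> x \<otimes>\<^bsub>A\<^esub> (c \<odot>\<^bsub>A\<^esub> y) = c \<odot>\<^bsub>A\<^esub> (x \<otimes>\<^bsub>A\<^esub> y)"

definition linear_maps ::
  "('k, 'm) ring_scheme \<Rightarrow> ('k, 'a, 'c) module_scheme \<Rightarrow> ('k, 'b, 'd) module_scheme \<Rightarrow> ('a \<Rightarrow> 'b) set"
  where "linear_maps K M N = {f \<in> carrier M \<rightarrow> carrier N.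
     (\<forall>x\<in>carrier M. \<forall>y\<in>carrier M. f (x \<oplus>\<^bsub>M\<^esub> y) = f x \<oplus>\<^bsub>N\<^esub> f y) \<and>
     (\<forall>c\<in>carrier K. \<forall>x\<in>carrier M. f (c \<odot>\<^bsub>M\<^esub> x) = c \<odot>\<^bsub>N\<^esub> f x)}"

definition algebra_homs ::
  "('k, 'm) ring_scheme \<Rightarrow> ('k, 'a, 'c) module_scheme \<Rightarrow> ('k, 'b, 'd) module_scheme \<Rightarrow> ('a \<Rightarrow> 'b) set"
  where "algebra_homs K A B = ring_hom A B \<inter> linear_maps K A B"

definition scalar_algebra :: "('k, 'm) ring_scheme \<Rightarrow> ('k, 'k) module"
  where "scalar_algebra K =
    \<lparr>carrier = carrier K, mult = mult K, one = one K, zero = zero K, add = add K, smult = mult K\<rparr>"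


section \<open>Tensor products\<close>

text \<open>A list \<open>[(a\<^sub>1, b\<^sub>1), \<dots>, (a\<^sub>r, b\<^sub>r)]\<close> stands for the formal sum
  \<open>a\<^sub>1 \<otimes> b\<^sub>1 + \<dots> + a\<^sub>r \<otimes> b\<^sub>r\<close>. Since \<open>c (a \<otimes> b) = (c a) \<otimes> b\<close>, coefficients need not be recorded,
  and the tensor product is the free commutative monoid on the pairs modulo the congruence
  generated by bilinearity. It is characterised by its universal property,
  \<open>tensor_universal\<close> below.\<close>

inductive tensor_eq ::
  "('k, 'm) ring_scheme \<Rightarrow> ('k, 'a, 'c) module_scheme \<Rightarrow> ('k, 'b, 'd) module_scheme
    \<Rightarrow> ('a \<times> 'b) list \<Rightarrow> ('a \<times> 'b) list \<Rightarrow> bool"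
  for K M N where
  refl: "xs \<in> lists (carrier M \<times> carrier N) \<Longrightarrow> tensor_eq K M N xs xs"
| sym: "tensor_eq K M N xs ys \<Longrightarrow> tensor_eq K M N ys xs"
| trans: "\<lbrakk>tensor_eq K M N xs ys; tensor_eq K M N ys zs\<rbrakk> \<Longrightarrow> tensor_eq K M N xs zs"
| append: "\<lbrakk>tensor_eq K M N xs ys; tensor_eq K M N us vs\<rbrakk>
    \<Longrightarrow> tensor_eq K M N (xs @ us) (ys @ vs)"
| commute: "\<lbrakk>xs \<in> lists (carrier M \<times> carrier N); ys \<in> lists (carrier M \<times> carrier N)\<rbrakk>
    \<Longrightarrow> tensor_eq K M N (xs @ ys) (ys @ xs)"
| zero: "b \<in> carrier N \<Longrightarrow> tensor_eq K M N [(\<zero>\<^bsub>M\<^esub>, b)] []"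
| add_left: "\<lbrakk>a \<in> carrier M; a' \<in> carrier M; b \<in> carrier N\<rbrakk>
    \<Longrightarrow> tensor_eq K M N [(a \<oplus>\<^bsub>M\<^esub> a', b)] [(a, b), (a', b)]"
| add_right: "\<lbrakk>a \<in> carrier M; b \<in> carrier N; b' \<in> carrier N\<rbrakk>
    \<Longrightarrow> tensor_eq K M N [(a, b \<oplus>\<^bsub>N\<^esub> b')] [(a, b), (a, b')]"
| balanced: "\<lbrakk>c \<in> carrier K; a \<in> carrier M; b \<in> carrier N\<rbrakk>
    \<Longrightarrow> tensor_eq K M N [(c \<odot>\<^bsub>M\<^esub> a, b)] [(a, c \<odot>\<^bsub>N\<^esub> b)]"

definition tensor_class ::
  "('k, 'm) ring_scheme \<Rightarrow> ('k, 'a, 'c) module_scheme \<Rightarrow> ('k, 'b, 'd) module_scheme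
    \<Rightarrow> ('a \<times> 'b) list \<Rightarrow> ('a \<times> 'b) list set"
  where "tensor_class K M N xs = {ys. tensor_eq K M N xs ys}"

definition pure_tensor ::
  "('k, 'm) ring_scheme \<Rightarrow> ('k, 'a, 'c) module_scheme \<Rightarrow> ('k, 'b, 'd) module_scheme
    \<Rightarrow> 'a \<Rightarrow> 'b \<Rightarrow> ('a \<times> 'b) list set"
  where "pure_tensor K M N a b = tensor_class K M N [(a, b)]"

text \<open>The ring operations of \<open>tensor K M N\<close> are meaningful when \<open>M\<close> and \<open>N\<close> are algebras:
  \<open>(a \<otimes> b) (a' \<otimes> b') = a a' \<otimes> b b'\<close>.\<close>

definition tensor ::
  "('k, 'm) ring_scheme \<Rightarrow> ('k, 'a, 'c) module_scheme \<Rightarrow> ('k, 'b, 'd) module_scheme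
    \<Rightarrow> ('k, ('a \<times> 'b) list set) module"
  where "tensor K M N =
    \<lparr>carrier = tensor_class K M N ` lists (carrier M \<times> carrier N),
     mult = (\<lambda>s t. \<Union>xs\<in>s. \<Union>ys\<in>t. tensor_class K M N
        (map (\<lambda>((a, b), (a', b')). (a \<otimes>\<^bsub>M\<^esub> a', b \<otimes>\<^bsub>N\<^esub> b')) (List.product xs ys))),
     one = pure_tensor K M N \<one>\<^bsub>M\<^esub> \<one>\<^bsub>N\<^esub>,
     zero = tensor_class K M N [],
     add = (\<lambda>s t. \<Union>xs\<in>s. \<Union>ys\<in>t. tensor_class K M N (xs @ ys)),
     smult = (\<lambda>c t. \<Union>xs\<in>t. tensor_class K M N (map (\<lambda>(a, b). (c \<odot>\<^bsub>M\<^esub> a, b)) xs))\<rparr>"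

definition bilinear_maps ::
  "('k, 'm) ring_scheme \<Rightarrow> ('k, 'a, 'c) module_scheme \<Rightarrow> ('k, 'b, 'd) module_scheme
    \<Rightarrow> ('k, 'p, 'e) module_scheme \<Rightarrow> ('a \<Rightarrow> 'b \<Rightarrow> 'p) set"
  where "bilinear_maps K M N P = {\<beta>.
     (\<forall>a\<in>carrier M. \<beta> a \<in> linear_maps K N P) \<and>
     (\<forall>b\<in>carrier N. (\<lambda>a. \<beta> a b) \<in> linear_maps K M P)}"

definition formal_sum_eval :: "('k, 'p, 'e) module_scheme \<Rightarrow> ('a \<Rightarrow> 'b \<Rightarrow> 'p) \<Rightarrow> ('a \<times> 'b) list \<Rightarrow> 'p"
  where "formal_sum_eval P \<beta> xs = foldr (\<lambda>(a, b) s. \<beta> a b \<oplus>\<^bsub>P\<^esub> s) xs \<zero>\<^bsub>P\<^esub>"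

text \<open>The linear map induced by a bilinear map \<open>\<beta>\<close>. In Sweedler notation,
  \<open>tensor_lift P \<beta> (\<Delta> x)\<close> is \<open>\<beta>(x\<^sub>(\<^sub>1\<^sub>), x\<^sub>(\<^sub>2\<^sub>))\<close>.\<close>

definition tensor_lift ::
  "('k, 'p, 'e) module_scheme \<Rightarrow> ('a \<Rightarrow> 'b \<Rightarrow> 'p) \<Rightarrow> ('a \<times> 'b) list set \<Rightarrow> 'p"
  where "tensor_lift P \<beta> t = the_elem (formal_sum_eval P \<beta> ` t)"

text \<open>\<open>tensor_map K M' N' f g\<close> is \<open>f \<otimes> g\<close>, where \<open>M'\<close> and \<open>N'\<close> are the codomains of
  \<open>f\<close> and \<open>g\<close>.\<close>

definition tensor_map ::
  "('k, 'm) ring_scheme \<Rightarrow> ('k, 'c, 'd) module_scheme \<Rightarrow> ('k, 'e, 'f) module_scheme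
    \<Rightarrow> ('a \<Rightarrow> 'c) \<Rightarrow> ('b \<Rightarrow> 'e) \<Rightarrow> ('a \<times> 'b) list set \<Rightarrow> ('c \<times> 'e) list set"
  where "tensor_map K M' N' f g =
    tensor_lift (tensor K M' N') (\<lambda>a b. pure_tensor K M' N' (f a) (g b))"

text \<open>The canonical isomorphisms \<open>(M \<otimes> N) \<otimes> P \<rightarrow> M \<otimes> (N \<otimes> P)\<close>, \<open>k \<otimes> M \<rightarrow> M\<close> and \<open>M \<otimes> k \<rightarrow> M\<close>.\<close>

definition tensor_assoc ::
  "('k, 'm) ring_scheme \<Rightarrow> ('k, 'a, 'd) module_scheme \<Rightarrow> ('k, 'b, 'e) module_scheme
    \<Rightarrow> ('k, 'c, 'f) module_scheme
    \<Rightarrow> (('a \<times> 'b) list set \<times> 'c) list set \<Rightarrow> ('a \<times> ('b \<times> 'c) list set) list set"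
  where "tensor_assoc K M N P =
    (let T = tensor K M (tensor K N P) in
      tensor_lift T (\<lambda>t c. tensor_lift T
        (\<lambda>a b. pure_tensor K M (tensor K N P) a (pure_tensor K N P b c)) t))"

definition tensor_lunit :: "('k, 'a, 'c) module_scheme \<Rightarrow> ('k \<times> 'a) list set \<Rightarrow> 'a"
  where "tensor_lunit M = tensor_lift M (\<lambda>c a. c \<odot>\<^bsub>M\<^esub> a)"

definition tensor_runit :: "('k, 'a, 'c) module_scheme \<Rightarrow> ('a \<times> 'k) list set \<Rightarrow> 'a"
  where "tensor_runit M = tensor_lift M (\<lambda>a c. c \<odot>\<^bsub>M\<^esub> a)"

text \<open>The linear map \<open>m : A \<otimes> A \<rightarrow> A\<close>.\<close>

definition mult_map :: "('k, 'a, 'c) module_scheme \<Rightarrow> ('a \<times> 'a) list set \<Rightarrow> 'a"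
  where "mult_map A = tensor_lift A (mult A)"

lemma tensor_eq_lists:
  assumes "module K M" "module K N" "tensor_eq K M N xs ys"
  shows "xs \<in> lists (carrier M \<times> carrier N) \<and> ys \<in> lists (carrier M \<times> carrier N)"
proof -
  interpret M: module K M by fact
  interpret N: module K N by fact
  show ?thesis using assms(3) by induction auto
qed

lemma tensor_class_eq_iff:
  assumes "ys \<in> lists (carrier M \<times> carrier N)"
  shows "tensor_class K M N xs = tensor_class K M N ys \<longleftrightarrow> tensor_eq K M N xs ys"
proof
  assume "tensor_class K M N xs = tensor_class K M N ys"
  then have "ys \<in> tensor_class K M N xs"
    using assms by (auto simp: tensor_class_def intro: tensor_eq.refl)
  then show "tensor_eq K M N xs ys" by (simp add: tensor_class_def)
qed (auto simp: tensor_class_def intro: tensor_eq.sym tensor_eq.trans)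

lemma UN_const_on: "\<lbrakk>x \<in> A; \<And>y. y \<in> A \<Longrightarrow> f y = c\<rbrakk> \<Longrightarrow> (\<Union>y\<in>A. f y) = c"
  by auto

lemma tensor_add_class:
  assumes "xs \<in> lists (carrier M \<times> carrier N)" "ys \<in> lists (carrier M \<times> carrier N)"
  shows "tensor_class K M N xs \<oplus>\<^bsub>tensor K M N\<^esub> tensor_class K M N ys = tensor_class K M N (xs @ ys)"
proof -
  have 1: "tensor_class K M N (us @ vs) = tensor_class K M N (xs @ ys)"
    if "us \<in> tensor_class K M N xs" "vs \<in> tensor_class K M N ys" for us vs
  proof -
    have "tensor_eq K M N us xs" "tensor_eq K M N vs ys"
      using that by (simp_all add: tensor_class_def tensor_eq.sym)
    then have "tensor_eq K M N (us @ vs) (xs @ ys)" by (rule tensor_eq.append)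
    then show ?thesis using assms by (subst tensor_class_eq_iff) auto
  qed
  have 2: "xs \<in> tensor_class K M N xs" "ys \<in> tensor_class K M N ys"
    using assms by (auto simp: tensor_class_def intro: tensor_eq.refl)
  have "(\<Union>us\<in>tensor_class K M N xs. \<Union>vs\<in>tensor_class K M N ys. tensor_class K M N (us @ vs))
      = tensor_class K M N (xs @ ys)"
    by (rule UN_const_on[OF 2(1)], rule UN_const_on[OF 2(2)], rule 1)
  then show ?thesis by (simp add: tensor_def)
qed

lemma tensor_eq_smult:
  assumes "module K M" "module K N" "c \<in> carrier K" "tensor_eq K M N xs ys"
  shows "tensor_eq K M N (map (\<lambda>(a, b). (c \<odot>\<^bsub>M\<^esub> a, b)) xs) (map (\<lambda>(a, b). (c \<odot>\<^bsub>M\<^esub> a, b)) ys)"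
proof -
  interpret M: module K M by fact
  interpret N: module K N by fact
  have L: "map (\<lambda>(a, b). (c \<odot>\<^bsub>M\<^esub> a, b)) zs \<in> lists (carrier M \<times> carrier N)"
    if "zs \<in> lists (carrier M \<times> carrier N)" for zs
    using that assms(3) by (induction zs) auto
  show ?thesis using assms(4)
  proof induction
    case (balanced d a b)
    then have "c \<odot>\<^bsub>M\<^esub> (d \<odot>\<^bsub>M\<^esub> a) = d \<odot>\<^bsub>M\<^esub> (c \<odot>\<^bsub>M\<^esub> a)"
      using assms(3) by (metis M.R.m_comm M.smult_assoc1)
    with balanced assms(3) show ?case by (simp add: tensor_eq.balanced)
  next
    case (sym xs ys)
    then show ?case by (rule_tac tensor_eq.sym)
  next
    case (trans xs ys zs)
    then show ?case by (rule_tac tensor_eq.trans)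
  qed (use assms(3) L in \<open>auto simp: M.smult_r_distr intro: tensor_eq.refl tensor_eq.append
        tensor_eq.commute tensor_eq.zero tensor_eq.add_left tensor_eq.add_right\<close>)
qed

lemma tensor_smult_class:
  assumes "module K M" "module K N" "c \<in> carrier K" "xs \<in> lists (carrier M \<times> carrier N)"
  shows "c \<odot>\<^bsub>tensor K M N\<^esub> tensor_class K M N xs
     = tensor_class K M N (map (\<lambda>(a, b). (c \<odot>\<^bsub>M\<^esub> a, b)) xs)"
proof -
  let ?m = "map (\<lambda>(a, b). (c \<odot>\<^bsub>M\<^esub> a, b))"
  have 1: "tensor_class K M N (?m us) = tensor_class K M N (?m xs)"
    if "us \<in> tensor_class K M N xs" for us
  proof -
    have "tensor_eq K M N us xs"
      using that by (auto simp: tensor_class_def intro: tensor_eq.sym)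
    then have "tensor_eq K M N (?m us) (?m xs)"
      by (rule tensor_eq_smult[OF assms(1-3)])
    then show ?thesis using tensor_eq_lists[OF assms(1,2)] tensor_class_eq_iff by blast
  qed
  have 2: "xs \<in> tensor_class K M N xs"
    using assms by (auto simp: tensor_class_def intro: tensor_eq.refl)
  have "(\<Union>us\<in>tensor_class K M N xs. tensor_class K M N (?m us))
      = tensor_class K M N (?m xs)"
    by (rule UN_const_on[OF 2], rule 1)
  then show ?thesis by (simp add: tensor_def)
qed

lemma tensor_eq_cancel:
  assumes "module K M" "module K N" "xs \<in> lists (carrier M \<times> carrier N)"
  shows "tensor_eq K M N (map (\<lambda>(a, b). (\<ominus>\<^bsub>M\<^esub> a, b)) xs @ xs) []"
proof -
  interpret M: module K M by fact
  interpret N: module K N by fact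
  let ?m = "map (\<lambda>(a, b). (\<ominus>\<^bsub>M\<^esub> a, b))"
  have L: "?m zs \<in> lists (carrier M \<times> carrier N)" if "zs \<in> lists (carrier M \<times> carrier N)" for zs
    using that by (induction zs) auto
  show ?thesis using assms(3)
  proof induction
    case Nil
    then show ?case by (auto intro: tensor_eq.refl)
  next
    case (Cons p zs)
    obtain a b where p: "p = (a, b)" "a \<in> carrier M" "b \<in> carrier N" using Cons by auto
    have "tensor_eq K M N [(\<zero>\<^bsub>M\<^esub>, b)] [(\<ominus>\<^bsub>M\<^esub> a, b), (a, b)]"
      using tensor_eq.add_left[of "\<ominus>\<^bsub>M\<^esub> a" M a b N K] p by (simp add: M.l_neg)
    then have 1: "tensor_eq K M N [(\<ominus>\<^bsub>M\<^esub> a, b), (a, b)] []"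
      using p by (rule_tac tensor_eq.trans[OF tensor_eq.sym tensor_eq.zero])
    have "tensor_eq K M N ((?m zs @ [(a, b)]) @ zs) (([(a, b)] @ ?m zs) @ zs)"
      using p Cons.hyps L[of zs]
      by (intro tensor_eq.append[OF tensor_eq.commute tensor_eq.refl]) auto
    then have "tensor_eq K M N ([(\<ominus>\<^bsub>M\<^esub> a, b)] @ (?m zs @ [(a, b)]) @ zs)
       ([(\<ominus>\<^bsub>M\<^esub> a, b)] @ (([(a, b)] @ ?m zs) @ zs))"
      by (rule tensor_eq.append[OF tensor_eq.refl, rotated]) (use p in simp)
    moreover have "tensor_eq K M N ([(\<ominus>\<^bsub>M\<^esub> a, b), (a, b)] @ (?m zs @ zs)) ([] @ [])"
      by (rule tensor_eq.append[OF 1 Cons.IH])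
    ultimately show ?case using tensor_eq.trans p by fastforce
  qed
qed

lemma tensor_carrier_cases:
  assumes "t \<in> carrier (tensor K M N)"
  obtains xs where "xs \<in> lists (carrier M \<times> carrier N)" "t = tensor_class K M N xs"
  using assms unfolding tensor_def by auto

lemma tensor_class_carrier:
  "xs \<in> lists (carrier M \<times> carrier N) \<Longrightarrow> tensor_class K M N xs \<in> carrier (tensor K M N)"
  unfolding tensor_def by auto

lemma module_tensor:
  assumes "module K M" "module K N"
  shows "module K (tensor K M N)"
proof -
  interpret M: module K M by fact
  interpret N: module K N by fact
  let ?T = "tensor K M N" and ?cl = "tensor_class K M N" and ?L = "lists (carrier M \<times> carrier N)"
  let ?s = "\<lambda>c. map (\<lambda>(a, b). (c \<odot>\<^bsub>M\<^esub> a, b))"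
  have zero: "\<zero>\<^bsub>?T\<^esub> = ?cl []" by (simp add: tensor_def)
  have sL: "?s c zs \<in> ?L" if "zs \<in> ?L" "c \<in> carrier K" for zs c
    using that by (induction zs) auto
  have eqI: "?cl xs = ?cl ys" if "tensor_eq K M N xs ys" for xs ys
    using that tensor_class_eq_iff tensor_eq_lists[OF assms] by blast
  note add = tensor_add_class[of _ M N _ K] and sm = tensor_smult_class[OF assms]
  show ?thesis
  proof (rule moduleI)
    show "cring K" ..
    show "abelian_group ?T"
    proof (rule abelian_groupI)
      fix s assume "s \<in> carrier ?T"
      then obtain xs where xs: "xs \<in> ?L" "s = ?cl xs" by (rule tensor_carrier_cases)
      have m: "map (\<lambda>(a, b). (\<ominus>\<^bsub>M\<^esub> a, b)) xs \<in> ?L"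
        using xs(1) by (induction xs) auto
      show "\<exists>t\<in>carrier ?T. t \<oplus>\<^bsub>?T\<^esub> s = \<zero>\<^bsub>?T\<^esub>"
        using add[OF m xs(1)] eqI[OF tensor_eq_cancel[OF assms xs(1)]] xs m
        by (metis tensor_class_carrier zero)
    next
      fix s t assume "s \<in> carrier ?T" "t \<in> carrier ?T"
      then obtain xs ys where *: "xs \<in> ?L" "s = ?cl xs" "ys \<in> ?L" "t = ?cl ys"
        by (metis tensor_carrier_cases)
      then show "s \<oplus>\<^bsub>?T\<^esub> t = t \<oplus>\<^bsub>?T\<^esub> s"
        using eqI[OF tensor_eq.commute[of xs M N ys K]] by (simp add: add)
    next
      fix s t assume "s \<in> carrier ?T" "t \<in> carrier ?T"
      then obtain xs ys where *: "xs \<in> ?L" "s = ?cl xs" "ys \<in> ?L" "t = ?cl ys"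
        by (metis tensor_carrier_cases)
      then have "xs @ ys \<in> ?L" by simp
      with * show "s \<oplus>\<^bsub>?T\<^esub> t \<in> carrier ?T" by (simp only: add tensor_class_carrier)
    next
      show "\<zero>\<^bsub>?T\<^esub> \<in> carrier ?T" by (simp add: zero tensor_class_carrier)
    next
      fix s t u assume "s \<in> carrier ?T" "t \<in> carrier ?T" "u \<in> carrier ?T"
      then obtain xs ys zs where *: "xs \<in> ?L" "s = ?cl xs" "ys \<in> ?L" "t = ?cl ys"
          "zs \<in> ?L" "u = ?cl zs"
        by (metis tensor_carrier_cases)
      then have "xs @ ys \<in> ?L" "ys @ zs \<in> ?L" by simp_all
      with * show "s \<oplus>\<^bsub>?T\<^esub> t \<oplus>\<^bsub>?T\<^esub> u = s \<oplus>\<^bsub>?T\<^esub> (t \<oplus>\<^bsub>?T\<^esub> u)"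
        by (simp only: add append_assoc)
    next
      fix s assume "s \<in> carrier ?T"
      then obtain xs where "xs \<in> ?L" "s = ?cl xs" by (rule tensor_carrier_cases)
      then show "\<zero>\<^bsub>?T\<^esub> \<oplus>\<^bsub>?T\<^esub> s = s" by (simp add: zero add)
    qed
  next
    fix c s assume c: "c \<in> carrier K" and "s \<in> carrier ?T"
    then obtain xs where xs: "xs \<in> ?L" "s = ?cl xs" by (metis tensor_carrier_cases)
    then show "c \<odot>\<^bsub>?T\<^esub> s \<in> carrier ?T" using c sL by (simp add: sm tensor_class_carrier)
  next
    fix c d s assume c: "c \<in> carrier K" "d \<in> carrier K" and "s \<in> carrier ?T"
    then obtain xs where xs: "xs \<in> ?L" "s = ?cl xs" by (metis tensor_carrier_cases)
    have "tensor_eq K M N (?s (c \<oplus>\<^bsub>K\<^esub> d) xs) (?s c xs @ ?s d xs)"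
      using xs(1)
    proof induction
      case Nil
      then show ?case by (auto intro: tensor_eq.refl)
    next
      case (Cons p zs)
      obtain a b where p: "p = (a, b)" "a \<in> carrier M" "b \<in> carrier N" using Cons by auto
      have 1: "tensor_eq K M N [((c \<oplus>\<^bsub>K\<^esub> d) \<odot>\<^bsub>M\<^esub> a, b)] [(c \<odot>\<^bsub>M\<^esub> a, b), (d \<odot>\<^bsub>M\<^esub> a, b)]"
        using p c by (simp add: M.smult_l_distr tensor_eq.add_left)
      have "tensor_eq K M N ([((c \<oplus>\<^bsub>K\<^esub> d) \<odot>\<^bsub>M\<^esub> a, b)] @ ?s (c \<oplus>\<^bsub>K\<^esub> d) zs)
          ([(c \<odot>\<^bsub>M\<^esub> a, b), (d \<odot>\<^bsub>M\<^esub> a, b)] @ (?s c zs @ ?s d zs))"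
        by (rule tensor_eq.append[OF 1 Cons.IH])
      moreover have "tensor_eq K M N ([(c \<odot>\<^bsub>M\<^esub> a, b)] @ ([(d \<odot>\<^bsub>M\<^esub> a, b)] @ ?s c zs) @ ?s d zs)
         ([(c \<odot>\<^bsub>M\<^esub> a, b)] @ (?s c zs @ [(d \<odot>\<^bsub>M\<^esub> a, b)]) @ ?s d zs)"
        using p c Cons sL by (intro tensor_eq.append tensor_eq.commute tensor_eq.refl) auto
      ultimately show ?case using tensor_eq.trans p by fastforce
    qed
    then show "(c \<oplus>\<^bsub>K\<^esub> d) \<odot>\<^bsub>?T\<^esub> s = c \<odot>\<^bsub>?T\<^esub> s \<oplus>\<^bsub>?T\<^esub> d \<odot>\<^bsub>?T\<^esub> s"
      using eqI xs c sL by (simp add: sm add)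
    have "?s (c \<otimes>\<^bsub>K\<^esub> d) xs = ?s c (?s d xs)"
      using xs(1) c by (induction xs) (auto simp: M.smult_assoc1)
    then show "(c \<otimes>\<^bsub>K\<^esub> d) \<odot>\<^bsub>?T\<^esub> s = c \<odot>\<^bsub>?T\<^esub> (d \<odot>\<^bsub>?T\<^esub> s)"
      using xs c sL by (simp add: sm del: map_map)
  next
    fix c s t assume c: "c \<in> carrier K" and "s \<in> carrier ?T" "t \<in> carrier ?T"
    then obtain xs ys where *: "xs \<in> ?L" "s = ?cl xs" "ys \<in> ?L" "t = ?cl ys"
      by (metis tensor_carrier_cases)
    show "c \<odot>\<^bsub>?T\<^esub> (s \<oplus>\<^bsub>?T\<^esub> t) = c \<odot>\<^bsub>?T\<^esub> s \<oplus>\<^bsub>?T\<^esub> c \<odot>\<^bsub>?T\<^esub> t"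
    proof -
      have "xs @ ys \<in> ?L" using * by simp
      then show ?thesis using * c sL by (simp only: add sm map_append)
    qed
  next
    fix s assume "s \<in> carrier ?T"
    then obtain xs where xs: "xs \<in> ?L" "s = ?cl xs" by (metis tensor_carrier_cases)
    have "?s \<one>\<^bsub>K\<^esub> xs = xs" using xs(1) by (induction xs) auto
    then show "\<one>\<^bsub>K\<^esub> \<odot>\<^bsub>?T\<^esub> s = s" using xs by (simp add: sm)
  qed
qed

lemma tensor_lift_class:
  assumes "module K M" "module K N" "module K P" "\<beta> \<in> bilinear_maps K M N P"
    and "xs \<in> lists (carrier M \<times> carrier N)"
  shows "tensor_lift P \<beta> (tensor_class K M N xs) = formal_sum_eval P \<beta> xs"
    and "formal_sum_eval P \<beta> xs \<in> carrier P"
proof -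
  interpret M: module K M by fact
  interpret N: module K N by fact
  interpret P: module K P by fact
  have cl: "\<beta> a b \<in> carrier P" if "a \<in> carrier M" "b \<in> carrier N" for a b
    using assms(4) that by (auto simp: bilinear_maps_def linear_maps_def)
  have evc: "formal_sum_eval P \<beta> zs \<in> carrier P" if "zs \<in> lists (carrier M \<times> carrier N)" for zs
    using that by (induction zs) (auto simp: formal_sum_eval_def cl)
  have app: "formal_sum_eval P \<beta> (us @ vs) = formal_sum_eval P \<beta> us \<oplus>\<^bsub>P\<^esub> formal_sum_eval P \<beta> vs"
    if "us \<in> lists (carrier M \<times> carrier N)" "vs \<in> lists (carrier M \<times> carrier N)" for us vs
    using that(1)
  proof induction
    case Nil
    then show ?case using evc[OF that(2)] by (simp add: formal_sum_eval_def)
  next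
    case (Cons p zs)
    then show ?case using evc[OF that(2)] evc[of zs] cl
      by (auto simp: formal_sum_eval_def P.a_assoc)
  qed
  have bz: "\<beta> \<zero>\<^bsub>M\<^esub> b = \<zero>\<^bsub>P\<^esub>" if "b \<in> carrier N" for b
  proof -
    have "\<beta> (\<zero>\<^bsub>K\<^esub> \<odot>\<^bsub>M\<^esub> \<zero>\<^bsub>M\<^esub>) b = \<zero>\<^bsub>K\<^esub> \<odot>\<^bsub>P\<^esub> \<beta> \<zero>\<^bsub>M\<^esub> b"
      using assms(4) that M.R.zero_closed M.zero_closed
      unfolding bilinear_maps_def linear_maps_def by blast
    then show ?thesis using cl[of "\<zero>\<^bsub>M\<^esub>" b] that by simp
  qed
  have ev: "formal_sum_eval P \<beta> us = formal_sum_eval P \<beta> vs" if "tensor_eq K M N us vs" for us vs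
    using that
  proof induction
    case (append xs ys us vs)
    then show ?case using tensor_eq_lists[OF assms(1,2)] app by metis
  next
    case (commute xs ys)
    then show ?case using evc by (simp add: app P.a_comm del: append_in_lists_conv)
  next
    case (add_left a a' b)
    then show ?case using assms(4) cl
      by (auto simp: formal_sum_eval_def bilinear_maps_def linear_maps_def)
  next
    case (add_right a b b')
    then show ?case using assms(4) cl
      by (auto simp: formal_sum_eval_def bilinear_maps_def linear_maps_def)
  next
    case (balanced c a b)
    then show ?case using assms(4) cl
      by (auto simp: formal_sum_eval_def bilinear_maps_def linear_maps_def)
  qed (auto simp: formal_sum_eval_def bz)
  have "formal_sum_eval P \<beta> ` tensor_class K M N xs = {formal_sum_eval P \<beta> xs}"
    using ev assms(5) by (fastforce simp: tensor_class_def intro: tensor_eq.refl)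
  then show "tensor_lift P \<beta> (tensor_class K M N xs) = formal_sum_eval P \<beta> xs"
    by (simp add: tensor_lift_def)
  show "formal_sum_eval P \<beta> xs \<in> carrier P" using evc assms(5) .
qed

theorem tensor_universal:
  assumes "module K M" "module K N" "module K P" "\<beta> \<in> bilinear_maps K M N P"
  shows "tensor_lift P \<beta> \<in> linear_maps K (tensor K M N) P"
    and "\<lbrakk>a \<in> carrier M; b \<in> carrier N\<rbrakk> \<Longrightarrow> tensor_lift P \<beta> (pure_tensor K M N a b) = \<beta> a b"
    and "\<lbrakk>f \<in> linear_maps K (tensor K M N) P;
          \<And>a b. \<lbrakk>a \<in> carrier M; b \<in> carrier N\<rbrakk> \<Longrightarrow> f (pure_tensor K M N a b) = \<beta> a b;
          t \<in> carrier (tensor K M N)\<rbrakk> \<Longrightarrow> f t = tensor_lift P \<beta> t"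
proof -
  interpret M: module K M by fact
  interpret N: module K N by fact
  interpret P: module K P by fact
  interpret T: module K "tensor K M N" using module_tensor assms(1,2) .
  let ?L = "lists (carrier M \<times> carrier N)" and ?cl = "tensor_class K M N"
    and ?ev = "formal_sum_eval P \<beta>"
  note lift = tensor_lift_class[OF assms]
  have cl: "\<beta> a b \<in> carrier P" if "a \<in> carrier M" "b \<in> carrier N" for a b
    using assms(4) that by (auto simp: bilinear_maps_def linear_maps_def)
  have app: "?ev (us @ vs) = ?ev us \<oplus>\<^bsub>P\<^esub> ?ev vs" if "us \<in> ?L" "vs \<in> ?L" for us vs
    using that(1)
  proof induction
    case Nil
    then show ?case using lift(2)[OF that(2)] by (simp add: formal_sum_eval_def)
  next
    case (Cons p zs)
    then show ?case using lift(2)[OF that(2)] lift(2)[of zs] cl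
      by (auto simp: formal_sum_eval_def P.a_assoc)
  qed
  have sL: "map (\<lambda>(a, b). (c \<odot>\<^bsub>M\<^esub> a, b)) zs \<in> ?L" if "zs \<in> ?L" "c \<in> carrier K" for zs c
    using that by (induction zs) auto
  have sev: "?ev (map (\<lambda>(a, b). (c \<odot>\<^bsub>M\<^esub> a, b)) zs) = c \<odot>\<^bsub>P\<^esub> ?ev zs"
    if "zs \<in> ?L" "c \<in> carrier K" for zs c
    using that
  proof induction
    case (Cons p zs)
    then show ?case using lift(2)[of zs] cl assms(4)
      by (auto simp: formal_sum_eval_def P.smult_r_distr bilinear_maps_def linear_maps_def)
  qed (simp add: formal_sum_eval_def)
  show "tensor_lift P \<beta> \<in> linear_maps K (tensor K M N) P"
    unfolding linear_maps_def
  proof (intro CollectI conjI ballI funcsetI)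
    fix s assume "s \<in> carrier (tensor K M N)"
    then obtain xs where xs: "xs \<in> ?L" "s = ?cl xs" by (rule tensor_carrier_cases)
    then show "tensor_lift P \<beta> s \<in> carrier P" by (simp only: lift)
    fix c assume "c \<in> carrier K"
    with xs show "tensor_lift P \<beta> (c \<odot>\<^bsub>tensor K M N\<^esub> s) = c \<odot>\<^bsub>P\<^esub> tensor_lift P \<beta> s"
      by (simp only: tensor_smult_class[OF assms(1,2)] lift sL sev)
  next
    fix s t assume "s \<in> carrier (tensor K M N)" "t \<in> carrier (tensor K M N)"
    then obtain xs ys where *: "xs \<in> ?L" "s = ?cl xs" "ys \<in> ?L" "t = ?cl ys"
      by (metis tensor_carrier_cases)
    then have "xs @ ys \<in> ?L" by simp
    with * show "tensor_lift P \<beta> (s \<oplus>\<^bsub>tensor K M N\<^esub> t)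
        = tensor_lift P \<beta> s \<oplus>\<^bsub>P\<^esub> tensor_lift P \<beta> t"
      by (simp only: tensor_add_class lift app)
  qed
  show "tensor_lift P \<beta> (pure_tensor K M N a b) = \<beta> a b" if "a \<in> carrier M" "b \<in> carrier N"
    unfolding pure_tensor_def using that by (subst lift) (auto simp: formal_sum_eval_def cl)
  show "f t = tensor_lift P \<beta> t"
    if f: "f \<in> linear_maps K (tensor K M N) P"
      and fb: "\<And>a b. \<lbrakk>a \<in> carrier M; b \<in> carrier N\<rbrakk> \<Longrightarrow> f (pure_tensor K M N a b) = \<beta> a b"
      and "t \<in> carrier (tensor K M N)"
  proof -
    obtain xs where xs: "xs \<in> ?L" "t = ?cl xs" using \<open>t \<in> _\<close> by (rule tensor_carrier_cases)
    have "f (?cl xs) = ?ev xs" using xs(1)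
    proof induction
      case Nil
      have "f (\<zero>\<^bsub>K\<^esub> \<odot>\<^bsub>tensor K M N\<^esub> \<zero>\<^bsub>tensor K M N\<^esub>) = \<zero>\<^bsub>K\<^esub> \<odot>\<^bsub>P\<^esub> f \<zero>\<^bsub>tensor K M N\<^esub>"
        and "f \<zero>\<^bsub>tensor K M N\<^esub> \<in> carrier P"
        using f T.zero_closed M.R.zero_closed unfolding linear_maps_def by blast+
      then have "f \<zero>\<^bsub>tensor K M N\<^esub> = \<zero>\<^bsub>P\<^esub>" by simp
      then show ?case by (simp add: tensor_def formal_sum_eval_def)
    next
      case (Cons p zs)
      obtain a b where p: "p = (a, b)" "a \<in> carrier M" "b \<in> carrier N" using Cons by auto
      have "?cl (p # zs) = pure_tensor K M N a b \<oplus>\<^bsub>tensor K M N\<^esub> ?cl zs"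
        using Cons p unfolding pure_tensor_def by (subst tensor_add_class) auto
      moreover have "pure_tensor K M N a b \<in> carrier (tensor K M N)"
        "?cl zs \<in> carrier (tensor K M N)"
        using Cons p unfolding pure_tensor_def by (auto intro!: tensor_class_carrier)
      ultimately have "f (?cl (p # zs)) = \<beta> a b \<oplus>\<^bsub>P\<^esub> ?ev zs"
        using f fb[OF p(2,3)] Cons.IH unfolding linear_maps_def by auto
      then show ?case using p by (simp add: formal_sum_eval_def)
    qed
    then show ?thesis using xs lift by simp
  qed
qed


section \<open>Cogroupoids\<close>

text \<open>All the algebras \<open>C X Y\<close> have their elements in one type; their carriers are unrelated.
  \<open>\<Delta> X Y Z\<close> is \<open>\<Delta>\<^sub>X\<^sub>,\<^sub>Y\<^sup>Z\<close>.\<close>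

locale cocategory = field K for K (structure) +
  fixes ob :: "'o set"
    and C :: "'o \<Rightarrow> 'o \<Rightarrow> ('k, 'a) module"
    and \<Delta> :: "'o \<Rightarrow> 'o \<Rightarrow> 'o \<Rightarrow> 'a \<Rightarrow> ('a \<times> 'a) list set"
    and \<epsilon> :: "'o \<Rightarrow> 'a \<Rightarrow> 'k"
  assumes algebra: "\<lbrakk>X \<in> ob; Y \<in> ob\<rbrakk> \<Longrightarrow> unital_algebra K (C X Y)"
    and comult_hom: "\<lbrakk>X \<in> ob; Y \<in> ob; Z \<in> ob\<rbrakk>
      \<Longrightarrow> \<Delta> X Y Z \<in> algebra_homs K (C X Y) (tensor K (C X Z) (C Z Y))"
    and counit_hom: "X \<in> ob \<Longrightarrow> \<epsilon> X \<in> algebra_homs K (C X X) (scalar_algebra K)"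
    and coassoc: "\<lbrakk>X \<in> ob; Y \<in> ob; Z \<in> ob; T \<in> ob; a \<in> carrier (C X Y)\<rbrakk>
      \<Longrightarrow> tensor_assoc K (C X T) (C T Z) (C Z Y)
            (tensor_map K (tensor K (C X T) (C T Z)) (C Z Y) (\<Delta> X Z T) (\<lambda>x. x) (\<Delta> X Y Z a))
        = tensor_map K (C X T) (tensor K (C T Z) (C Z Y)) (\<lambda>x. x) (\<Delta> T Y Z) (\<Delta> X Y T a)"
    and counit_right: "\<lbrakk>X \<in> ob; Y \<in> ob; a \<in> carrier (C X Y)\<rbrakk>
      \<Longrightarrow> tensor_runit (C X Y)
            (tensor_map K (C X Y) (scalar_algebra K) (\<lambda>x. x) (\<epsilon> Y) (\<Delta> X Y Y a)) = a"
    and counit_left: "\<lbrakk>X \<in> ob; Y \<in> ob; a \<in> carrier (C X Y)\<rbrakk>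
      \<Longrightarrow> tensor_lunit (C X Y)
            (tensor_map K (scalar_algebra K) (C X Y) (\<epsilon> X) (\<lambda>x. x) (\<Delta> X Y X a)) = a"

locale cogroupoid = cocategory K ob C \<Delta> \<epsilon>
  for K (structure) and ob :: "'o set" and C :: "'o \<Rightarrow> 'o \<Rightarrow> ('k, 'a) module" and \<Delta> \<epsilon> +
  fixes S :: "'o \<Rightarrow> 'o \<Rightarrow> 'a \<Rightarrow> 'a"
  assumes antipode_linear: "\<lbrakk>X \<in> ob; Y \<in> ob\<rbrakk> \<Longrightarrow> S X Y \<in> linear_maps K (C X Y) (C Y X)"
    and antipode_right: "\<lbrakk>X \<in> ob; Y \<in> ob; a \<in> carrier (C X X)\<rbrakk>
      \<Longrightarrow> mult_map (C X Y) (tensor_map K (C X Y) (C X Y) (\<lambda>x. x) (S Y X) (\<Delta> X X Y a))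
        = \<epsilon> X a \<odot>\<^bsub>C X Y\<^esub> \<one>\<^bsub>C X Y\<^esub>"
    and antipode_left: "\<lbrakk>X \<in> ob; Y \<in> ob; a \<in> carrier (C X X)\<rbrakk>
      \<Longrightarrow> mult_map (C Y X) (tensor_map K (C Y X) (C Y X) (S X Y) (\<lambda>x. x) (\<Delta> X X Y a))
        = \<epsilon> X a \<odot>\<^bsub>C Y X\<^esub> \<one>\<^bsub>C Y X\<^esub>"


section \<open>Weak Hopf algebras\<close>

locale coalgebra = field K + module K H for K and H (structure) +
  fixes \<Delta> :: "'h \<Rightarrow> ('h \<times> 'h) list set" and \<epsilon> :: "'h \<Rightarrow> 'k"
  assumes comult_linear: "\<Delta> \<in> linear_maps K H (tensor K H H)"
    and counit_linear: "\<epsilon> \<in> linear_maps K H (scalar_algebra K)"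
    and coassoc: "x \<in> carrier H
      \<Longrightarrow> tensor_assoc K H H H (tensor_map K (tensor K H H) H \<Delta> (\<lambda>x. x) (\<Delta> x))
        = tensor_map K H (tensor K H H) (\<lambda>x. x) \<Delta> (\<Delta> x)"
    and counit_right: "x \<in> carrier H
      \<Longrightarrow> tensor_runit H (tensor_map K H (scalar_algebra K) (\<lambda>x. x) \<epsilon> (\<Delta> x)) = x"
    and counit_left: "x \<in> carrier H
      \<Longrightarrow> tensor_lunit H (tensor_map K (scalar_algebra K) H \<epsilon> (\<lambda>x. x) (\<Delta> x)) = x"

text \<open>The identities in \<open>H \<otimes> H \<otimes> H\<close> for \<open>\<Delta>(1)\<close> are read in \<open>H \<otimes> (H \<otimes> H)\<close>; in
  \<open>antipode_conv\<close> the bracketing \<open>(\<Delta> \<otimes> 1) \<Delta>(x)\<close> is used, so that \<open>t\<close> runs over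
  \<open>x\<^sub>(\<^sub>1\<^sub>) \<otimes> x\<^sub>(\<^sub>2\<^sub>)\<close>.\<close>

locale weak_hopf_algebra = unital_algebra K H + coalgebra K H \<Delta> \<epsilon>
  for K and H (structure) and \<Delta> :: "'h \<Rightarrow> ('h \<times> 'h) list set" and \<epsilon> :: "'h \<Rightarrow> 'k" +
  fixes S :: "'h \<Rightarrow> 'h"
  assumes antipode_linear: "S \<in> linear_maps K H H"
    and comult_mult: "\<lbrakk>x \<in> carrier H; y \<in> carrier H\<rbrakk>
      \<Longrightarrow> \<Delta> (x \<otimes>\<^bsub>H\<^esub> y) = \<Delta> x \<otimes>\<^bsub>tensor K H H\<^esub> \<Delta> y"
    and counit_mult1: "\<lbrakk>x \<in> carrier H; y \<in> carrier H; z \<in> carrier H\<rbrakk>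
      \<Longrightarrow> \<epsilon> (x \<otimes>\<^bsub>H\<^esub> y \<otimes>\<^bsub>H\<^esub> z)
        = tensor_lift (scalar_algebra K) (\<lambda>y1 y2. \<epsilon> (x \<otimes>\<^bsub>H\<^esub> y1) \<otimes>\<^bsub>K\<^esub> \<epsilon> (y2 \<otimes>\<^bsub>H\<^esub> z)) (\<Delta> y)"
    and counit_mult2: "\<lbrakk>x \<in> carrier H; y \<in> carrier H; z \<in> carrier H\<rbrakk>
      \<Longrightarrow> \<epsilon> (x \<otimes>\<^bsub>H\<^esub> y \<otimes>\<^bsub>H\<^esub> z)
        = tensor_lift (scalar_algebra K) (\<lambda>y1 y2. \<epsilon> (x \<otimes>\<^bsub>H\<^esub> y2) \<otimes>\<^bsub>K\<^esub> \<epsilon> (y1 \<otimes>\<^bsub>H\<^esub> z)) (\<Delta> y)"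
    and comult_one1:
      "tensor_assoc K H H H (tensor_map K (tensor K H H) H \<Delta> (\<lambda>x. x) (\<Delta> \<one>\<^bsub>H\<^esub>))
        = tensor_assoc K H H H (pure_tensor K (tensor K H H) H (\<Delta> \<one>\<^bsub>H\<^esub>) \<one>\<^bsub>H\<^esub>)
            \<otimes>\<^bsub>tensor K H (tensor K H H)\<^esub> pure_tensor K H (tensor K H H) \<one>\<^bsub>H\<^esub> (\<Delta> \<one>\<^bsub>H\<^esub>)"
    and comult_one2:
      "tensor_assoc K H H H (tensor_map K (tensor K H H) H \<Delta> (\<lambda>x. x) (\<Delta> \<one>\<^bsub>H\<^esub>))
        = pure_tensor K H (tensor K H H) \<one>\<^bsub>H\<^esub> (\<Delta> \<one>\<^bsub>H\<^esub>)
            \<otimes>\<^bsub>tensor K H (tensor K H H)\<^esub>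
            tensor_assoc K H H H (pure_tensor K (tensor K H H) H (\<Delta> \<one>\<^bsub>H\<^esub>) \<one>\<^bsub>H\<^esub>)"
    and antipode_right: "x \<in> carrier H
      \<Longrightarrow> tensor_lift H (\<lambda>x1 x2. x1 \<otimes>\<^bsub>H\<^esub> S x2) (\<Delta> x)
        = tensor_lift H (\<lambda>e1 e2. \<epsilon> (e1 \<otimes>\<^bsub>H\<^esub> x) \<odot>\<^bsub>H\<^esub> e2) (\<Delta> \<one>\<^bsub>H\<^esub>)"
    and antipode_left: "x \<in> carrier H
      \<Longrightarrow> tensor_lift H (\<lambda>x1 x2. S x1 \<otimes>\<^bsub>H\<^esub> x2) (\<Delta> x)
        = tensor_lift H (\<lambda>e1 e2. \<epsilon> (x \<otimes>\<^bsub>H\<^esub> e2) \<odot>\<^bsub>H\<^esub> e1) (\<Delta> \<one>\<^bsub>H\<^esub>)"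
    and antipode_conv: "x \<in> carrier H
      \<Longrightarrow> tensor_lift H
            (\<lambda>t x3. tensor_lift H (\<lambda>x1 x2. S x1 \<otimes>\<^bsub>H\<^esub> x2 \<otimes>\<^bsub>H\<^esub> S x3) t)
            (tensor_map K (tensor K H H) H \<Delta> (\<lambda>x. x) (\<Delta> x)) = S x"


section \<open>The direct sum of the algebras of a cogroupoid\<close>

text \<open>Direct sum of algebras over a finite index set, with componentwise operations.\<close>

definition direct_sum :: "'i set \<Rightarrow> ('i \<Rightarrow> ('k, 'a) module) \<Rightarrow> ('k, 'i \<Rightarrow> 'a) module"
  where "direct_sum I A =
    \<lparr>carrier = (\<Pi>\<^sub>E i\<in>I. carrier (A i)),
     mult = (\<lambda>x y. \<lambda>i\<in>I. x i \<otimes>\<^bsub>A i\<^esub> y i),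
     one = (\<lambda>i\<in>I. \<one>\<^bsub>A i\<^esub>),
     zero = (\<lambda>i\<in>I. \<zero>\<^bsub>A i\<^esub>),
     add = (\<lambda>x y. \<lambda>i\<in>I. x i \<oplus>\<^bsub>A i\<^esub> y i),
     smult = (\<lambda>c x. \<lambda>i\<in>I. c \<odot>\<^bsub>A i\<^esub> x i)\<rparr>"

definition direct_sum_incl :: "'i set \<Rightarrow> ('i \<Rightarrow> ('k, 'a) module) \<Rightarrow> 'i \<Rightarrow> 'a \<Rightarrow> 'i \<Rightarrow> 'a"
  where "direct_sum_incl I A i a = (\<lambda>j\<in>I. if j = i then a else \<zero>\<^bsub>A j\<^esub>)"

text \<open>The summands are indexed by pairs of positions \<open>(i, j)\<close>, so objects may be repeated
  among \<open>X 1, \<dots>, X n\<close>.\<close>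

definition cog_index :: "nat \<Rightarrow> (nat \<times> nat) set"
  where "cog_index n = {1..n} \<times> {1..n}"

definition cog_block ::
  "('o \<Rightarrow> 'o \<Rightarrow> ('k, 'a) module) \<Rightarrow> (nat \<Rightarrow> 'o) \<Rightarrow> nat \<times> nat \<Rightarrow> ('k, 'a) module"
  where "cog_block C X = (\<lambda>(i, j). C (X i) (X j))"

definition cog_algebra ::
  "('o \<Rightarrow> 'o \<Rightarrow> ('k, 'a) module) \<Rightarrow> nat \<Rightarrow> (nat \<Rightarrow> 'o) \<Rightarrow> ('k, nat \<times> nat \<Rightarrow> 'a) module"
  where "cog_algebra C n X = direct_sum (cog_index n) (cog_block C X)"

abbreviation cog_incl ::
  "('o \<Rightarrow> 'o \<Rightarrow> ('k, 'a) module) \<Rightarrow> nat \<Rightarrow> (nat \<Rightarrow> 'o) \<Rightarrow> nat \<times> nat \<Rightarrow> 'a \<Rightarrow> nat \<times> nat \<Rightarrow> 'a"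
  where "cog_incl C n X \<equiv> direct_sum_incl (cog_index n) (cog_block C X)"

text \<open>The three structure maps are given on an arbitrary element \<open>h\<close>, the sum of its components
  \<open>h (i, j)\<close>; the inclusion of \<open>C(i,l) \<otimes> C(l,j)\<close> in \<open>H \<otimes> H\<close> is the tensor product of the
  inclusions of the two factors.\<close>

definition cog_comult ::
  "('k, 'm) ring_scheme \<Rightarrow> ('o \<Rightarrow> 'o \<Rightarrow> ('k, 'a) module)
    \<Rightarrow> ('o \<Rightarrow> 'o \<Rightarrow> 'o \<Rightarrow> 'a \<Rightarrow> ('a \<times> 'a) list set) \<Rightarrow> nat \<Rightarrow> (nat \<Rightarrow> 'o)
    \<Rightarrow> (nat \<times> nat \<Rightarrow> 'a) \<Rightarrow> ((nat \<times> nat \<Rightarrow> 'a) \<times> (nat \<times> nat \<Rightarrow> 'a)) list set"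
  where "cog_comult K C \<Delta> n X h =
    (let H = cog_algebra C n X; HH = tensor K H H in
      \<Oplus>\<^bsub>HH\<^esub>i\<in>{1..n}. \<Oplus>\<^bsub>HH\<^esub>j\<in>{1..n}. \<Oplus>\<^bsub>HH\<^esub>l\<in>{1..n}.
        tensor_map K H H (cog_incl C n X (i, l)) (cog_incl C n X (l, j))
          (\<Delta> (X i) (X j) (X l) (h (i, j))))"

definition cog_counit ::
  "('k, 'm) ring_scheme \<Rightarrow> ('o \<Rightarrow> 'a \<Rightarrow> 'k) \<Rightarrow> nat \<Rightarrow> (nat \<Rightarrow> 'o) \<Rightarrow> (nat \<times> nat \<Rightarrow> 'a) \<Rightarrow> 'k"
  where "cog_counit K \<epsilon> n X h =
    (\<Oplus>\<^bsub>K\<^esub>i\<in>{1..n}. \<Oplus>\<^bsub>K\<^esub>j\<in>{1..n}. if i = j then \<epsilon> (X i) (h (i, j)) else \<zero>\<^bsub>K\<^esub>)"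

definition cog_antipode ::
  "('o \<Rightarrow> 'o \<Rightarrow> ('k, 'a) module) \<Rightarrow> ('o \<Rightarrow> 'o \<Rightarrow> 'a \<Rightarrow> 'a) \<Rightarrow> nat \<Rightarrow> (nat \<Rightarrow> 'o)
    \<Rightarrow> (nat \<times> nat \<Rightarrow> 'a) \<Rightarrow> (nat \<times> nat \<Rightarrow> 'a)"
  where "cog_antipode C S n X h =
    (let H = cog_algebra C n X in
      \<Oplus>\<^bsub>H\<^esub>i\<in>{1..n}. \<Oplus>\<^bsub>H\<^esub>j\<in>{1..n}. cog_incl C n X (j, i) (S (X i) (X j) (h (i, j))))"

end

theory Submission
  imports Defs
begin

text \<open>Write \<open>e\<^sub>i\<^sub>j\<close> for the unit of \<open>C(i,j)\<close>, seen in \<open>H\<close>. These are central orthogonal idempotents with sum \<open>1\<close>, and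
the product of elements of two different summands is \<open>0\<close>. Apart from the identities for \<open>\<Delta>(1)\<close>, every axiom
to be verified is an equality of maps that are linear in each of their arguments in \<open>H\<close>, so it is enough
to check it on elements of the summands (\<open>total_linear_eqI\<close>). There the structure maps are sums of the structure
maps of the cogroupoid followed by inclusions, and orthogonality kills all but a few terms: what
is left is an axiom of the cogroupoid.

For coassociativity (\<open>total_coassoc\<close>) no term vanishes: for \<open>a\<close> in \<open>C(i,j)\<close> both sides are double sums
over positions \<open>k\<close> and \<open>l\<close> with values in \<open>C(i,k) \<otimes> C(k,l) \<otimes> C(l,j)\<close>, and they agree term by term by
coassociativity in the cogroupoid.

The comultiplication of \<open>H\<close> is multiplicative because each \<open>\<Delta>\<^sub>i\<^sub>j\<^sup>l\<close> is, and because the images of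
\<open>C(i,l) \<otimes> C(l,j)\<close> for different triples \<open>(i,j,l)\<close> multiply to \<open>0\<close> (\<open>total_comult_mult\<close>). It does not
preserve units: \<open>\<Delta>(1)\<close> is the sum of all \<open>e\<^sub>i\<^sub>l \<otimes> e\<^sub>l\<^sub>j\<close>, which is not \<open>1 \<otimes> 1\<close> in general. Orthogonality
turns each of the two products of \<open>\<Delta>(1) \<otimes> 1\<close> and \<open>1 \<otimes> \<Delta>(1)\<close> into the sum of all
\<open>e\<^sub>i\<^sub>l \<otimes> e\<^sub>l\<^sub>j \<otimes> e\<^sub>j\<^sub>q\<close>, which is also \<open>(\<Delta> \<otimes> 1) \<Delta>(1)\<close> (\<open>total_comult_one_split\<close>,
\<open>total_comult_one_product\<close>).

The counit is multiplicative on each \<open>C(i,i)\<close> and zero off the diagonal. Hence for \<open>y\<close> in \<open>C(i,j)\<close> both sides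
of \<open>\<epsilon>(xyz) = \<epsilon>(xy\<^sub>(\<^sub>1\<^sub>)) \<epsilon>(y\<^sub>(\<^sub>2\<^sub>)z)\<close> vanish unless \<open>i = j\<close>, and then both are
\<open>\<epsilon>\<^sub>i(x\<^sub>i\<^sub>i) \<epsilon>\<^sub>i(y) \<epsilon>\<^sub>i(z\<^sub>i\<^sub>i)\<close> (\<open>total_counit_mult\<close>).

For \<open>a\<close> in \<open>C(i,j)\<close> the element \<open>S(a\<^sub>(\<^sub>1\<^sub>)) a\<^sub>(\<^sub>2\<^sub>)\<close> is zero if \<open>i \<noteq> j\<close>, and otherwise the antipode axiom of the
cogroupoid gives \<open>\<epsilon>\<^sub>i(a)\<close> times the sum of all \<open>e\<^sub>l\<^sub>i\<close> (\<open>lift_antipode_left_incl\<close>); evaluation of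
\<open>1\<^sub>(\<^sub>1\<^sub>) \<epsilon>(a 1\<^sub>(\<^sub>2\<^sub>))\<close> on \<open>\<Delta>(1)\<close> gives the same. In \<open>S(a\<^sub>(\<^sub>1\<^sub>)) a\<^sub>(\<^sub>2\<^sub>) S(a\<^sub>(\<^sub>3\<^sub>))\<close> the factor \<open>S(a\<^sub>(\<^sub>3\<^sub>))\<close> selects the single idempotent
\<open>e\<^sub>j\<^sub>i\<close>, and the counit axiom of the cogroupoid leaves \<open>S(a)\<close> (\<open>total_antipode_conv\<close>).

The tensor products are quotients of formal sums, so the first part of the text derives what is needed
of them from the universal property: uniqueness and functoriality of induced maps, bilinearity of
the product of tensors, and naturality of the associator.\<close>

section \<open>Finite sums in a commutative monoid\<close>

context abelian_monoid
begin

lemma finsum_swap: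
  assumes "finite A" "finite B" "\<And>i j. \<lbrakk>i \<in> A; j \<in> B\<rbrakk> \<Longrightarrow> f i j \<in> carrier G"
  shows "(\<Oplus>i\<in>A. \<Oplus>j\<in>B. f i j) = (\<Oplus>j\<in>B. \<Oplus>i\<in>A. f i j)"
  using assms(1,3)
proof (induction A)
  case empty
  then show ?case by (simp add: add.finprod_one_eqI)
next
  case (insert a A)
  have "(\<Oplus>j\<in>B. \<Oplus>i\<in>insert a A. f i j) = (\<Oplus>j\<in>B. f a j \<oplus> (\<Oplus>i\<in>A. f i j))"
    using insert by (intro finsum_cong') (auto simp: Pi_def)
  also have "\<dots> = (\<Oplus>j\<in>B. f a j) \<oplus> (\<Oplus>j\<in>B. \<Oplus>i\<in>A. f i j)"
    using insert by (intro finsum_addf) (auto simp: Pi_def)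
  finally show ?case
    using insert by (subst finsum_insert) (auto simp: Pi_def)
qed

lemma finsum_single:
  assumes "finite A" "a \<in> A" "f a \<in> carrier G" "\<And>i. \<lbrakk>i \<in> A; i \<noteq> a\<rbrakk> \<Longrightarrow> f i = \<zero>"
  shows "(\<Oplus>i\<in>A. f i) = f a"
proof -
  have "(\<Oplus>i\<in>{a}. f i) = (\<Oplus>i\<in>A. f i)"
    using assms by (intro add.finprod_mono_neutral_cong_left) (auto simp: Pi_def, metis zero_closed)
  then show ?thesis using assms by simp
qed

end

section \<open>Linear and bilinear maps\<close>

lemma linear_mapsI:
  assumes "\<And>x. x \<in> carrier M \<Longrightarrow> f x \<in> carrier N"
    and "\<And>x y. \<lbrakk>x \<in> carrier M; y \<in> carrier M\<rbrakk> \<Longrightarrow> f (x \<oplus>\<^bsub>M\<^esub> y) = f x \<oplus>\<^bsub>N\<^esub> f y"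
    and "\<And>c x. \<lbrakk>c \<in> carrier K; x \<in> carrier M\<rbrakk> \<Longrightarrow> f (c \<odot>\<^bsub>M\<^esub> x) = c \<odot>\<^bsub>N\<^esub> f x"
  shows "f \<in> linear_maps K M N"
  using assms by (auto simp: linear_maps_def)

lemma linear_maps_closed:
  "\<lbrakk>f \<in> linear_maps K M N; x \<in> carrier M\<rbrakk> \<Longrightarrow> f x \<in> carrier N"
  by (auto simp: linear_maps_def)

lemma linear_maps_add:
  "\<lbrakk>f \<in> linear_maps K M N; x \<in> carrier M; y \<in> carrier M\<rbrakk> \<Longrightarrow> f (x \<oplus>\<^bsub>M\<^esub> y) = f x \<oplus>\<^bsub>N\<^esub> f y"
  by (auto simp: linear_maps_def)

lemma linear_maps_smult:
  "\<lbrakk>f \<in> linear_maps K M N; c \<in> carrier K; x \<in> carrier M\<rbrakk> \<Longrightarrow> f (c \<odot>\<^bsub>M\<^esub> x) = c \<odot>\<^bsub>N\<^esub> f x"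
  by (auto simp: linear_maps_def)

lemma linear_maps_cong:
  assumes "module K M" "f \<in> linear_maps K M N" "\<And>x. x \<in> carrier M \<Longrightarrow> f x = g x"
  shows "g \<in> linear_maps K M N"
proof -
  interpret M: module K M by fact
  show ?thesis
    by (rule linear_mapsI) (use assms(2) in \<open>simp_all add: assms(3)[symmetric] linear_maps_closed
        linear_maps_add linear_maps_smult\<close>)
qed

lemma linear_maps_zero:
  assumes "module K M" "module K N" "f \<in> linear_maps K M N"
  shows "f \<zero>\<^bsub>M\<^esub> = \<zero>\<^bsub>N\<^esub>"
proof -
  interpret M: module K M by fact
  interpret N: module K N by fact
  have "f (\<zero>\<^bsub>K\<^esub> \<odot>\<^bsub>M\<^esub> \<zero>\<^bsub>M\<^esub>) = \<zero>\<^bsub>K\<^esub> \<odot>\<^bsub>N\<^esub> f \<zero>\<^bsub>M\<^esub>"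
    using assms(3) by (rule linear_maps_smult) auto
  then show ?thesis using linear_maps_closed[OF assms(3)] by simp
qed

lemma linear_maps_finsum:
  assumes "module K M" "module K N" "f \<in> linear_maps K M N"
    and "\<And>i. i \<in> A \<Longrightarrow> g i \<in> carrier M"
  shows "f (\<Oplus>\<^bsub>M\<^esub>i\<in>A. g i) = (\<Oplus>\<^bsub>N\<^esub>i\<in>A. f (g i))"
proof -
  interpret M: module K M by fact
  interpret N: module K N by fact
  show ?thesis using assms(4)
  proof (induction A rule: infinite_finite_induct)
    case (insert a A)
    have g: "g \<in> A \<rightarrow> carrier M" "(\<lambda>i. f (g i)) \<in> A \<rightarrow> carrier N"
      using insert.prems linear_maps_closed[OF assms(3)] by auto
    then show ?case
      using insert linear_maps_closed[OF assms(3)]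
      by (simp add: linear_maps_add[OF assms(3)] M.finsum_insert)
  qed (simp_all add: linear_maps_zero[OF assms(1-3)])
qed

lemma linear_maps_id: "(\<lambda>x. x) \<in> linear_maps K M M"
  by (simp add: linear_maps_def)

lemma linear_maps_comp:
  "\<lbrakk>f \<in> linear_maps K N P; g \<in> linear_maps K M N\<rbrakk> \<Longrightarrow> (\<lambda>x. f (g x)) \<in> linear_maps K M P"
  by (auto simp: linear_maps_def Pi_def)

lemma zero_map_linear:
  assumes "module K N"
  shows "(\<lambda>x. \<zero>\<^bsub>N\<^esub>) \<in> linear_maps K M N"
proof -
  interpret N: module K N by fact
  show ?thesis by (rule linear_mapsI) (auto simp: N.smult_r_null)
qed

lemma smult_linear:
  assumes "module K N" "c \<in> carrier K"
  shows "(\<lambda>x. c \<odot>\<^bsub>N\<^esub> x) \<in> linear_maps K N N"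
proof -
  interpret N: module K N by fact
  show ?thesis
    by (rule linear_mapsI) (use assms(2) in
        \<open>auto simp: N.smult_r_distr N.smult_assoc1[symmetric] N.R.m_comm\<close>)
qed

lemma finsum_linear:
  assumes "module K M" "module K N" "\<And>i. i \<in> A \<Longrightarrow> f i \<in> linear_maps K M N"
  shows "(\<lambda>x. \<Oplus>\<^bsub>N\<^esub>i\<in>A. f i x) \<in> linear_maps K M N"
proof -
  interpret M: module K M by fact
  interpret N: module K N by fact
  have cl: "f i x \<in> carrier N" if "i \<in> A" "x \<in> carrier M" for i x
    using linear_maps_closed[OF assms(3)] that by auto
  show ?thesis
  proof (rule linear_mapsI)
    fix x assume x: "x \<in> carrier M"
    then show "(\<Oplus>\<^bsub>N\<^esub>i\<in>A. f i x) \<in> carrier N" by (auto intro: N.finsum_closed simp: cl)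
    fix c assume c: "c \<in> carrier K"
    have "c \<odot>\<^bsub>N\<^esub> (\<Oplus>\<^bsub>N\<^esub>i\<in>A. f i x) = (\<Oplus>\<^bsub>N\<^esub>i\<in>A. c \<odot>\<^bsub>N\<^esub> f i x)"
      using c cl x by (intro linear_maps_finsum[OF assms(2,2) smult_linear[OF assms(2)]]) auto
    also have "\<dots> = (\<Oplus>\<^bsub>N\<^esub>i\<in>A. f i (c \<odot>\<^bsub>M\<^esub> x))"
      using c x cl by (intro N.finsum_cong') (auto simp: linear_maps_smult[OF assms(3)])
    finally show "(\<Oplus>\<^bsub>N\<^esub>i\<in>A. f i (c \<odot>\<^bsub>M\<^esub> x)) = c \<odot>\<^bsub>N\<^esub> (\<Oplus>\<^bsub>N\<^esub>i\<in>A. f i x)" by simp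
  next
    fix x y assume xy: "x \<in> carrier M" "y \<in> carrier M"
    have "(\<Oplus>\<^bsub>N\<^esub>i\<in>A. f i (x \<oplus>\<^bsub>M\<^esub> y)) = (\<Oplus>\<^bsub>N\<^esub>i\<in>A. f i x \<oplus>\<^bsub>N\<^esub> f i y)"
      using xy cl by (intro N.finsum_cong') (auto simp: linear_maps_add[OF assms(3)])
    then show "(\<Oplus>\<^bsub>N\<^esub>i\<in>A. f i (x \<oplus>\<^bsub>M\<^esub> y)) = (\<Oplus>\<^bsub>N\<^esub>i\<in>A. f i x) \<oplus>\<^bsub>N\<^esub> (\<Oplus>\<^bsub>N\<^esub>i\<in>A. f i y)"
      using xy cl by (simp add: N.finsum_addf Pi_def)
  qed
qed

lemma module_scalar_algebra:
  assumes "field K"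
  shows "module K (scalar_algebra K)"
proof -
  interpret field K by fact
  show ?thesis
    by (rule moduleI)
      (auto simp: scalar_algebra_def l_distr r_distr m_assoc is_cring l_neg
        intro!: abelian_groupI intro: a_assoc a_comm a_inv_closed)
qed

lemma scalar_multiples_linear:
  assumes "module K N" "f \<in> linear_maps K M (scalar_algebra K)" "p \<in> carrier N"
  shows "(\<lambda>x. f x \<odot>\<^bsub>N\<^esub> p) \<in> linear_maps K M N"
proof -
  interpret N: module K N by fact
  have cl: "f x \<in> carrier K" if "x \<in> carrier M" for x
    using linear_maps_closed[OF assms(2) that] by (simp add: scalar_algebra_def)
  show ?thesis
    by (rule linear_mapsI) (use assms cl in \<open>auto simp: linear_maps_add[OF assms(2)]
       linear_maps_smult[OF assms(2)] scalar_algebra_def N.smult_l_distr N.smult_assoc1\<close>)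
qed

lemma bilinear_mapsI:
  assumes "\<And>a. a \<in> carrier M \<Longrightarrow> (\<lambda>b. \<beta> a b) \<in> linear_maps K N P"
    and "\<And>b. b \<in> carrier N \<Longrightarrow> (\<lambda>a. \<beta> a b) \<in> linear_maps K M P"
  shows "\<beta> \<in> bilinear_maps K M N P"
  using assms by (auto simp: bilinear_maps_def)

lemma bilinear_maps_right:
  "\<lbrakk>\<beta> \<in> bilinear_maps K M N P; a \<in> carrier M\<rbrakk> \<Longrightarrow> (\<lambda>b. \<beta> a b) \<in> linear_maps K N P"
  by (auto simp: bilinear_maps_def)

lemma bilinear_maps_left:
  "\<lbrakk>\<beta> \<in> bilinear_maps K M N P; b \<in> carrier N\<rbrakk> \<Longrightarrow> (\<lambda>a. \<beta> a b) \<in> linear_maps K M P"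
  by (auto simp: bilinear_maps_def)

lemma bilinear_maps_closed:
  "\<lbrakk>\<beta> \<in> bilinear_maps K M N P; a \<in> carrier M; b \<in> carrier N\<rbrakk> \<Longrightarrow> \<beta> a b \<in> carrier P"
  by (meson bilinear_maps_right linear_maps_closed)

lemma bilinear_maps_precomp:
  assumes "\<beta> \<in> bilinear_maps K M N P" "f \<in> linear_maps K M' M" "g \<in> linear_maps K N' N"
  shows "(\<lambda>a b. \<beta> (f a) (g b)) \<in> bilinear_maps K M' N' P"
proof (rule bilinear_mapsI)
  fix a assume "a \<in> carrier M'"
  then show "(\<lambda>b. \<beta> (f a) (g b)) \<in> linear_maps K N' P"
    using linear_maps_comp[OF bilinear_maps_right[OF assms(1) linear_maps_closed[OF assms(2)]] assms(3)]
    by blast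
next
  fix b assume b: "b \<in> carrier N'"
  show "(\<lambda>a. \<beta> (f a) (g b)) \<in> linear_maps K M' P"
    using linear_maps_comp[OF bilinear_maps_left[OF assms(1) linear_maps_closed[OF assms(3) b]]
        assms(2)] .
qed

lemma bilinear_maps_postcomp:
  assumes "h \<in> linear_maps K P Q" "\<beta> \<in> bilinear_maps K M N P"
  shows "(\<lambda>a b. h (\<beta> a b)) \<in> bilinear_maps K M N Q"
  using assms by (intro bilinear_mapsI linear_maps_comp[OF assms(1)])
    (auto intro: bilinear_maps_left bilinear_maps_right)

lemma smult_bilinear:
  assumes "module K N"
  shows "smult N \<in> bilinear_maps K (scalar_algebra K) N N"
proof (rule bilinear_mapsI)
  fix a assume "a \<in> carrier (scalar_algebra K)"
  then show "(\<lambda>b. a \<odot>\<^bsub>N\<^esub> b) \<in> linear_maps K N N"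
    using assms by (intro smult_linear) (auto simp: scalar_algebra_def)
next
  fix b assume "b \<in> carrier N"
  with assms show "(\<lambda>a. a \<odot>\<^bsub>N\<^esub> b) \<in> linear_maps K (scalar_algebra K) N"
    by (rule_tac scalar_multiples_linear[OF _ linear_maps_id])
qed

lemma bilinear_maps_flip:
  "\<beta> \<in> bilinear_maps K M N P \<Longrightarrow> (\<lambda>b a. \<beta> a b) \<in> bilinear_maps K N M P"
  by (auto simp: bilinear_maps_def)

lemma (in unital_algebra) mult_bilinear: "mult A \<in> bilinear_maps K A A A"
  by (intro bilinear_mapsI linear_mapsI) (auto simp: A.l_distr A.r_distr mult_smult_left mult_smult_right)

lemma bilinear_maps_finsum:
  assumes "module K M" "module K N" "module K P" and \<beta>: "\<beta> \<in> bilinear_maps K M N P"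
    and "\<And>i. i \<in> A \<Longrightarrow> f i \<in> carrier M" "\<And>j. j \<in> A' \<Longrightarrow> g j \<in> carrier N"
  shows "\<beta> (\<Oplus>\<^bsub>M\<^esub>i\<in>A. f i) (\<Oplus>\<^bsub>N\<^esub>j\<in>A'. g j) = (\<Oplus>\<^bsub>P\<^esub>i\<in>A. \<Oplus>\<^bsub>P\<^esub>j\<in>A'. \<beta> (f i) (g j))"
proof -
  interpret M: module K M by fact
  interpret N: module K N by fact
  interpret P: module K P by fact
  have g: "(\<Oplus>\<^bsub>N\<^esub>j\<in>A'. g j) \<in> carrier N" using assms(6) by (intro N.finsum_closed) auto
  have "\<beta> (\<Oplus>\<^bsub>M\<^esub>i\<in>A. f i) (\<Oplus>\<^bsub>N\<^esub>j\<in>A'. g j) = (\<Oplus>\<^bsub>P\<^esub>i\<in>A. \<beta> (f i) (\<Oplus>\<^bsub>N\<^esub>j\<in>A'. g j))"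
    by (rule linear_maps_finsum[OF assms(1,3) bilinear_maps_left[OF \<beta> g] assms(5)])
  also have "\<dots> = (\<Oplus>\<^bsub>P\<^esub>i\<in>A. \<Oplus>\<^bsub>P\<^esub>j\<in>A'. \<beta> (f i) (g j))"
    using assms(5,6) bilinear_maps_closed[OF \<beta>]
    by (intro P.finsum_cong'[OF HOL.refl] linear_maps_finsum[OF assms(2,3) bilinear_maps_right[OF \<beta>]]
        funcsetI P.finsum_closed) auto
  finally show ?thesis .
qed

section \<open>Maps out of a tensor product\<close>

lemma pure_tensor_bilinear:
  assumes "module K M" "module K N"
  shows "pure_tensor K M N \<in> bilinear_maps K M N (tensor K M N)"
proof -
  interpret M: module K M by fact
  interpret N: module K N by fact
  have eqI: "tensor_class K M N xs = tensor_class K M N ys" if "tensor_eq K M N xs ys" for xs ys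
    using that tensor_class_eq_iff tensor_eq_lists[OF assms] by blast
  show ?thesis
    by (intro bilinear_mapsI linear_mapsI)
      (auto simp: pure_tensor_def tensor_class_carrier tensor_add_class
        tensor_smult_class[OF assms]
        intro!: eqI tensor_eq.add_left tensor_eq.add_right tensor_eq.sym[OF tensor_eq.balanced])
qed

lemma pure_tensor_closed:
  "\<lbrakk>a \<in> carrier M; b \<in> carrier N\<rbrakk> \<Longrightarrow> pure_tensor K M N a b \<in> carrier (tensor K M N)"
  by (simp add: pure_tensor_def tensor_class_carrier)

text \<open>The pure tensors span, which is the uniqueness part of the universal property: \<open>f\<close> and \<open>g\<close> are
both the map induced by the bilinear map \<open>(a, b) \<mapsto> g(a \<otimes> b)\<close>.\<close>

lemma tensor_linear_eqI:
  assumes "module K M" "module K N" "module K P"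
    and f: "f \<in> linear_maps K (tensor K M N) P" and g: "g \<in> linear_maps K (tensor K M N) P"
    and eq: "\<And>a b. \<lbrakk>a \<in> carrier M; b \<in> carrier N\<rbrakk>
      \<Longrightarrow> f (pure_tensor K M N a b) = g (pure_tensor K M N a b)"
    and t: "t \<in> carrier (tensor K M N)"
  shows "f t = g t"
proof -
  have \<beta>: "(\<lambda>a b. g (pure_tensor K M N a b)) \<in> bilinear_maps K M N P"
    by (rule bilinear_maps_postcomp[OF g pure_tensor_bilinear]) fact+
  show ?thesis
    using tensor_universal(3)[OF assms(1-3) \<beta> f eq t] tensor_universal(3)[OF assms(1-3) \<beta> g HOL.refl t]
    by simp
qed

lemma tensor_lift_closed:
  assumes "module K M" "module K N" "module K P" "\<beta> \<in> bilinear_maps K M N P"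
    and "t \<in> carrier (tensor K M N)"
  shows "tensor_lift P \<beta> t \<in> carrier P"
  using linear_maps_closed[OF tensor_universal(1)[OF assms(1-4)] assms(5)] .

text \<open>The lists in a class of formal sums have their entries in the carriers, so only the values there enter.\<close>

lemma tensor_lift_cong:
  assumes "module K M" "module K N" "t \<in> carrier (tensor K M N)"
    and "\<And>a b. \<lbrakk>a \<in> carrier M; b \<in> carrier N\<rbrakk> \<Longrightarrow> \<beta> a b = \<gamma> a b"
  shows "tensor_lift P \<beta> t = tensor_lift P \<gamma> t"
proof -
  have "formal_sum_eval P \<beta> xs = formal_sum_eval P \<gamma> xs" if "xs \<in> t" for xs
  proof -
    have "xs \<in> lists (carrier M \<times> carrier N)"
      using that assms(3) tensor_eq_lists[OF assms(1,2)]
      by (auto simp: tensor_def tensor_class_def)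
    then show ?thesis
      by induction (auto simp: formal_sum_eval_def assms(4))
  qed
  then show ?thesis by (simp add: tensor_lift_def cong: image_cong)
qed

lemma linear_tensor_lift:
  assumes "module K M" "module K N" "module K P" "module K Q"
    and "\<beta> \<in> bilinear_maps K M N P" "h \<in> linear_maps K P Q" "t \<in> carrier (tensor K M N)"
  shows "h (tensor_lift P \<beta> t) = tensor_lift Q (\<lambda>a b. h (\<beta> a b)) t"
  by (rule tensor_universal(3)[OF assms(1,2,4) bilinear_maps_postcomp[OF assms(6,5)]])
    (use assms in \<open>auto intro: linear_maps_comp[OF assms(6)] tensor_universal(1)
      simp: tensor_universal(2)\<close>)

lemma tensor_lift_finsum:
  assumes "module K M" "module K N" "module K P"
    and "\<And>i. i \<in> A \<Longrightarrow> \<beta> i \<in> bilinear_maps K M N P" "t \<in> carrier (tensor K M N)"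
  shows "tensor_lift P (\<lambda>a b. \<Oplus>\<^bsub>P\<^esub>i\<in>A. \<beta> i a b) t = (\<Oplus>\<^bsub>P\<^esub>i\<in>A. tensor_lift P (\<beta> i) t)"
proof -
  interpret P: module K P by fact
  have \<beta>: "(\<lambda>a b. \<Oplus>\<^bsub>P\<^esub>i\<in>A. \<beta> i a b) \<in> bilinear_maps K M N P"
    using assms by (intro bilinear_mapsI finsum_linear)
      (auto intro: bilinear_maps_left bilinear_maps_right)
  have "(\<lambda>t. \<Oplus>\<^bsub>P\<^esub>i\<in>A. tensor_lift P (\<beta> i) t) \<in> linear_maps K (tensor K M N) P"
    using assms by (intro finsum_linear module_tensor tensor_universal(1)) auto
  then have "(\<Oplus>\<^bsub>P\<^esub>i\<in>A. tensor_lift P (\<beta> i) t) = tensor_lift P (\<lambda>a b. \<Oplus>\<^bsub>P\<^esub>i\<in>A. \<beta> i a b) t"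
    using assms tensor_universal(2)[OF assms(1-4)]
    by (intro tensor_universal(3)[OF assms(1-3) \<beta>] P.finsum_cong')
     (auto intro: bilinear_maps_closed)
  then show ?thesis ..
qed

lemma tensor_lift_zero:
  assumes "module K M" "module K N" "module K P" "t \<in> carrier (tensor K M N)"
    and "\<And>a b. \<lbrakk>a \<in> carrier M; b \<in> carrier N\<rbrakk> \<Longrightarrow> \<beta> a b = \<zero>\<^bsub>P\<^esub>"
  shows "tensor_lift P \<beta> t = \<zero>\<^bsub>P\<^esub>"
proof -
  have "tensor_lift P \<beta> t = tensor_lift P (\<lambda>a b. \<zero>\<^bsub>P\<^esub>) t"
    by (rule tensor_lift_cong[OF assms(1,2,4,5)])
  also have "\<dots> = \<zero>\<^bsub>P\<^esub>"
    using assms by (intro tensor_universal(3)[symmetric, where f = "\<lambda>_. \<zero>\<^bsub>P\<^esub>"] bilinear_mapsI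
      zero_map_linear) auto
  finally show ?thesis .
qed

text \<open>Once a formal sum representing \<open>t\<close> is chosen, the value at \<open>t\<close> is a finite sum of terms
\<open>\<beta> c a b\<close>, each linear in \<open>c\<close>. This gives bilinearity of maps whose first argument is
itself a tensor, such as the product of two tensors or the associator.\<close>

lemma tensor_lift_param_linear:
  assumes "module K L" "module K M" "module K N" "module K P"
    and "\<And>c. c \<in> carrier L \<Longrightarrow> \<beta> c \<in> bilinear_maps K M N P"
    and "\<And>a b. \<lbrakk>a \<in> carrier M; b \<in> carrier N\<rbrakk> \<Longrightarrow> (\<lambda>c. \<beta> c a b) \<in> linear_maps K L P"
    and t: "t \<in> carrier (tensor K M N)"
  shows "(\<lambda>c. tensor_lift P (\<beta> c) t) \<in> linear_maps K L P"
proof -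
  interpret L: module K L by fact
  interpret P: module K P by fact
  obtain xs where xs: "xs \<in> lists (carrier M \<times> carrier N)" "t = tensor_class K M N xs"
    using t by (rule tensor_carrier_cases)
  have "(\<lambda>c. formal_sum_eval P (\<beta> c) xs) \<in> linear_maps K L P" using xs(1)
  proof induction
    case Nil
    then show ?case using zero_map_linear[OF assms(4)] by (simp add: formal_sum_eval_def)
  next
    case (Cons p zs)
    obtain a b where p: "p = (a, b)" "a \<in> carrier M" "b \<in> carrier N" using Cons by auto
    have ev: "formal_sum_eval P (\<beta> c) (p # zs) = \<beta> c a b \<oplus>\<^bsub>P\<^esub> formal_sum_eval P (\<beta> c) zs" for c
      using p by (simp add: formal_sum_eval_def)
    note l = assms(6)[OF p(2,3)] and IH = Cons.IH
    show ?case unfolding ev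
      by (rule linear_mapsI) (auto simp: linear_maps_closed[OF l] linear_maps_closed[OF IH]
         linear_maps_add[OF l] linear_maps_add[OF IH] linear_maps_smult[OF l] linear_maps_smult[OF IH]
         P.smult_r_distr P.a_ac)
  qed
  then show ?thesis
    by (rule linear_maps_cong[OF assms(1)])
      (use xs assms in \<open>simp add: tensor_lift_class(1)[OF assms(2-5)]\<close>)
qed

section \<open>Maps between tensor products\<close>

lemma tensor_map_bilinear:
  assumes "module K M'" "module K N'" "f \<in> linear_maps K M M'" "g \<in> linear_maps K N N'"
  shows "(\<lambda>a b. pure_tensor K M' N' (f a) (g b)) \<in> bilinear_maps K M N (tensor K M' N')"
  by (rule bilinear_maps_precomp[OF pure_tensor_bilinear assms(3,4)]) fact+

lemma tensor_map_linear:
  assumes "module K M" "module K N" "module K M'" "module K N'"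
    and "f \<in> linear_maps K M M'" "g \<in> linear_maps K N N'"
  shows "tensor_map K M' N' f g \<in> linear_maps K (tensor K M N) (tensor K M' N')"
  unfolding tensor_map_def
  using assms by (intro tensor_universal(1) module_tensor tensor_map_bilinear)

lemma tensor_map_closed:
  assumes "module K M" "module K N" "module K M'" "module K N'"
    and "f \<in> linear_maps K M M'" "g \<in> linear_maps K N N'" "t \<in> carrier (tensor K M N)"
  shows "tensor_map K M' N' f g t \<in> carrier (tensor K M' N')"
  using linear_maps_closed[OF tensor_map_linear[OF assms(1-6)] assms(7)] .

lemma tensor_map_pure:
  assumes "module K M" "module K N" "module K M'" "module K N'"
    and "f \<in> linear_maps K M M'" "g \<in> linear_maps K N N'" "a \<in> carrier M" "b \<in> carrier N"
  shows "tensor_map K M' N' f g (pure_tensor K M N a b) = pure_tensor K M' N' (f a) (g b)"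
  unfolding tensor_map_def
  using assms by (subst tensor_universal(2)) (auto intro: module_tensor tensor_map_bilinear)

lemma tensor_lift_tensor_map:
  assumes "module K M" "module K N" "module K M'" "module K N'" "module K P"
    and "f \<in> linear_maps K M M'" "g \<in> linear_maps K N N'" "\<beta> \<in> bilinear_maps K M' N' P"
    and "t \<in> carrier (tensor K M N)"
  shows "tensor_lift P \<beta> (tensor_map K M' N' f g t) = tensor_lift P (\<lambda>a b. \<beta> (f a) (g b)) t"
  by (rule tensor_universal(3)[OF assms(1,2,5) bilinear_maps_precomp[OF assms(8,6,7)]])
    (use assms in \<open>auto intro!: linear_maps_comp[OF tensor_universal(1)] tensor_map_linear
      simp: tensor_map_pure tensor_universal(2) linear_maps_closed\<close>)

lemma tensor_map_cong:
  assumes "module K M" "module K N" "t \<in> carrier (tensor K M N)"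
    and "\<And>a. a \<in> carrier M \<Longrightarrow> f a = f' a" "\<And>b. b \<in> carrier N \<Longrightarrow> g b = g' b"
  shows "tensor_map K M' N' f g t = tensor_map K M' N' f' g' t"
  unfolding tensor_map_def by (rule tensor_lift_cong[OF assms(1-3)]) (simp add: assms(4,5))

lemma tensor_map_comp:
  assumes "module K M" "module K N" "module K M'" "module K N'" "module K M''" "module K N''"
    and "f' \<in> linear_maps K M M'" "g' \<in> linear_maps K N N'"
    and "f \<in> linear_maps K M' M''" "g \<in> linear_maps K N' N''"
    and "t \<in> carrier (tensor K M N)"
  shows "tensor_map K M'' N'' f g (tensor_map K M' N' f' g' t)
    = tensor_map K M'' N'' (\<lambda>a. f (f' a)) (\<lambda>b. g (g' b)) t"
  using tensor_lift_tensor_map[OF assms(1-4) module_tensor[OF assms(5,6)] assms(7,8)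
      tensor_map_bilinear[OF assms(5,6,9,10)] assms(11)]
  by (simp add: tensor_map_def)

lemma tensor_map_finsum_left:
  assumes "module K M" "module K N" "module K M'" "module K N'"
    and "\<And>i. i \<in> A \<Longrightarrow> f i \<in> linear_maps K M M'" "g \<in> linear_maps K N N'"
    and t: "t \<in> carrier (tensor K M N)"
  shows "tensor_map K M' N' (\<lambda>a. \<Oplus>\<^bsub>M'\<^esub>i\<in>A. f i a) g t
    = (\<Oplus>\<^bsub>tensor K M' N'\<^esub>i\<in>A. tensor_map K M' N' (f i) g t)"
proof -
  let ?T = "tensor K M' N'"
  have "pure_tensor K M' N' (\<Oplus>\<^bsub>M'\<^esub>i\<in>A. f i a) (g b) = (\<Oplus>\<^bsub>?T\<^esub>i\<in>A. pure_tensor K M' N' (f i a) (g b))"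
    if "a \<in> carrier M" "b \<in> carrier N" for a b
    by (rule linear_maps_finsum[OF assms(3) module_tensor[OF assms(3,4)]
        bilinear_maps_left[OF pure_tensor_bilinear[OF assms(3,4)] linear_maps_closed[OF assms(6)]]])
      (use that linear_maps_closed[OF assms(5)] in auto)
  then have "tensor_map K M' N' (\<lambda>a. \<Oplus>\<^bsub>M'\<^esub>i\<in>A. f i a) g t
      = tensor_lift ?T (\<lambda>a b. \<Oplus>\<^bsub>?T\<^esub>i\<in>A. pure_tensor K M' N' (f i a) (g b)) t"
    unfolding tensor_map_def by (rule tensor_lift_cong[OF assms(1,2) t])
  also have "\<dots> = (\<Oplus>\<^bsub>?T\<^esub>i\<in>A. tensor_map K M' N' (f i) g t)"
    unfolding tensor_map_def
    by (rule tensor_lift_finsum[OF assms(1,2) module_tensor[OF assms(3,4)] tensor_map_bilinear t])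
      (use assms in auto)
  finally show ?thesis .
qed

lemma tensor_map_finsum_right:
  assumes "module K M" "module K N" "module K M'" "module K N'"
    and "f \<in> linear_maps K M M'" "\<And>i. i \<in> A \<Longrightarrow> g i \<in> linear_maps K N N'"
    and t: "t \<in> carrier (tensor K M N)"
  shows "tensor_map K M' N' f (\<lambda>b. \<Oplus>\<^bsub>N'\<^esub>i\<in>A. g i b) t
    = (\<Oplus>\<^bsub>tensor K M' N'\<^esub>i\<in>A. tensor_map K M' N' f (g i) t)"
proof -
  let ?T = "tensor K M' N'"
  have "pure_tensor K M' N' (f a) (\<Oplus>\<^bsub>N'\<^esub>i\<in>A. g i b) = (\<Oplus>\<^bsub>?T\<^esub>i\<in>A. pure_tensor K M' N' (f a) (g i b))"
    if "a \<in> carrier M" "b \<in> carrier N" for a b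
    by (rule linear_maps_finsum[OF assms(4) module_tensor[OF assms(3,4)]
        bilinear_maps_right[OF pure_tensor_bilinear[OF assms(3,4)] linear_maps_closed[OF assms(5)]]])
      (use that linear_maps_closed[OF assms(6)] in auto)
  then have "tensor_map K M' N' f (\<lambda>b. \<Oplus>\<^bsub>N'\<^esub>i\<in>A. g i b) t
      = tensor_lift ?T (\<lambda>a b. \<Oplus>\<^bsub>?T\<^esub>i\<in>A. pure_tensor K M' N' (f a) (g i b)) t"
    unfolding tensor_map_def by (rule tensor_lift_cong[OF assms(1,2) t])
  also have "\<dots> = (\<Oplus>\<^bsub>?T\<^esub>i\<in>A. tensor_map K M' N' f (g i) t)"
    unfolding tensor_map_def
    by (rule tensor_lift_finsum[OF assms(1,2) module_tensor[OF assms(3,4)] tensor_map_bilinear t])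
      (use assms in auto)
  finally show ?thesis .
qed

text \<open>The form of uniqueness used for identities about the product of two tensors.\<close>

lemma tensor_bilinear_eqI:
  assumes "module K M" "module K N" "module K M'" "module K N'" "module K P"
    and \<beta>: "\<beta> \<in> bilinear_maps K (tensor K M N) (tensor K M' N') P"
    and \<gamma>: "\<gamma> \<in> bilinear_maps K (tensor K M N) (tensor K M' N') P"
    and eq: "\<And>a b a' b'. \<lbrakk>a \<in> carrier M; b \<in> carrier N; a' \<in> carrier M'; b' \<in> carrier N'\<rbrakk>
      \<Longrightarrow> \<beta> (pure_tensor K M N a b) (pure_tensor K M' N' a' b')
        = \<gamma> (pure_tensor K M N a b) (pure_tensor K M' N' a' b')"
    and s: "s \<in> carrier (tensor K M N)" and t: "t \<in> carrier (tensor K M' N')"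
  shows "\<beta> s t = \<gamma> s t"
proof (rule tensor_linear_eqI[OF assms(1,2,5) bilinear_maps_left[OF \<beta> t] bilinear_maps_left[OF \<gamma> t] _ s])
  fix a b assume ab: "a \<in> carrier M" "b \<in> carrier N"
  then have p: "pure_tensor K M N a b \<in> carrier (tensor K M N)" by (rule pure_tensor_closed)
  show "\<beta> (pure_tensor K M N a b) t = \<gamma> (pure_tensor K M N a b) t"
    by (rule tensor_linear_eqI[OF assms(3-5) bilinear_maps_right[OF \<beta> p] bilinear_maps_right[OF \<gamma> p]
          eq[OF ab] t])
qed

section \<open>Multiplication of tensors\<close>

text \<open>Addition of classes is concatenation of lists, so evaluation of a list of lists in the tensor product
is concatenation.\<close>

lemma formal_sum_eval_class:
  assumes "module K M" "module K N" "xs \<in> lists (A \<times> B)"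
    and "\<And>a b. \<lbrakk>a \<in> A; b \<in> B\<rbrakk> \<Longrightarrow> h a b \<in> lists (carrier M \<times> carrier N)"
  shows "formal_sum_eval (tensor K M N) (\<lambda>a b. tensor_class K M N (h a b)) xs
    = tensor_class K M N (concat (map (\<lambda>(a, b). h a b) xs))"
  using assms(3)
proof induction
  case Nil
  then show ?case by (simp add: formal_sum_eval_def tensor_def)
next
  case (Cons p zs)
  obtain a b where p: "p = (a, b)" "a \<in> A" "b \<in> B" using Cons by auto
  have "concat (map (\<lambda>(a, b). h a b) zs) \<in> lists (carrier M \<times> carrier N)"
    using Cons.hyps(2) by induction (use assms(4) in \<open>fastforce simp: in_lists_conv_set\<close>)+
  then have "tensor_class K M N (h a b) \<oplus>\<^bsub>tensor K M N\<^esub>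
      tensor_class K M N (concat (map (\<lambda>(a, b). h a b) zs))
      = tensor_class K M N (h a b @ concat (map (\<lambda>(a, b). h a b) zs))"
    by (rule tensor_add_class[OF assms(4)[OF p(2,3)]])
  then show ?case using Cons.IH p by (simp add: formal_sum_eval_def)
qed

text \<open>The product of two tensors is defined by multiplying out representing lists. It equals the iterated
lift of \<open>(a, b), (a', b') \<mapsto> a a' \<otimes> b b'\<close>, which shows at once that it does not depend on the
representatives and that it is bilinear. Of the two multiplications
only bilinearity is assumed, so that the result applies to \<open>A \<otimes> (A \<otimes> A)\<close> as well.\<close>

lemma tensor_mult_bilinear_lift:
  assumes A: "module K A" and B: "module K B"
    and mA: "mult A \<in> bilinear_maps K A A A" and mB: "mult B \<in> bilinear_maps K B B B"
    and t: "t \<in> carrier (tensor K A B)"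
  defines "T \<equiv> tensor K A B"
  defines "\<gamma> \<equiv> \<lambda>a b a' b'. pure_tensor K A B (a \<otimes>\<^bsub>A\<^esub> a') (b \<otimes>\<^bsub>B\<^esub> b')"
  shows "\<And>a b. \<lbrakk>a \<in> carrier A; b \<in> carrier B\<rbrakk> \<Longrightarrow> \<gamma> a b \<in> bilinear_maps K A B T"
    and "(\<lambda>a b. tensor_lift T (\<gamma> a b) t) \<in> bilinear_maps K A B T"
    and "s \<in> carrier (tensor K A B)
      \<Longrightarrow> s \<otimes>\<^bsub>T\<^esub> t = tensor_lift T (\<lambda>a b. tensor_lift T (\<gamma> a b) t) s"
proof -
  have T: "module K T" unfolding T_def by (rule module_tensor[OF A B])
  show \<gamma>: "\<gamma> a b \<in> bilinear_maps K A B T" if "a \<in> carrier A" "b \<in> carrier B" for a b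
    unfolding T_def \<gamma>_def
    by (rule tensor_map_bilinear[OF A B bilinear_maps_right[OF mA that(1)] bilinear_maps_right[OF mB that(2)]])
  have \<gamma>': "(\<lambda>a b. \<gamma> a b a' b') \<in> bilinear_maps K A B T"
    if "a' \<in> carrier A" "b' \<in> carrier B" for a' b'
    unfolding T_def \<gamma>_def
    by (rule tensor_map_bilinear[OF A B bilinear_maps_left[OF mA that(1)] bilinear_maps_left[OF mB that(2)]])
  show \<beta>: "(\<lambda>a b. tensor_lift T (\<gamma> a b) t) \<in> bilinear_maps K A B T"
    by (intro bilinear_mapsI tensor_lift_param_linear[OF _ A B T _ _ t] A B \<gamma>)
      (auto intro: bilinear_maps_left[OF \<gamma>'] bilinear_maps_right[OF \<gamma>'])
  assume s: "s \<in> carrier (tensor K A B)"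
  let ?L = "lists (carrier A \<times> carrier B)" and ?cl = "tensor_class K A B"
  let ?p = "\<lambda>((a, b), (a', b')). (a \<otimes>\<^bsub>A\<^esub> a', b \<otimes>\<^bsub>B\<^esub> b')"
  have rep: "xs \<in> ?L \<and> u = ?cl xs" if u: "u \<in> carrier (tensor K A B)" and xs: "xs \<in> u" for u xs
  proof -
    obtain zs where zs: "zs \<in> ?L" "u = ?cl zs" using u by (rule tensor_carrier_cases)
    then have "tensor_eq K A B zs xs" using xs by (simp add: tensor_class_def)
    moreover from tensor_eq_lists[OF A B this] have "xs \<in> ?L" by simp
    ultimately show ?thesis using zs by (simp add: tensor_class_eq_iff)
  qed
  have main: "?cl (map ?p (List.product xs ys)) = tensor_lift T (\<lambda>a b. tensor_lift T (\<gamma> a b) t) s"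
    if xs: "xs \<in> s" and ys: "ys \<in> t" for xs ys
  proof -
    note X = rep[OF s xs] and Y = rep[OF t ys]
    let ?h = "\<lambda>a b. map (\<lambda>(a', b'). (a \<otimes>\<^bsub>A\<^esub> a', b \<otimes>\<^bsub>B\<^esub> b')) ys"
    have hL: "?h a b \<in> ?L" if "a \<in> carrier A" "b \<in> carrier B" for a b
      using conjunct1[OF Y] that
      by induction (auto intro: bilinear_maps_closed[OF mA] bilinear_maps_closed[OF mB])
    have inner: "tensor_lift T (\<gamma> a b) t = ?cl (?h a b)" if ab: "a \<in> carrier A" "b \<in> carrier B" for a b
    proof -
      have "tensor_lift T (\<gamma> a b) t = formal_sum_eval T (\<gamma> a b) ys"
        using Y tensor_lift_class(1)[OF A B T \<gamma>[OF ab]] by simp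
      also have "\<dots> = ?cl (concat (map (\<lambda>(a', b'). [(a \<otimes>\<^bsub>A\<^esub> a', b \<otimes>\<^bsub>B\<^esub> b')]) ys))"
        unfolding T_def \<gamma>_def pure_tensor_def
        by (rule formal_sum_eval_class[OF A B conjunct1[OF Y]])
         (use ab in \<open>auto intro: bilinear_maps_closed[OF mA] bilinear_maps_closed[OF mB]\<close>)
      also have "concat (map (\<lambda>(a', b'). [(a \<otimes>\<^bsub>A\<^esub> a', b \<otimes>\<^bsub>B\<^esub> b')]) ys) = ?h a b"
        by (induction ys) auto
      finally show ?thesis .
    qed
    have "tensor_lift T (\<lambda>a b. tensor_lift T (\<gamma> a b) t) s
        = formal_sum_eval T (\<lambda>a b. tensor_lift T (\<gamma> a b) t) xs"
      using X tensor_lift_class(1)[OF A B T \<beta>] by simp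
    also have "\<dots> = formal_sum_eval T (\<lambda>a b. ?cl (?h a b)) xs"
      using conjunct1[OF X] by induction (auto simp: formal_sum_eval_def inner)
    also have "\<dots> = ?cl (concat (map (\<lambda>(a, b). ?h a b) xs))"
      unfolding T_def by (rule formal_sum_eval_class[OF A B conjunct1[OF X] hL])
    also have "concat (map (\<lambda>(a, b). ?h a b) xs) = map ?p (List.product xs ys)"
      by (induction xs) auto
    finally show ?thesis by simp
  qed
  obtain xs ys where "xs \<in> s" "ys \<in> t"
    using s t by (metis A B tensor_carrier_cases tensor_class_def mem_Collect_eq tensor_eq.refl)
  have "s \<otimes>\<^bsub>T\<^esub> t = (\<Union>xs\<in>s. \<Union>ys\<in>t. ?cl (map ?p (List.product xs ys)))"
    by (simp add: T_def tensor_def)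
  also have "\<dots> = tensor_lift T (\<lambda>a b. tensor_lift T (\<gamma> a b) t) s"
    by (rule UN_const_on[OF \<open>xs \<in> s\<close>], rule UN_const_on[OF \<open>ys \<in> t\<close>], rule main)
  finally show "s \<otimes>\<^bsub>T\<^esub> t = tensor_lift T (\<lambda>a b. tensor_lift T (\<gamma> a b) t) s" .
qed

lemma tensor_mult_pure:
  assumes "module K A" "module K B"
    and "mult A \<in> bilinear_maps K A A A" "mult B \<in> bilinear_maps K B B B"
    and "a \<in> carrier A" "b \<in> carrier B" "a' \<in> carrier A" "b' \<in> carrier B"
  shows "pure_tensor K A B a b \<otimes>\<^bsub>tensor K A B\<^esub> pure_tensor K A B a' b'
    = pure_tensor K A B (a \<otimes>\<^bsub>A\<^esub> a') (b \<otimes>\<^bsub>B\<^esub> b')"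
proof -
  note p = pure_tensor_closed[OF assms(7,8), of K]
  note l = tensor_mult_bilinear_lift[OF assms(1-4) p]
  note u = tensor_universal(2)[OF assms(1,2) module_tensor[OF assms(1,2)]]
  show ?thesis
    by (simp add: l(3)[OF pure_tensor_closed[OF assms(5,6)]] u[OF l(2) assms(5,6)]
        u[OF l(1)[OF assms(5,6)] assms(7,8)])
qed

lemma tensor_mult_bilinear:
  assumes A: "module K A" and B: "module K B"
    and mA: "mult A \<in> bilinear_maps K A A A" and mB: "mult B \<in> bilinear_maps K B B B"
  shows "mult (tensor K A B) \<in> bilinear_maps K (tensor K A B) (tensor K A B) (tensor K A B)"
proof (rule bilinear_mapsI)
  note T = module_tensor[OF A B] and l = tensor_mult_bilinear_lift[OF A B mA mB]
  fix t assume t: "t \<in> carrier (tensor K A B)"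
  show "(\<lambda>s. s \<otimes>\<^bsub>tensor K A B\<^esub> t) \<in> linear_maps K (tensor K A B) (tensor K A B)"
    by (rule linear_maps_cong[OF T tensor_universal(1)[OF A B T l(2)[OF t]]])
      (simp add: l(3)[OF t])
  show "(\<lambda>s. t \<otimes>\<^bsub>tensor K A B\<^esub> s) \<in> linear_maps K (tensor K A B) (tensor K A B)"
    by (rule linear_maps_cong[OF T tensor_lift_param_linear[OF T A B T l(2) tensor_universal(1)[OF A B T l(1)]
            t]])
     (use t in \<open>simp_all add: l(3)[OF _ t]\<close>)
qed

lemma tensor_map_mult:
  assumes "module K A" "module K B" "module K A'" "module K B'"
    and "mult A \<in> bilinear_maps K A A A" "mult B \<in> bilinear_maps K B B B"
    and "mult A' \<in> bilinear_maps K A' A' A'" "mult B' \<in> bilinear_maps K B' B' B'"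
    and f: "f \<in> linear_maps K A A'" and g: "g \<in> linear_maps K B B'"
    and fm: "\<And>x y. \<lbrakk>x \<in> carrier A; y \<in> carrier A\<rbrakk> \<Longrightarrow> f (x \<otimes>\<^bsub>A\<^esub> y) = f x \<otimes>\<^bsub>A'\<^esub> f y"
    and gm: "\<And>x y. \<lbrakk>x \<in> carrier B; y \<in> carrier B\<rbrakk> \<Longrightarrow> g (x \<otimes>\<^bsub>B\<^esub> y) = g x \<otimes>\<^bsub>B'\<^esub> g y"
    and s: "s \<in> carrier (tensor K A B)" and t: "t \<in> carrier (tensor K A B)"
  shows "tensor_map K A' B' f g (s \<otimes>\<^bsub>tensor K A B\<^esub> t)
    = tensor_map K A' B' f g s \<otimes>\<^bsub>tensor K A' B'\<^esub> tensor_map K A' B' f g t"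
proof (rule tensor_bilinear_eqI[OF assms(1,2,1,2) module_tensor[OF assms(3,4)] _ _ _ s t])
  note l = tensor_map_linear[OF assms(1-4) f g]
  show "(\<lambda>s t. tensor_map K A' B' f g (s \<otimes>\<^bsub>tensor K A B\<^esub> t))
      \<in> bilinear_maps K (tensor K A B) (tensor K A B) (tensor K A' B')"
    by (rule bilinear_maps_postcomp[OF l tensor_mult_bilinear[OF assms(1,2,5,6)]])
  show "(\<lambda>s t. tensor_map K A' B' f g s \<otimes>\<^bsub>tensor K A' B'\<^esub> tensor_map K A' B' f g t)
      \<in> bilinear_maps K (tensor K A B) (tensor K A B) (tensor K A' B')"
    by (rule bilinear_maps_precomp[OF tensor_mult_bilinear[OF assms(3,4,7,8)] l l])
qed (simp add: tensor_mult_pure assms tensor_map_pure linear_maps_closed[OF f] linear_maps_closed[OF g]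
    bilinear_maps_closed[OF assms(5)] bilinear_maps_closed[OF assms(6)])

text \<open>It is enough that the images annihilate each other in one of the two tensor factors, since
\<open>0 \<otimes> b\<close> and \<open>a \<otimes> 0\<close> vanish.\<close>

lemma tensor_map_mult_zero:
  assumes "module K M" "module K N" "module K M'" "module K N'" "module K A" "module K B"
    and "mult A \<in> bilinear_maps K A A A" "mult B \<in> bilinear_maps K B B B"
    and f: "f \<in> linear_maps K M A" and g: "g \<in> linear_maps K N B"
    and f': "f' \<in> linear_maps K M' A" and g': "g' \<in> linear_maps K N' B"
    and z: "(\<forall>x\<in>carrier M. \<forall>y\<in>carrier M'. f x \<otimes>\<^bsub>A\<^esub> f' y = \<zero>\<^bsub>A\<^esub>)
      \<or> (\<forall>x\<in>carrier N. \<forall>y\<in>carrier N'. g x \<otimes>\<^bsub>B\<^esub> g' y = \<zero>\<^bsub>B\<^esub>)"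
    and s: "s \<in> carrier (tensor K M N)" and t: "t \<in> carrier (tensor K M' N')"
  shows "tensor_map K A B f g s \<otimes>\<^bsub>tensor K A B\<^esub> tensor_map K A B f' g' t = \<zero>\<^bsub>tensor K A B\<^esub>"
proof (rule tensor_bilinear_eqI[OF assms(1-4) module_tensor[OF assms(5,6)] _ _ _ s t])
  show "(\<lambda>s t. tensor_map K A B f g s \<otimes>\<^bsub>tensor K A B\<^esub> tensor_map K A B f' g' t)
      \<in> bilinear_maps K (tensor K M N) (tensor K M' N') (tensor K A B)"
    by (rule bilinear_maps_precomp[OF tensor_mult_bilinear[OF assms(5-8)]
          tensor_map_linear[OF assms(1,2,5,6) f g] tensor_map_linear[OF assms(3,4,5,6) f' g']])
  show "(\<lambda>s t. \<zero>\<^bsub>tensor K A B\<^esub>)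
      \<in> bilinear_maps K (tensor K M N) (tensor K M' N') (tensor K A B)"
    using assms by (intro bilinear_mapsI zero_map_linear module_tensor)
next
  fix a b a' b' assume ab: "a \<in> carrier M" "b \<in> carrier N" "a' \<in> carrier M'" "b' \<in> carrier N'"
  note c = linear_maps_closed[OF f ab(1)] linear_maps_closed[OF g ab(2)]
    linear_maps_closed[OF f' ab(3)] linear_maps_closed[OF g' ab(4)]
  note P = pure_tensor_bilinear[OF assms(5,6)]
  note T = module_tensor[OF assms(5,6)]
  have "tensor_map K A B f g (pure_tensor K M N a b) \<otimes>\<^bsub>tensor K A B\<^esub>
      tensor_map K A B f' g' (pure_tensor K M' N' a' b')
      = pure_tensor K A B (f a \<otimes>\<^bsub>A\<^esub> f' a') (g b \<otimes>\<^bsub>B\<^esub> g' b')"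
    by (simp add: assms ab c tensor_map_pure tensor_mult_pure)
  also have "\<dots> = \<zero>\<^bsub>tensor K A B\<^esub>"
    using z linear_maps_zero[OF assms(5) T bilinear_maps_left[OF P]]
     linear_maps_zero[OF assms(6) T bilinear_maps_right[OF P]] ab c
     bilinear_maps_closed[OF assms(7)] bilinear_maps_closed[OF assms(8)]
    by auto
  finally show "tensor_map K A B f g (pure_tensor K M N a b) \<otimes>\<^bsub>tensor K A B\<^esub>
      tensor_map K A B f' g' (pure_tensor K M' N' a' b') = \<zero>\<^bsub>tensor K A B\<^esub>" .
qed

section \<open>The associator\<close>

lemma tensor_assoc_bilinear:
  assumes M: "module K M" and N: "module K N" and P: "module K P"
  defines "T \<equiv> tensor K M (tensor K N P)"
  shows "\<And>c. c \<in> carrier P \<Longrightarrow>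
      (\<lambda>a b. pure_tensor K M (tensor K N P) a (pure_tensor K N P b c)) \<in> bilinear_maps K M N T"
    and "(\<lambda>t c. tensor_lift T (\<lambda>a b. pure_tensor K M (tensor K N P) a (pure_tensor K N P b c)) t)
      \<in> bilinear_maps K (tensor K M N) P T"
proof -
  have NP: "module K (tensor K N P)" by (rule module_tensor[OF N P])
  have T: "module K T" unfolding T_def by (rule module_tensor[OF M NP])
  note pNP = pure_tensor_bilinear[OF N P] and pT = pure_tensor_bilinear[OF M NP, folded T_def]
  show b: "(\<lambda>a b. pure_tensor K M (tensor K N P) a (pure_tensor K N P b c)) \<in> bilinear_maps K M N T"
    if c: "c \<in> carrier P" for c
    by (rule bilinear_maps_precomp[OF pT linear_maps_id bilinear_maps_left[OF pNP c]])
  show "(\<lambda>t c. tensor_lift T (\<lambda>a b. pure_tensor K M (tensor K N P) a (pure_tensor K N P b c)) t)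
      \<in> bilinear_maps K (tensor K M N) P T"
  proof (rule bilinear_mapsI)
    fix t assume t: "t \<in> carrier (tensor K M N)"
    show "(\<lambda>c. tensor_lift T (\<lambda>a b. pure_tensor K M (tensor K N P) a (pure_tensor K N P b c)) t)
        \<in> linear_maps K P T"
      by (rule tensor_lift_param_linear[OF P M N T b _ t])
        (assumption, rule linear_maps_comp[OF bilinear_maps_right[OF pT] bilinear_maps_right[OF pNP]])
  qed (rule tensor_universal(1)[OF M N T b])
qed

lemma tensor_assoc_linear:
  assumes "module K M" "module K N" "module K P"
  shows "tensor_assoc K M N P
    \<in> linear_maps K (tensor K (tensor K M N) P) (tensor K M (tensor K N P))"
  unfolding tensor_assoc_def Let_def
  using assms by (intro tensor_universal(1) module_tensor tensor_assoc_bilinear)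

lemma tensor_assoc_pure_left:
  assumes "module K M" "module K N" "module K P" "t \<in> carrier (tensor K M N)" "c \<in> carrier P"
  shows "tensor_assoc K M N P (pure_tensor K (tensor K M N) P t c)
    = tensor_lift (tensor K M (tensor K N P))
        (\<lambda>a b. pure_tensor K M (tensor K N P) a (pure_tensor K N P b c)) t"
  unfolding tensor_assoc_def Let_def
  using assms by (subst tensor_universal(2)) (auto intro: module_tensor tensor_assoc_bilinear)

lemma tensor_assoc_pure:
  assumes "module K M" "module K N" "module K P" "a \<in> carrier M" "b \<in> carrier N" "c \<in> carrier P"
  shows "tensor_assoc K M N P (pure_tensor K (tensor K M N) P (pure_tensor K M N a b) c)
    = pure_tensor K M (tensor K N P) a (pure_tensor K N P b c)"
  using assms
  by (simp add: tensor_assoc_pure_left pure_tensor_closed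
      tensor_universal(2)[OF _ _ _ tensor_assoc_bilinear(1)] module_tensor)

lemma tensor_assoc_natural:
  assumes M: "module K M" and N: "module K N" and P: "module K P"
    and M': "module K M'" and N': "module K N'" and P': "module K P'"
    and f: "f \<in> linear_maps K M M'" and g: "g \<in> linear_maps K N N'" and h: "h \<in> linear_maps K P P'"
    and t: "t \<in> carrier (tensor K (tensor K M N) P)"
  shows "tensor_map K M' (tensor K N' P') f (tensor_map K N' P' g h) (tensor_assoc K M N P t)
    = tensor_assoc K M' N' P' (tensor_map K (tensor K M' N') P' (tensor_map K M' N' f g) h t)"
    (is "?l t = ?r t")
proof -
  note mods = M N P M' N' P' module_tensor
  note lin = linear_maps_comp[OF tensor_map_linear tensor_assoc_linear]
    linear_maps_comp[OF tensor_assoc_linear tensor_map_linear] tensor_map_linear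
  have l: "?l \<in> linear_maps K (tensor K (tensor K M N) P) (tensor K M' (tensor K N' P'))"
    and r: "?r \<in> linear_maps K (tensor K (tensor K M N) P) (tensor K M' (tensor K N' P'))"
    by (intro lin mods f g h)+
  show ?thesis
  proof (rule tensor_linear_eqI[OF _ P _ l r _ t])
    fix s c assume s: "s \<in> carrier (tensor K M N)" and c: "c \<in> carrier P"
    note pl = bilinear_maps_left[OF pure_tensor_bilinear[of K "tensor K M N" P] c]
    show "?l (pure_tensor K (tensor K M N) P s c) = ?r (pure_tensor K (tensor K M N) P s c)"
    proof (rule tensor_linear_eqI[OF M N _ _ _ _ s])
      show "(\<lambda>s. ?l (pure_tensor K (tensor K M N) P s c))
          \<in> linear_maps K (tensor K M N) (tensor K M' (tensor K N' P'))"
        by (rule linear_maps_comp[OF l pl]) (intro mods)+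
      show "(\<lambda>s. ?r (pure_tensor K (tensor K M N) P s c))
          \<in> linear_maps K (tensor K M N) (tensor K M' (tensor K N' P'))"
        by (rule linear_maps_comp[OF r pl]) (intro mods)+
      fix a b assume ab: "a \<in> carrier M" "b \<in> carrier N"
      show "?l (pure_tensor K (tensor K M N) P (pure_tensor K M N a b) c)
          = ?r (pure_tensor K (tensor K M N) P (pure_tensor K M N a b) c)"
        using ab c
        by (simp add: tensor_assoc_pure mods
            tensor_map_pure[OF M _ M' _ f tensor_map_linear[OF N P N' P' g h]]
            tensor_map_pure[OF N P N' P' g h]
            tensor_map_pure[OF _ P _ P' tensor_map_linear[OF M N M' N' f g] h]
            tensor_map_pure[OF M N M' N' f g] pure_tensor_closed
            linear_maps_closed[OF f] linear_maps_closed[OF g] linear_maps_closed[OF h])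
    qed (intro mods)
  qed (intro mods)+
qed

section \<open>Direct sums of algebras\<close>

lemma direct_sum_carrier: "carrier (direct_sum I A) = (\<Pi>\<^sub>E i\<in>I. carrier (A i))"
  by (simp add: direct_sum_def)

lemma direct_sum_component_closed:
  "\<lbrakk>x \<in> carrier (direct_sum I A); i \<in> I\<rbrakk> \<Longrightarrow> x i \<in> carrier (A i)"
  by (auto simp: direct_sum_carrier)

lemma direct_sum_component:
  assumes "i \<in> I"
  shows "(x \<otimes>\<^bsub>direct_sum I A\<^esub> y) i = x i \<otimes>\<^bsub>A i\<^esub> y i"
    and "(x \<oplus>\<^bsub>direct_sum I A\<^esub> y) i = x i \<oplus>\<^bsub>A i\<^esub> y i"
    and "(c \<odot>\<^bsub>direct_sum I A\<^esub> x) i = c \<odot>\<^bsub>A i\<^esub> x i"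
    and "\<one>\<^bsub>direct_sum I A\<^esub> i = \<one>\<^bsub>A i\<^esub>"
    and "\<zero>\<^bsub>direct_sum I A\<^esub> i = \<zero>\<^bsub>A i\<^esub>"
  using assms by (simp_all add: direct_sum_def)

lemma direct_sum_ext:
  "\<lbrakk>x \<in> carrier (direct_sum I A); y \<in> carrier (direct_sum I A); \<And>i. i \<in> I \<Longrightarrow> x i = y i\<rbrakk> \<Longrightarrow> x = y"
  unfolding direct_sum_carrier by (rule PiE_ext)

lemma module_direct_sum:
  assumes "cring K" "\<And>i. i \<in> I \<Longrightarrow> module K (A i)"
  shows "module K (direct_sum I A)"
proof -
  let ?D = "direct_sum I A"
  note g = abelian_groupE[OF module.axioms(2)[OF assms(2)]]
  note m = module.smult_closed[OF assms(2)]
  have add: "x \<oplus>\<^bsub>?D\<^esub> y \<in> carrier ?D" if "x \<in> carrier ?D" "y \<in> carrier ?D" for x y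
    using that by (auto simp: direct_sum_def intro!: g)
  have zero: "\<zero>\<^bsub>?D\<^esub> \<in> carrier ?D"
    by (auto simp: direct_sum_def intro!: g)
  have smult: "c \<odot>\<^bsub>?D\<^esub> x \<in> carrier ?D" if "c \<in> carrier K" "x \<in> carrier ?D" for c x
    using that by (auto simp: direct_sum_def intro!: m)
  note c = direct_sum_component direct_sum_component_closed
  show ?thesis
  proof (rule moduleI[OF assms(1)])
    show "abelian_group ?D"
    proof (rule abelian_groupI)
      fix x y assume "x \<in> carrier ?D" "y \<in> carrier ?D"
      then show "x \<oplus>\<^bsub>?D\<^esub> y = y \<oplus>\<^bsub>?D\<^esub> x"
        by (intro direct_sum_ext[of _ I A] add) (simp_all add: c g(4))
    next
      fix x y z assume "x \<in> carrier ?D" "y \<in> carrier ?D" "z \<in> carrier ?D"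
      then show "x \<oplus>\<^bsub>?D\<^esub> y \<oplus>\<^bsub>?D\<^esub> z = x \<oplus>\<^bsub>?D\<^esub> (y \<oplus>\<^bsub>?D\<^esub> z)"
        by (intro direct_sum_ext[of _ I A] add) (simp_all add: c g(3))
    next
      fix x assume x: "x \<in> carrier ?D"
      then show "\<zero>\<^bsub>?D\<^esub> \<oplus>\<^bsub>?D\<^esub> x = x"
        by (intro direct_sum_ext[of _ I A] add zero) (simp_all add: c g(5))
      have n: "(\<lambda>i\<in>I. \<ominus>\<^bsub>A i\<^esub> x i) \<in> carrier ?D"
        using x abelian_group.a_inv_closed[OF module.axioms(2)[OF assms(2)]]
        by (auto simp: direct_sum_carrier)
      moreover have "(\<lambda>i\<in>I. \<ominus>\<^bsub>A i\<^esub> x i) \<oplus>\<^bsub>?D\<^esub> x = \<zero>\<^bsub>?D\<^esub>"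
        using x n
        by (intro direct_sum_ext[of _ I A] add zero)
          (simp_all add: c abelian_group.l_neg[OF module.axioms(2)[OF assms(2)]])
      ultimately show "\<exists>y\<in>carrier ?D. y \<oplus>\<^bsub>?D\<^esub> x = \<zero>\<^bsub>?D\<^esub>" by blast
    qed (fact add zero)+
  next
    fix a b x assume "a \<in> carrier K" "b \<in> carrier K" "x \<in> carrier ?D"
    moreover from this have "a \<oplus>\<^bsub>K\<^esub> b \<in> carrier K" "a \<otimes>\<^bsub>K\<^esub> b \<in> carrier K"
      using assms(1) by (simp_all add: cring.cring_simprules)
    ultimately show "(a \<oplus>\<^bsub>K\<^esub> b) \<odot>\<^bsub>?D\<^esub> x = a \<odot>\<^bsub>?D\<^esub> x \<oplus>\<^bsub>?D\<^esub> b \<odot>\<^bsub>?D\<^esub> x"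
      and "(a \<otimes>\<^bsub>K\<^esub> b) \<odot>\<^bsub>?D\<^esub> x = a \<odot>\<^bsub>?D\<^esub> (b \<odot>\<^bsub>?D\<^esub> x)"
      by (intro direct_sum_ext[of _ I A] add smult,
          simp_all add: c module.smult_l_distr[OF assms(2)] module.smult_assoc1[OF assms(2)])+
  next
    fix a x y assume "a \<in> carrier K" "x \<in> carrier ?D" "y \<in> carrier ?D"
    then show "a \<odot>\<^bsub>?D\<^esub> (x \<oplus>\<^bsub>?D\<^esub> y) = a \<odot>\<^bsub>?D\<^esub> x \<oplus>\<^bsub>?D\<^esub> a \<odot>\<^bsub>?D\<^esub> y"
      by (intro direct_sum_ext[of _ I A] add smult) (simp_all add: c module.smult_r_distr[OF assms(2)])
  next
    fix x assume "x \<in> carrier ?D"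
    then show "\<one>\<^bsub>K\<^esub> \<odot>\<^bsub>?D\<^esub> x = x"
      using assms(1) by (intro direct_sum_ext[of _ I A] smult)
        (simp_all add: c module.smult_one[OF assms(2)] cring.cring_simprules)
  qed (fact smult)
qed

lemma unital_algebra_direct_sum:
  assumes "field K" "\<And>i. i \<in> I \<Longrightarrow> unital_algebra K (A i)"
  shows "unital_algebra K (direct_sum I A)"
proof -
  interpret field K by fact
  let ?D = "direct_sum I A"
  have r: "ring (A i)" and m: "module K (A i)" if "i \<in> I" for i
    using assms(2)[OF that] by (simp_all add: unital_algebra_def)
  interpret D: module K ?D by (rule module_direct_sum[OF is_cring m])
  note c = direct_sum_component direct_sum_component_closed
  have mult: "x \<otimes>\<^bsub>?D\<^esub> y \<in> carrier ?D" if "x \<in> carrier ?D" "y \<in> carrier ?D" for x y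
    using that by (auto simp: direct_sum_def intro!: ring.ring_simprules(5) r)
  have one: "\<one>\<^bsub>?D\<^esub> \<in> carrier ?D"
    by (auto simp: direct_sum_def intro!: ring.ring_simprules(6) r)
  have mon: "monoid ?D"
  proof (rule monoidI[OF mult one])
    fix x y z assume "x \<in> carrier ?D" "y \<in> carrier ?D" "z \<in> carrier ?D"
    then show "x \<otimes>\<^bsub>?D\<^esub> y \<otimes>\<^bsub>?D\<^esub> z = x \<otimes>\<^bsub>?D\<^esub> (y \<otimes>\<^bsub>?D\<^esub> z)"
      by (intro direct_sum_ext[of _ I A] mult) (simp_all add: c monoid.m_assoc[OF ring.is_monoid[OF r]])
  next
    fix x assume "x \<in> carrier ?D"
    then show "\<one>\<^bsub>?D\<^esub> \<otimes>\<^bsub>?D\<^esub> x = x" "x \<otimes>\<^bsub>?D\<^esub> \<one>\<^bsub>?D\<^esub> = x"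
      by (intro direct_sum_ext[of _ I A] mult one, simp_all add: c monoid.l_one[OF ring.is_monoid[OF r]]
        monoid.r_one[OF ring.is_monoid[OF r]])+
  qed
  have "ring ?D"
  proof (rule ringI[OF module.axioms(2)[OF D.module_axioms] mon])
    fix x y z assume "x \<in> carrier ?D" "y \<in> carrier ?D" "z \<in> carrier ?D"
    then show "(x \<oplus>\<^bsub>?D\<^esub> y) \<otimes>\<^bsub>?D\<^esub> z = x \<otimes>\<^bsub>?D\<^esub> z \<oplus>\<^bsub>?D\<^esub> y \<otimes>\<^bsub>?D\<^esub> z"
      and "z \<otimes>\<^bsub>?D\<^esub> (x \<oplus>\<^bsub>?D\<^esub> y) = z \<otimes>\<^bsub>?D\<^esub> x \<oplus>\<^bsub>?D\<^esub> z \<otimes>\<^bsub>?D\<^esub> y"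
      by (intro direct_sum_ext[of _ I A] mult D.a_closed, simp_all add: c ringE(3,4)[OF r])+
  qed
  moreover have "unital_algebra_axioms K ?D"
  proof
    fix a x y assume "a \<in> carrier K" "x \<in> carrier ?D" "y \<in> carrier ?D"
    then show "(a \<odot>\<^bsub>?D\<^esub> x) \<otimes>\<^bsub>?D\<^esub> y = a \<odot>\<^bsub>?D\<^esub> (x \<otimes>\<^bsub>?D\<^esub> y)"
      and "x \<otimes>\<^bsub>?D\<^esub> (a \<odot>\<^bsub>?D\<^esub> y) = a \<odot>\<^bsub>?D\<^esub> (x \<otimes>\<^bsub>?D\<^esub> y)"
      by (intro direct_sum_ext[of _ I A] mult D.smult_closed,
         simp_all add: c unital_algebra.mult_smult_left[OF assms(2)]
          unital_algebra.mult_smult_right[OF assms(2)])+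
  qed
  ultimately show ?thesis
    using assms(1) D.module_axioms by (simp add: unital_algebra_def)
qed

lemma direct_sum_incl_linear:
  assumes "\<And>i. i \<in> I \<Longrightarrow> module K (A i)"
  shows "direct_sum_incl I A p \<in> linear_maps K (A p) (direct_sum I A)"
proof -
  have g: "abelian_group (A i)" if "i \<in> I" for i using module.axioms(2)[OF assms(1)[OF that]] .
  note ab = abelian_groupE[OF g]
  show ?thesis
    by (rule linear_mapsI)
     (auto simp: direct_sum_def direct_sum_incl_def ab module.smult_r_null[OF assms]
        intro!: restrict_ext)
qed

lemma direct_sum_decompose:
  assumes "finite I" "cring K" "\<And>i. i \<in> I \<Longrightarrow> module K (A i)" "h \<in> carrier (direct_sum I A)"
  shows "h = (\<Oplus>\<^bsub>direct_sum I A\<^esub>p\<in>I. direct_sum_incl I A p (h p))"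
proof -
  interpret D: module K "direct_sum I A" by (rule module_direct_sum[OF assms(2,3)])
  have hp: "h p \<in> carrier (A p)" if "p \<in> I" for p
    using assms(4) that by (auto simp: direct_sum_def)
  have c: "direct_sum_incl I A p (h p) \<in> carrier (direct_sum I A)" if "p \<in> I" for p
    using linear_maps_closed[OF direct_sum_incl_linear[of I K A, OF assms(3)] hp[OF that]] .
  show ?thesis
  proof (rule direct_sum_ext[OF assms(4)])
    show "(\<Oplus>\<^bsub>direct_sum I A\<^esub>p\<in>I. direct_sum_incl I A p (h p)) \<in> carrier (direct_sum I A)"
      by (rule D.finsum_closed) (auto intro: c)
    fix q assume q: "q \<in> I"
    interpret Aq: module K "A q" by (rule assms(3)[OF q])
    have pr: "(\<lambda>x. x q) \<in> linear_maps K (direct_sum I A) (A q)"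
      using q by (intro linear_mapsI) (auto simp: direct_sum_def)
    have "(\<Oplus>\<^bsub>direct_sum I A\<^esub>p\<in>I. direct_sum_incl I A p (h p)) q
        = (\<Oplus>\<^bsub>A q\<^esub>p\<in>I. direct_sum_incl I A p (h p) q)"
      using linear_maps_finsum[OF D.module_axioms assms(3)[OF q] pr c] .
    also have "\<dots> = direct_sum_incl I A q (h q) q"
      using assms(1) q hp by (intro Aq.finsum_single) (auto simp: direct_sum_incl_def)
    also have "\<dots> = h q" using q by (simp add: direct_sum_incl_def)
    finally show "h q = (\<Oplus>\<^bsub>direct_sum I A\<^esub>p\<in>I. direct_sum_incl I A p (h p)) q" by simp
  qed
qed

text \<open>A direct sum over a finite index set is spanned by its summands.\<close>

lemma direct_sum_linear_eqI:
  assumes "finite I" "cring K" "\<And>i. i \<in> I \<Longrightarrow> module K (A i)" "module K N"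
    and f: "f \<in> linear_maps K (direct_sum I A) N" and g: "g \<in> linear_maps K (direct_sum I A) N"
    and eq: "\<And>p a. \<lbrakk>p \<in> I; a \<in> carrier (A p)\<rbrakk>
      \<Longrightarrow> f (direct_sum_incl I A p a) = g (direct_sum_incl I A p a)"
    and h: "h \<in> carrier (direct_sum I A)"
  shows "f h = g h"
proof -
  interpret D: module K "direct_sum I A" by (rule module_direct_sum[OF assms(2,3)])
  interpret N: module K N by fact
  have hp: "h p \<in> carrier (A p)" if "p \<in> I" for p
    using h that by (auto simp: direct_sum_def)
  have c: "direct_sum_incl I A p (h p) \<in> carrier (direct_sum I A)" if "p \<in> I" for p
    using linear_maps_closed[OF direct_sum_incl_linear[of I K A, OF assms(3)] hp[OF that]] .
  let ?s = "\<Oplus>\<^bsub>direct_sum I A\<^esub>p\<in>I. direct_sum_incl I A p (h p)"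
  have "f ?s = (\<Oplus>\<^bsub>N\<^esub>p\<in>I. f (direct_sum_incl I A p (h p)))"
    by (rule linear_maps_finsum[OF D.module_axioms assms(4) f c])
  also have "\<dots> = (\<Oplus>\<^bsub>N\<^esub>p\<in>I. g (direct_sum_incl I A p (h p)))"
    by (rule N.finsum_cong') (auto simp: eq hp linear_maps_closed[OF g c])
  also have "\<dots> = g ?s"
    by (rule linear_maps_finsum[OF D.module_axioms assms(4) g c, symmetric])
  finally show ?thesis
    using direct_sum_decompose[OF assms(1-3) h] by simp
qed

section \<open>The direct sum of the algebras of a family of objects\<close>

lemma finsum_scalar_algebra: "finsum (scalar_algebra K) = finsum K"
  by (simp add: fun_eq_iff finsum_def finprod_def scalar_algebra_def)

text \<open>The objects \<open>X 1, \<dots>, X n\<close> may repeat, hence all summands are indexed by positions.\<close>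

locale cogroupoid_family = cogroupoid K ob C \<Delta> \<epsilon> S
  for K (structure) and ob :: "'o set" and C :: "'o \<Rightarrow> 'o \<Rightarrow> ('k, 'a) module" and \<Delta> \<epsilon> S +
  fixes n :: nat and X :: "nat \<Rightarrow> 'o"
  assumes family_ob: "i \<in> {1..n} \<Longrightarrow> X i \<in> ob"
begin

text \<open>The set of positions is a constant of its own, so that simplification does not take \<open>i \<in> J\<close> apart into
inequalities.\<close>

definition J :: "nat set" where "J = {1..n}"

abbreviation B where "B i j \<equiv> C (X i) (X j)"
abbreviation H where "H \<equiv> cog_algebra C n X"
abbreviation HH where "HH \<equiv> tensor K H H"
abbreviation \<iota> where "\<iota> i j \<equiv> cog_incl C n X (i, j)"
abbreviation e where "e i j \<equiv> \<iota> i j \<one>\<^bsub>B i j\<^esub>"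
abbreviation comult where "comult i j l \<equiv> \<Delta> (X i) (X j) (X l)"
abbreviation \<Delta>H where "\<Delta>H \<equiv> cog_comult K C \<Delta> n X"
abbreviation \<epsilon>H where "\<epsilon>H \<equiv> cog_counit K \<epsilon> n X"
abbreviation SH where "SH \<equiv> cog_antipode C S n X"

lemma finite_J [simp]: "finite J"
  by (simp add: J_def)

lemma object_in_ob: "i \<in> J \<Longrightarrow> X i \<in> ob"
  unfolding J_def by (rule family_ob)

lemma block_algebra: "\<lbrakk>i \<in> J; j \<in> J\<rbrakk> \<Longrightarrow> unital_algebra K (B i j)"
  using object_in_ob by (intro algebra)

lemma block_module: "\<lbrakk>i \<in> J; j \<in> J\<rbrakk> \<Longrightarrow> module K (B i j)"
  using block_algebra by (simp add: unital_algebra_def)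

lemma block_ring: "\<lbrakk>i \<in> J; j \<in> J\<rbrakk> \<Longrightarrow> ring (B i j)"
  using block_algebra by (simp add: unital_algebra_def)

lemma block_one_closed: "\<lbrakk>i \<in> J; j \<in> J\<rbrakk> \<Longrightarrow> \<one>\<^bsub>B i j\<^esub> \<in> carrier (B i j)"
  using block_ring by (intro ring.ring_simprules)

lemma block_mult_closed:
  "\<lbrakk>i \<in> J; j \<in> J; a \<in> carrier (B i j); b \<in> carrier (B i j)\<rbrakk> \<Longrightarrow> a \<otimes>\<^bsub>B i j\<^esub> b \<in> carrier (B i j)"
  using block_ring by (intro ring.ring_simprules)

lemma index_mem: "p \<in> cog_index n \<longleftrightarrow> fst p \<in> J \<and> snd p \<in> J"
  unfolding J_def by (cases p) (simp add: cog_index_def)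

lemma cog_block_pair: "cog_block C X (i, j) = B i j"
  by (simp add: cog_block_def)

lemma cog_block_algebra: "p \<in> cog_index n \<Longrightarrow> unital_algebra K (cog_block C X p)"
  using block_algebra by (cases p) (simp add: index_mem cog_block_pair)

lemma cog_block_module: "p \<in> cog_index n \<Longrightarrow> module K (cog_block C X p)"
  using block_module by (cases p) (simp add: index_mem cog_block_pair)

lemma scalar_module: "module K (scalar_algebra K)"
  by (rule module_scalar_algebra[OF field_axioms])

lemma total_algebra: "unital_algebra K H"
  unfolding cog_algebra_def
  by (rule unital_algebra_direct_sum[OF field_axioms cog_block_algebra])

lemma total_module: "module K H"
  using total_algebra by (simp add: unital_algebra_def)

lemma square_module: "module K HH"
  by (rule module_tensor[OF total_module total_module])

sublocale H: unital_algebra K H by (rule total_algebra)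
sublocale HH: module K HH by (rule square_module)

lemma incl_linear: "\<lbrakk>i \<in> J; j \<in> J\<rbrakk> \<Longrightarrow> \<iota> i j \<in> linear_maps K (B i j) H"
  unfolding cog_algebra_def
  using direct_sum_incl_linear[of "cog_index n" K "cog_block C X" "(i, j)", OF cog_block_module]
  by (simp add: cog_block_pair)

lemma incl_closed: "\<lbrakk>i \<in> J; j \<in> J; a \<in> carrier (B i j)\<rbrakk> \<Longrightarrow> \<iota> i j a \<in> carrier H"
  using linear_maps_closed[OF incl_linear] .

lemma e_closed: "\<lbrakk>i \<in> J; j \<in> J\<rbrakk> \<Longrightarrow> e i j \<in> carrier H"
  by (simp only: incl_closed block_one_closed)

lemma component_closed: "\<lbrakk>x \<in> carrier H; i \<in> J; j \<in> J\<rbrakk> \<Longrightarrow> x (i, j) \<in> carrier (B i j)"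
  unfolding cog_algebra_def
  using direct_sum_component_closed[of x "cog_index n" "cog_block C X" "(i, j)"]
  by (simp add: index_mem cog_block_pair)

lemma component_linear: "\<lbrakk>i \<in> J; j \<in> J\<rbrakk> \<Longrightarrow> (\<lambda>x. x (i, j)) \<in> linear_maps K H (B i j)"
  by (rule linear_mapsI) (auto simp: component_closed cog_algebra_def direct_sum_component
      index_mem cog_block_pair)

lemma incl_component:
  "\<lbrakk>k \<in> J; l \<in> J\<rbrakk> \<Longrightarrow> \<iota> i j a (k, l) = (if (k, l) = (i, j) then a else \<zero>\<^bsub>B k l\<^esub>)"
  by (simp add: direct_sum_incl_def index_mem cog_block_pair)

lemma total_ext:
  assumes "x \<in> carrier H" "y \<in> carrier H" "\<And>k l. \<lbrakk>k \<in> J; l \<in> J\<rbrakk> \<Longrightarrow> x (k, l) = y (k, l)"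
  shows "x = y"
proof (rule direct_sum_ext[OF assms(1,2)[unfolded cog_algebra_def]])
  fix p assume "p \<in> cog_index n"
  then show "x p = y p" using assms(3)[of "fst p" "snd p"] by (simp add: index_mem)
qed

lemma total_mult_component:
  "\<lbrakk>k \<in> J; l \<in> J\<rbrakk> \<Longrightarrow> (x \<otimes>\<^bsub>H\<^esub> y) (k, l) = x (k, l) \<otimes>\<^bsub>B k l\<^esub> y (k, l)"
  by (simp add: cog_algebra_def direct_sum_component(1) index_mem cog_block_pair)

text \<open>A summand is a two-sided ideal, and a product with one of its elements only sees the component of the
other factor in that summand.\<close>

lemma mult_incl:
  assumes "i \<in> J" "j \<in> J" "x \<in> carrier H" "a \<in> carrier (B i j)"
  shows mult_incl_right: "x \<otimes>\<^bsub>H\<^esub> \<iota> i j a = \<iota> i j (x (i, j) \<otimes>\<^bsub>B i j\<^esub> a)"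
    and mult_incl_left: "\<iota> i j a \<otimes>\<^bsub>H\<^esub> x = \<iota> i j (a \<otimes>\<^bsub>B i j\<^esub> x (i, j))"
proof -
  note c = component_closed[OF assms(3)] and \<iota>a = incl_closed[OF assms(1,2,4)]
  note m = block_mult_closed[OF assms(1,2)]
  note null = ring.ring_simprules(24,25)[OF block_ring]
  show "x \<otimes>\<^bsub>H\<^esub> \<iota> i j a = \<iota> i j (x (i, j) \<otimes>\<^bsub>B i j\<^esub> a)"
    by (rule total_ext[OF H.A.m_closed[OF assms(3) \<iota>a] incl_closed[OF assms(1,2) m[OF c[OF assms(1,2)] assms(4)]]])
      (simp add: total_mult_component incl_component null c)
  show "\<iota> i j a \<otimes>\<^bsub>H\<^esub> x = \<iota> i j (a \<otimes>\<^bsub>B i j\<^esub> x (i, j))"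
    by (rule total_ext[OF H.A.m_closed[OF \<iota>a assms(3)] incl_closed[OF assms(1,2) m[OF assms(4) c[OF assms(1,2)]]]])
      (simp add: total_mult_component incl_component null c)
qed

lemma incl_mult_incl:
  assumes "i \<in> J" "j \<in> J" "k \<in> J" "l \<in> J" "a \<in> carrier (B i j)" "b \<in> carrier (B k l)"
  shows "\<iota> i j a \<otimes>\<^bsub>H\<^esub> \<iota> k l b = (if i = k \<and> j = l then \<iota> i j (a \<otimes>\<^bsub>B i j\<^esub> b) else \<zero>\<^bsub>H\<^esub>)"
proof -
  note null = ring.ring_simprules(25)[OF block_ring[OF assms(1,2)] assms(5)]
  have "\<iota> i j a \<otimes>\<^bsub>H\<^esub> \<iota> k l b = \<iota> i j (a \<otimes>\<^bsub>B i j\<^esub> \<iota> k l b (i, j))"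
    by (rule mult_incl_left[OF assms(1,2) incl_closed[OF assms(3,4,6)] assms(5)])
  also have "\<iota> k l b (i, j) = (if i = k \<and> j = l then b else \<zero>\<^bsub>B i j\<^esub>)"
    using incl_component[OF assms(1,2)] by simp
  finally show ?thesis
    using null linear_maps_zero[OF block_module[OF assms(1,2)] total_module incl_linear[OF assms(1,2)]]
    by (cases "i = k \<and> j = l") auto
qed

lemma e_mult:
  assumes "i \<in> J" "j \<in> J" "k \<in> J" "l \<in> J"
  shows "e i j \<otimes>\<^bsub>H\<^esub> e k l = (if i = k \<and> j = l then e i j else \<zero>\<^bsub>H\<^esub>)"
  using incl_mult_incl[OF assms block_one_closed[OF assms(1,2)] block_one_closed[OF assms(3,4)]]
    ring.ring_simprules(12)[OF block_ring block_one_closed, OF assms(1,2,1,2)]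
  by auto

text \<open>The reduction to elements of one summand, on which all axioms are checked.\<close>

lemma total_linear_eqI:
  assumes "module K N" "f \<in> linear_maps K H N" "g \<in> linear_maps K H N"
    and "\<And>i j a. \<lbrakk>i \<in> J; j \<in> J; a \<in> carrier (B i j)\<rbrakk> \<Longrightarrow> f (\<iota> i j a) = g (\<iota> i j a)"
    and "h \<in> carrier H"
  shows "f h = g h"
proof -
  note a = assms[unfolded cog_algebra_def]
  have "finite (cog_index n)" by (simp add: cog_index_def)
  then show ?thesis
  proof (rule direct_sum_linear_eqI[OF _ is_cring cog_block_module assms(1) a(2,3) _ a(5)])
    fix p a assume "p \<in> cog_index n" "a \<in> carrier (cog_block C X p)"
    then show "f (cog_incl C n X p a) = g (cog_incl C n X p a)"
      using assms(4) by (cases p) (simp add: index_mem cog_block_pair)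
  qed
qed

section \<open>The structure maps on the summands\<close>

lemma block_comult:
  assumes "i \<in> J" "j \<in> J" "l \<in> J"
  shows block_comult_linear: "comult i j l \<in> linear_maps K (B i j) (tensor K (B i l) (B l j))"
    and block_comult_hom: "comult i j l \<in> ring_hom (B i j) (tensor K (B i l) (B l j))"
  using comult_hom[of "X i" "X j" "X l"] object_in_ob assms by (auto simp: algebra_homs_def)

lemma block_comult_closed:
  "\<lbrakk>i \<in> J; j \<in> J; l \<in> J; a \<in> carrier (B i j)\<rbrakk>
    \<Longrightarrow> comult i j l a \<in> carrier (tensor K (B i l) (B l j))"
  using linear_maps_closed[OF block_comult_linear] .

lemma block_counit:
  assumes "i \<in> J"
  shows block_counit_linear: "\<epsilon> (X i) \<in> linear_maps K (B i i) (scalar_algebra K)"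
    and block_counit_mult: "\<lbrakk>a \<in> carrier (B i i); b \<in> carrier (B i i)\<rbrakk>
      \<Longrightarrow> \<epsilon> (X i) (a \<otimes>\<^bsub>B i i\<^esub> b) = \<epsilon> (X i) a \<otimes> \<epsilon> (X i) b"
    and block_counit_one: "\<epsilon> (X i) \<one>\<^bsub>B i i\<^esub> = \<one>"
  using counit_hom[of "X i"] object_in_ob assms
  by (auto simp: algebra_homs_def ring_hom_def scalar_algebra_def)

lemma block_counit_closed: "\<lbrakk>i \<in> J; a \<in> carrier (B i i)\<rbrakk> \<Longrightarrow> \<epsilon> (X i) a \<in> carrier K"
  using linear_maps_closed[OF block_counit_linear] by (simp add: scalar_algebra_def)

lemma block_antipode_linear:
  "\<lbrakk>i \<in> J; j \<in> J\<rbrakk> \<Longrightarrow> S (X i) (X j) \<in> linear_maps K (B i j) (B j i)"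
  using object_in_ob by (intro antipode_linear)

lemma block_antipode_closed:
  "\<lbrakk>i \<in> J; j \<in> J; a \<in> carrier (B i j)\<rbrakk> \<Longrightarrow> S (X i) (X j) a \<in> carrier (B j i)"
  using linear_maps_closed[OF block_antipode_linear] .

abbreviation \<iota>\<iota> where "\<iota>\<iota> i j l \<equiv> tensor_map K H H (\<iota> i l) (\<iota> l j)"

lemma incl2_linear:
  "\<lbrakk>i \<in> J; j \<in> J; l \<in> J\<rbrakk> \<Longrightarrow> \<iota>\<iota> i j l \<in> linear_maps K (tensor K (B i l) (B l j)) HH"
  by (intro tensor_map_linear block_module total_module incl_linear)

lemma comult_part_linear:
  "\<lbrakk>i \<in> J; j \<in> J; l \<in> J\<rbrakk> \<Longrightarrow> (\<lambda>a. \<iota>\<iota> i j l (comult i j l a)) \<in> linear_maps K (B i j) HH"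
  by (rule linear_maps_comp[OF incl2_linear block_comult_linear])

lemma counit_part_linear:
  assumes "i \<in> J" "j \<in> J"
  shows "(\<lambda>a. if i = j then \<epsilon> (X i) a else \<zero>) \<in> linear_maps K (B i j) (scalar_algebra K)"
proof -
  have "\<zero>\<^bsub>scalar_algebra K\<^esub> = \<zero>" by (simp add: scalar_algebra_def)
  then show ?thesis
    using block_counit_linear[OF assms(1)] zero_map_linear[OF scalar_module, of "B i j"]
    by (cases "i = j") simp_all
qed

lemma total_comult_linear: "\<Delta>H \<in> linear_maps K H HH"
proof -
  have "(\<lambda>h. \<Oplus>\<^bsub>HH\<^esub>i\<in>J. \<Oplus>\<^bsub>HH\<^esub>j\<in>J. \<Oplus>\<^bsub>HH\<^esub>l\<in>J. \<iota>\<iota> i j l (comult i j l (h (i, j)))) \<in> linear_maps K H HH"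
    by (intro finsum_linear total_module square_module
        linear_maps_comp[OF comult_part_linear component_linear])
  then show ?thesis unfolding cog_comult_def Let_def J_def .
qed

lemma total_counit_linear: "\<epsilon>H \<in> linear_maps K H (scalar_algebra K)"
proof -
  have "(\<lambda>h. \<Oplus>\<^bsub>scalar_algebra K\<^esub>i\<in>J. \<Oplus>\<^bsub>scalar_algebra K\<^esub>j\<in>J. if i = j then \<epsilon> (X i) (h (i, j)) else \<zero>)
      \<in> linear_maps K H (scalar_algebra K)"
    by (intro finsum_linear total_module scalar_module
      linear_maps_comp[OF counit_part_linear component_linear])
  then show ?thesis unfolding cog_counit_def finsum_scalar_algebra J_def .
qed

lemma antipode_part_linear:
  "\<lbrakk>i \<in> J; j \<in> J\<rbrakk> \<Longrightarrow> (\<lambda>a. \<iota> j i (S (X i) (X j) a)) \<in> linear_maps K (B i j) H"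
  by (rule linear_maps_comp[OF incl_linear block_antipode_linear])

lemma total_antipode_linear: "SH \<in> linear_maps K H H"
proof -
  have "(\<lambda>h. \<Oplus>\<^bsub>H\<^esub>i\<in>J. \<Oplus>\<^bsub>H\<^esub>j\<in>J. \<iota> j i (S (X i) (X j) (h (i, j)))) \<in> linear_maps K H H"
    by (intro finsum_linear total_module linear_maps_comp[OF antipode_part_linear component_linear])
  then show ?thesis unfolding cog_antipode_def Let_def J_def .
qed

text \<open>The structure maps of \<open>H\<close> are double sums over all components of their argument; on an element of one
summand a single component contributes.\<close>

lemma block_sum_incl:
  assumes "module K N" "i \<in> J" "j \<in> J" "a \<in> carrier (B i j)"
    and F: "\<And>k l. \<lbrakk>k \<in> J; l \<in> J\<rbrakk> \<Longrightarrow> F k l \<in> linear_maps K (B k l) N"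
  shows "(\<Oplus>\<^bsub>N\<^esub>k\<in>J. \<Oplus>\<^bsub>N\<^esub>l\<in>J. F k l (\<iota> i j a (k, l))) = F i j a"
proof -
  interpret N: module K N by fact
  have z: "F k l \<zero>\<^bsub>B k l\<^esub> = \<zero>\<^bsub>N\<^esub>" if "k \<in> J" "l \<in> J" for k l
    using linear_maps_zero[OF block_module[OF that] assms(1) F[OF that]] .
  have c: "F i j a \<in> carrier N" using linear_maps_closed[OF F] assms by blast
  have row: "(\<Oplus>\<^bsub>N\<^esub>l\<in>J. F k l (\<iota> i j a (k, l))) = (if k = i then F i j a else \<zero>\<^bsub>N\<^esub>)"
    if k: "k \<in> J" for k
  proof (cases "k = i")
    case True
    have "(\<Oplus>\<^bsub>N\<^esub>l\<in>J. F i l (\<iota> i j a (i, l))) = F i j (\<iota> i j a (i, j))"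
      using assms(2,3) c by (intro N.finsum_single finite_J) (simp_all add: incl_component z)
    then show ?thesis using True assms(2,3) by (simp add: incl_component)
  next
    case False
    then show ?thesis using k by (simp add: incl_component z N.add.finprod_one_eqI)
  qed
  have "(\<Oplus>\<^bsub>N\<^esub>k\<in>J. \<Oplus>\<^bsub>N\<^esub>l\<in>J. F k l (\<iota> i j a (k, l)))
      = (\<Oplus>\<^bsub>N\<^esub>l\<in>J. F i l (\<iota> i j a (i, l)))"
    using assms(2) c by (intro N.finsum_single finite_J) (simp_all add: row)
  then show ?thesis using row[OF assms(2)] by simp
qed

lemma total_comult_incl:
  assumes "i \<in> J" "j \<in> J" "a \<in> carrier (B i j)"
  shows "\<Delta>H (\<iota> i j a) = (\<Oplus>\<^bsub>HH\<^esub>l\<in>J. \<iota>\<iota> i j l (comult i j l a))"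
  unfolding cog_comult_def Let_def J_def[symmetric]
  by (rule block_sum_incl[OF square_module assms,
        where F = "\<lambda>i j a. \<Oplus>\<^bsub>HH\<^esub>l\<in>J. \<iota>\<iota> i j l (comult i j l a)"])
    (rule finsum_linear[OF block_module square_module comult_part_linear])

lemma total_counit_incl:
  assumes "i \<in> J" "j \<in> J" "a \<in> carrier (B i j)"
  shows "\<epsilon>H (\<iota> i j a) = (if i = j then \<epsilon> (X i) a else \<zero>)"
  unfolding cog_counit_def J_def[symmetric]
  by (rule block_sum_incl[OF scalar_module assms,
        where F = "\<lambda>i j a. if i = j then \<epsilon> (X i) a else \<zero>", OF counit_part_linear,
        unfolded finsum_scalar_algebra])

lemma total_antipode_incl:
  assumes "i \<in> J" "j \<in> J" "a \<in> carrier (B i j)"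
  shows "SH (\<iota> i j a) = \<iota> j i (S (X i) (X j) a)"
  unfolding cog_antipode_def Let_def J_def[symmetric]
  by (rule block_sum_incl[OF total_module assms,
        where F = "\<lambda>i j a. \<iota> j i (S (X i) (X j) a)", OF antipode_part_linear])

text \<open>This moves the inclusions of the summands from the comultiplication into \<open>\<beta>\<close>, so that orthogonality can be
applied inside \<open>\<beta>\<close> for each \<open>l\<close> separately.\<close>

lemma lift_comult_incl:
  assumes "module K P" "\<beta> \<in> bilinear_maps K H H P" "i \<in> J" "j \<in> J" "a \<in> carrier (B i j)"
  shows "tensor_lift P \<beta> (\<Delta>H (\<iota> i j a))
    = (\<Oplus>\<^bsub>P\<^esub>l\<in>J. tensor_lift P (\<lambda>u v. \<beta> (\<iota> i l u) (\<iota> l j v)) (comult i j l a))"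
proof -
  interpret P: module K P by fact
  have "tensor_lift P \<beta> (\<Delta>H (\<iota> i j a)) = (\<Oplus>\<^bsub>P\<^esub>l\<in>J. tensor_lift P \<beta> (\<iota>\<iota> i j l (comult i j l a)))"
    unfolding total_comult_incl[OF assms(3-5)]
    by (rule linear_maps_finsum[OF square_module assms(1) tensor_universal(1)[OF total_module total_module assms(1,2)]])
      (rule linear_maps_closed[OF comult_part_linear assms(5)], use assms in auto)
  also have "\<dots> = (\<Oplus>\<^bsub>P\<^esub>l\<in>J. tensor_lift P (\<lambda>u v. \<beta> (\<iota> i l u) (\<iota> l j v)) (comult i j l a))"
  proof (rule P.finsum_cong'[OF HOL.refl])
    fix l assume l: "l \<in> J"
    note il = incl_linear[OF assms(3) l] and lj = incl_linear[OF l assms(4)]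
      and m = block_module[OF assms(3) l] block_module[OF l assms(4)]
      and c = block_comult_closed[OF assms(3,4) l assms(5)]
    show "tensor_lift P \<beta> (\<iota>\<iota> i j l (comult i j l a))
        = tensor_lift P (\<lambda>u v. \<beta> (\<iota> i l u) (\<iota> l j v)) (comult i j l a)"
      by (rule tensor_lift_tensor_map[OF m total_module total_module assms(1) il lj assms(2) c])
  next
    show "(\<lambda>l. tensor_lift P (\<lambda>u v. \<beta> (\<iota> i l u) (\<iota> l j v)) (comult i j l a)) \<in> J \<rightarrow> carrier P"
    proof
      fix l assume l: "l \<in> J"
      show "tensor_lift P (\<lambda>u v. \<beta> (\<iota> i l u) (\<iota> l j v)) (comult i j l a) \<in> carrier P"
        by (rule tensor_lift_closed[OF block_module[OF assms(3) l] block_module[OF l assms(4)] assms(1)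
            bilinear_maps_precomp[OF assms(2) incl_linear[OF assms(3) l] incl_linear[OF l assms(4)]]
            block_comult_closed[OF assms(3,4) l assms(5)]])
    qed
  qed
  finally show ?thesis .
qed

lemma block_mult_bilinear:
  "\<lbrakk>i \<in> J; j \<in> J\<rbrakk> \<Longrightarrow> mult (B i j) \<in> bilinear_maps K (B i j) (B i j) (B i j)"
  by (rule unital_algebra.mult_bilinear[OF block_algebra])

text \<open>The counit axiom of the cogroupoid followed by a linear map \<open>f\<close>. Here and in the mirror image below, \<open>f\<close>
will be an inclusion into \<open>H\<close>, an inclusion after the antipode, or a multiple of the counit.\<close>

lemma lift_block_counit_right:
  assumes "i \<in> J" "j \<in> J" "a \<in> carrier (B i j)" "module K P" "f \<in> linear_maps K (B i j) P"
  shows "tensor_lift P (\<lambda>u v. \<epsilon> (X j) v \<odot>\<^bsub>P\<^esub> f u) (comult i j j a) = f a"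
proof -
  note Bij = block_module[OF assms(1,2)] and Bjj = block_module[OF assms(2,2)]
    and c = block_comult_closed[OF assms(1,2,2,3)]
    and \<epsilon>l = block_counit_linear[OF assms(2)] and b = bilinear_maps_flip[OF smult_bilinear[of K "B i j"]]
  have "a = tensor_runit (B i j)
      (tensor_map K (B i j) (scalar_algebra K) (\<lambda>x. x) (\<epsilon> (X j)) (comult i j j a))"
    using counit_right[of "X i" "X j" a] assms object_in_ob by simp
  also have "\<dots> = tensor_lift (B i j) (\<lambda>u v. \<epsilon> (X j) v \<odot>\<^bsub>B i j\<^esub> u) (comult i j j a)"
    unfolding tensor_runit_def
    by (rule tensor_lift_tensor_map[OF Bij Bjj Bij scalar_module Bij linear_maps_id \<epsilon>l b[OF Bij] c])
  finally have "f a = f (tensor_lift (B i j) (\<lambda>u v. \<epsilon> (X j) v \<odot>\<^bsub>B i j\<^esub> u) (comult i j j a))"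
    by simp
  also have "\<dots> = tensor_lift P (\<lambda>u v. f (\<epsilon> (X j) v \<odot>\<^bsub>B i j\<^esub> u)) (comult i j j a)"
    by (rule linear_tensor_lift[OF Bij Bjj Bij assms(4) bilinear_maps_precomp[OF b[OF Bij] linear_maps_id \<epsilon>l]
          assms(5) c])
  also have "\<dots> = tensor_lift P (\<lambda>u v. \<epsilon> (X j) v \<odot>\<^bsub>P\<^esub> f u) (comult i j j a)"
    by (rule tensor_lift_cong[OF Bij Bjj c])
      (simp add: linear_maps_smult[OF assms(5)] block_counit_closed assms(2))
  finally show ?thesis by simp
qed

lemma lift_block_counit_left:
  assumes "i \<in> J" "j \<in> J" "a \<in> carrier (B i j)" "module K P" "f \<in> linear_maps K (B i j) P"
  shows "tensor_lift P (\<lambda>u v. \<epsilon> (X i) u \<odot>\<^bsub>P\<^esub> f v) (comult i j i a) = f a"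
proof -
  note Bij = block_module[OF assms(1,2)] and Bii = block_module[OF assms(1,1)]
    and c = block_comult_closed[OF assms(1,2,1,3)]
    and \<epsilon>l = block_counit_linear[OF assms(1)] and b = smult_bilinear[of K "B i j"]
  have "a = tensor_lunit (B i j)
      (tensor_map K (scalar_algebra K) (B i j) (\<epsilon> (X i)) (\<lambda>x. x) (comult i j i a))"
    using counit_left[of "X i" "X j" a] assms object_in_ob by simp
  also have "\<dots> = tensor_lift (B i j) (\<lambda>u v. \<epsilon> (X i) u \<odot>\<^bsub>B i j\<^esub> v) (comult i j i a)"
    unfolding tensor_lunit_def
    by (rule tensor_lift_tensor_map[OF Bii Bij scalar_module Bij Bij \<epsilon>l linear_maps_id b[OF Bij] c])
  finally have "f a = f (tensor_lift (B i j) (\<lambda>u v. \<epsilon> (X i) u \<odot>\<^bsub>B i j\<^esub> v) (comult i j i a))"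
    by simp
  also have "\<dots> = tensor_lift P (\<lambda>u v. f (\<epsilon> (X i) u \<odot>\<^bsub>B i j\<^esub> v)) (comult i j i a)"
    by (rule linear_tensor_lift[OF Bii Bij Bij assms(4) bilinear_maps_precomp[OF b[OF Bij] \<epsilon>l linear_maps_id]
          assms(5) c])
  also have "\<dots> = tensor_lift P (\<lambda>u v. \<epsilon> (X i) u \<odot>\<^bsub>P\<^esub> f v) (comult i j i a)"
    by (rule tensor_lift_cong[OF Bii Bij c])
      (simp add: linear_maps_smult[OF assms(5)] block_counit_closed assms(1))
  finally show ?thesis by simp
qed

lemma lift_block_antipode_right:
  assumes "i \<in> J" "j \<in> J" "a \<in> carrier (B i i)"
  shows "tensor_lift (B i j) (\<lambda>u v. u \<otimes>\<^bsub>B i j\<^esub> S (X j) (X i) v) (comult i i j a)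
    = \<epsilon> (X i) a \<odot>\<^bsub>B i j\<^esub> \<one>\<^bsub>B i j\<^esub>"
  using antipode_right[of "X i" "X j" a] assms object_in_ob
    tensor_lift_tensor_map[OF block_module[OF assms(1,2)] block_module[OF assms(2,1)]
      block_module[OF assms(1,2)] block_module[OF assms(1,2)] block_module[OF assms(1,2)]
      linear_maps_id block_antipode_linear[OF assms(2,1)] block_mult_bilinear[OF assms(1,2)]
      block_comult_closed[OF assms(1,1,2,3)]]
  by (simp add: mult_map_def)

lemma lift_block_antipode_left:
  assumes "i \<in> J" "j \<in> J" "a \<in> carrier (B i i)"
  shows "tensor_lift (B j i) (\<lambda>u v. S (X i) (X j) u \<otimes>\<^bsub>B j i\<^esub> v) (comult i i j a)
    = \<epsilon> (X i) a \<odot>\<^bsub>B j i\<^esub> \<one>\<^bsub>B j i\<^esub>"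
  using antipode_left[of "X i" "X j" a] assms object_in_ob
    tensor_lift_tensor_map[OF block_module[OF assms(1,2)] block_module[OF assms(2,1)]
      block_module[OF assms(2,1)] block_module[OF assms(2,1)] block_module[OF assms(2,1)]
      block_antipode_linear[OF assms(1,2)] linear_maps_id block_mult_bilinear[OF assms(2,1)]
      block_comult_closed[OF assms(1,1,2,3)]]
  by (simp add: mult_map_def)

section \<open>Coassociativity and counit\<close>

lemma total_comult_closed: "x \<in> carrier H \<Longrightarrow> \<Delta>H x \<in> carrier HH"
  by (rule linear_maps_closed[OF total_comult_linear])

text \<open>Both sides are double sums. On the left the sum over \<open>l\<close> comes from the first comultiplication and the
sum over \<open>k\<close> from the second, applied to the left factor; on the right \<open>k\<close> comes first and \<open>l\<close> from the
comultiplication of the right factor. The \<open>(k,l)\<close> terms are the images in \<open>H \<otimes> (H \<otimes> H)\<close> of the two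
sides of the coassociativity axiom.\<close>

lemma total_coassoc:
  assumes "x \<in> carrier H"
  shows "tensor_assoc K H H H (tensor_map K HH H \<Delta>H (\<lambda>x. x) (\<Delta>H x))
    = tensor_map K H HH (\<lambda>x. x) \<Delta>H (\<Delta>H x)"
proof -
  note Hm = total_module and HHm = square_module
  let ?T = "tensor K H HH" and ?D = "tensor_map K HH H \<Delta>H (\<lambda>x. x)"
    and ?D' = "tensor_map K H HH (\<lambda>x. x) \<Delta>H"
  have Tm: "module K ?T" by (rule module_tensor[OF Hm HHm])
  have D: "?D \<in> linear_maps K HH (tensor K HH H)"
    by (rule tensor_map_linear[OF Hm Hm HHm Hm total_comult_linear linear_maps_id])
  have D': "?D' \<in> linear_maps K HH ?T"
    by (rule tensor_map_linear[OF Hm Hm Hm HHm linear_maps_id total_comult_linear])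
  have assoc: "tensor_assoc K H H H \<in> linear_maps K (tensor K HH H) ?T"
    by (rule tensor_assoc_linear[OF Hm Hm Hm])
  show ?thesis
  proof (rule total_linear_eqI[OF Tm _ _ _ assms])
    show "(\<lambda>x. tensor_assoc K H H H (?D (\<Delta>H x))) \<in> linear_maps K H ?T"
      by (rule linear_maps_comp[OF assoc linear_maps_comp[OF D total_comult_linear]])
    show "(\<lambda>x. ?D' (\<Delta>H x)) \<in> linear_maps K H ?T"
      by (rule linear_maps_comp[OF D' total_comult_linear])
    fix i j a assume ij: "i \<in> J" "j \<in> J" and a: "a \<in> carrier (B i j)"
    let ?\<iota>3 = "\<lambda>k l. tensor_map K H HH (\<iota> i k) (\<iota>\<iota> k j l)"
    let ?w = "\<lambda>k l. tensor_map K (B i k) (tensor K (B k l) (B l j)) (\<lambda>x. x) (comult k j l) (comult i j k a)"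
    interpret T: module K ?T by (rule Tm)
    have W: "?\<iota>3 k l (?w k l) \<in> carrier ?T" if kl: "k \<in> J" "l \<in> J" for k l
    proof -
      note m = block_module[OF ij(1) kl(1)] block_module[OF kl(1) ij(2)]
        module_tensor[OF block_module[OF kl] block_module[OF kl(2) ij(2)]]
      have "?w k l \<in> carrier (tensor K (B i k) (tensor K (B k l) (B l j)))"
        by (rule tensor_map_closed[OF m(1,2,1,3) linear_maps_id block_comult_linear[OF kl(1) ij(2) kl(2)]
            block_comult_closed[OF ij kl(1) a]])
      then show ?thesis
        by (rule tensor_map_closed[OF m(1,3) Hm HHm incl_linear[OF ij(1) kl(1)] incl2_linear[OF kl(1) ij(2) kl(2)]])
    qed
    have right: "?D' (\<iota>\<iota> i j k (comult i j k a)) = (\<Oplus>\<^bsub>?T\<^esub>l\<in>J. ?\<iota>3 k l (?w k l))" if k: "k \<in> J" for k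
    proof -
      note m = block_module[OF ij(1) k] block_module[OF k ij(2)]
        and c = block_comult_closed[OF ij k a] and il = incl_linear[OF ij(1) k] incl_linear[OF k ij(2)]
      have "?D' (\<iota>\<iota> i j k (comult i j k a)) = tensor_map K H HH (\<iota> i k) (\<lambda>v. \<Delta>H (\<iota> k j v)) (comult i j k a)"
        by (rule tensor_map_comp[OF m Hm Hm Hm HHm il linear_maps_id total_comult_linear c])
      also have "\<dots> = tensor_map K H HH (\<iota> i k) (\<lambda>v. \<Oplus>\<^bsub>HH\<^esub>l\<in>J. \<iota>\<iota> k j l (comult k j l v)) (comult i j k a)"
        by (rule tensor_map_cong[OF m c HOL.refl total_comult_incl[OF k ij(2)]])
      also have "\<dots> = (\<Oplus>\<^bsub>?T\<^esub>l\<in>J. tensor_map K H HH (\<iota> i k) (\<lambda>v. \<iota>\<iota> k j l (comult k j l v)) (comult i j k a))"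
        by (rule tensor_map_finsum_right[OF m Hm HHm il(1) comult_part_linear[OF k ij(2)] c])
      also have "\<dots> = (\<Oplus>\<^bsub>?T\<^esub>l\<in>J. ?\<iota>3 k l (?w k l))"
      proof (rule T.finsum_cong'[OF HOL.refl])
        fix l assume l: "l \<in> J"
        show "tensor_map K H HH (\<iota> i k) (\<lambda>v. \<iota>\<iota> k j l (comult k j l v)) (comult i j k a) = ?\<iota>3 k l (?w k l)"
          by (rule tensor_map_comp[OF m m(1) module_tensor[OF block_module[OF k l] block_module[OF l ij(2)]]
              Hm HHm linear_maps_id block_comult_linear[OF k ij(2) l] il(1) incl2_linear[OF k ij(2) l] c,
              symmetric])
      qed (use W k in auto)
      finally show ?thesis .
    qed
    have left: "tensor_assoc K H H H (?D (\<iota>\<iota> i j l (comult i j l a))) = (\<Oplus>\<^bsub>?T\<^esub>k\<in>J. ?\<iota>3 k l (?w k l))"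
      if l: "l \<in> J" for l
    proof -
      note m = block_module[OF ij(1) l] block_module[OF l ij(2)]
        and c = block_comult_closed[OF ij l a] and il = incl_linear[OF ij(1) l] incl_linear[OF l ij(2)]
      let ?v = "\<lambda>k. tensor_map K (tensor K (B i k) (B k l)) (B l j) (comult i l k) (\<lambda>x. x) (comult i j l a)"
      have v: "?v k \<in> carrier (tensor K (tensor K (B i k) (B k l)) (B l j))" if k: "k \<in> J" for k
        by (rule tensor_map_closed[OF m module_tensor[OF block_module[OF ij(1) k] block_module[OF k l]] m(2)
            block_comult_linear[OF ij(1) l k] linear_maps_id c])
      have cl: "tensor_map K HH H (\<iota>\<iota> i l k) (\<iota> l j) (?v k) \<in> carrier (tensor K HH H)" if k: "k \<in> J" for k
        by (rule tensor_map_closed[OF module_tensor[OF block_module[OF ij(1) k] block_module[OF k l]] m(2)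
            HHm Hm incl2_linear[OF ij(1) l k] il(2) v[OF k]])
      have "?D (\<iota>\<iota> i j l (comult i j l a)) = tensor_map K HH H (\<lambda>u. \<Delta>H (\<iota> i l u)) (\<iota> l j) (comult i j l a)"
        by (rule tensor_map_comp[OF m Hm Hm HHm Hm il total_comult_linear linear_maps_id c])
      also have "\<dots> = tensor_map K HH H (\<lambda>u. \<Oplus>\<^bsub>HH\<^esub>k\<in>J. \<iota>\<iota> i l k (comult i l k u)) (\<iota> l j) (comult i j l a)"
        by (rule tensor_map_cong[OF m c total_comult_incl[OF ij(1) l] HOL.refl])
      also have "\<dots> = (\<Oplus>\<^bsub>tensor K HH H\<^esub>k\<in>J.
          tensor_map K HH H (\<lambda>u. \<iota>\<iota> i l k (comult i l k u)) (\<iota> l j) (comult i j l a))"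
        by (rule tensor_map_finsum_left[OF m HHm Hm comult_part_linear[OF ij(1) l] il(2) c])
      also have "\<dots> = (\<Oplus>\<^bsub>tensor K HH H\<^esub>k\<in>J. tensor_map K HH H (\<iota>\<iota> i l k) (\<iota> l j) (?v k))"
      proof (rule abelian_monoid.finsum_cong'[OF _ HOL.refl])
        show "abelian_monoid (tensor K HH H)"
          using module_tensor[OF HHm Hm] by (simp add: module_def abelian_group_def)
        fix k assume k: "k \<in> J"
        show "tensor_map K HH H (\<lambda>u. \<iota>\<iota> i l k (comult i l k u)) (\<iota> l j) (comult i j l a)
            = tensor_map K HH H (\<iota>\<iota> i l k) (\<iota> l j) (?v k)"
          by (rule tensor_map_comp[OF m module_tensor[OF block_module[OF ij(1) k] block_module[OF k l]] m(2)
              HHm Hm block_comult_linear[OF ij(1) l k] linear_maps_id incl2_linear[OF ij(1) l k] il(2) c,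
              symmetric])
      qed (use cl in auto)
      finally have "tensor_assoc K H H H (?D (\<iota>\<iota> i j l (comult i j l a)))
          = (\<Oplus>\<^bsub>?T\<^esub>k\<in>J. tensor_assoc K H H H (tensor_map K HH H (\<iota>\<iota> i l k) (\<iota> l j) (?v k)))"
        by (simp add: linear_maps_finsum[OF module_tensor[OF HHm Hm] Tm assoc cl])
      also have "\<dots> = (\<Oplus>\<^bsub>?T\<^esub>k\<in>J. ?\<iota>3 k l (?w k l))"
      proof (rule T.finsum_cong'[OF HOL.refl])
        fix k assume k: "k \<in> J"
        have "tensor_assoc K H H H (tensor_map K HH H (\<iota>\<iota> i l k) (\<iota> l j) (?v k))
            = ?\<iota>3 k l (tensor_assoc K (B i k) (B k l) (B l j) (?v k))"
          by (rule tensor_assoc_natural[OF block_module[OF ij(1) k] block_module[OF k l] m(2) Hm Hm Hm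
              incl_linear[OF ij(1) k] incl_linear[OF k l] il(2) v[OF k], symmetric])
        also have "tensor_assoc K (B i k) (B k l) (B l j) (?v k) = ?w k l"
          using coassoc[of "X i" "X j" "X l" "X k" a] ij k l a object_in_ob by simp
        finally show "tensor_assoc K H H H (tensor_map K HH H (\<iota>\<iota> i l k) (\<iota> l j) (?v k)) = ?\<iota>3 k l (?w k l)" .
      qed (use W l in auto)
      finally show ?thesis .
    qed
    note pc = linear_maps_closed[OF comult_part_linear[OF ij] a]
    have "tensor_assoc K H H H (?D (\<Delta>H (\<iota> i j a)))
        = (\<Oplus>\<^bsub>?T\<^esub>l\<in>J. tensor_assoc K H H H (?D (\<iota>\<iota> i j l (comult i j l a))))"
      unfolding total_comult_incl[OF ij a]
      by (rule linear_maps_finsum[OF HHm Tm linear_maps_comp[OF assoc D] pc])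
    also have "\<dots> = (\<Oplus>\<^bsub>?T\<^esub>l\<in>J. \<Oplus>\<^bsub>?T\<^esub>k\<in>J. ?\<iota>3 k l (?w k l))"
      using W by (intro T.finsum_cong'[OF HOL.refl] left funcsetI T.finsum_closed)
    also have "\<dots> = (\<Oplus>\<^bsub>?T\<^esub>k\<in>J. \<Oplus>\<^bsub>?T\<^esub>l\<in>J. ?\<iota>3 k l (?w k l))"
      using W by (intro T.finsum_swap finite_J)
    also have "\<dots> = (\<Oplus>\<^bsub>?T\<^esub>k\<in>J. ?D' (\<iota>\<iota> i j k (comult i j k a)))"
      using W by (intro T.finsum_cong'[OF HOL.refl] right[symmetric] funcsetI)
        (auto simp: right intro: T.finsum_closed)
    also have "\<dots> = ?D' (\<Delta>H (\<iota> i j a))"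
      unfolding total_comult_incl[OF ij a]
      by (rule linear_maps_finsum[OF HHm Tm D' pc, symmetric])
    finally show "tensor_assoc K H H H (?D (\<Delta>H (\<iota> i j a))) = ?D' (\<Delta>H (\<iota> i j a))" .
  qed
qed

text \<open>Only \<open>l = j\<close> survives in the sum for \<open>\<Delta>(a)\<close>, as the counit vanishes on \<open>C(l,j)\<close> for \<open>l \<noteq> j\<close>.\<close>

lemma total_counit_right:
  assumes "x \<in> carrier H"
  shows "tensor_runit H (tensor_map K H (scalar_algebra K) (\<lambda>x. x) \<epsilon>H (\<Delta>H x)) = x"
proof -
  note b = bilinear_maps_flip[OF smult_bilinear[OF total_module]]
    and Hm = total_module
  note b' = bilinear_maps_precomp[OF b linear_maps_id total_counit_linear]
  have "tensor_runit H (tensor_map K H (scalar_algebra K) (\<lambda>x. x) \<epsilon>H (\<Delta>H x))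
      = tensor_lift H (\<lambda>u v. \<epsilon>H v \<odot>\<^bsub>H\<^esub> u) (\<Delta>H x)"
    unfolding tensor_runit_def
    by (rule tensor_lift_tensor_map[OF Hm Hm Hm scalar_module Hm linear_maps_id total_counit_linear b
          total_comult_closed[OF assms]])
  also have "\<dots> = x"
  proof (rule total_linear_eqI[OF Hm _ linear_maps_id _ assms])
    show "(\<lambda>x. tensor_lift H (\<lambda>u v. \<epsilon>H v \<odot>\<^bsub>H\<^esub> u) (\<Delta>H x)) \<in> linear_maps K H H"
      by (rule linear_maps_comp[OF tensor_universal(1)[OF Hm Hm Hm b'] total_comult_linear])
    fix i j a assume ij: "i \<in> J" "j \<in> J" and a: "a \<in> carrier (B i j)"
    have part: "tensor_lift H (\<lambda>u v. \<epsilon>H (\<iota> l j v) \<odot>\<^bsub>H\<^esub> \<iota> i l u) (comult i j l a)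
        = (if l = j then \<iota> i j a else \<zero>\<^bsub>H\<^esub>)" if l: "l \<in> J" for l
    proof -
      note m = block_module[OF ij(1) l] block_module[OF l ij(2)] and c = block_comult_closed[OF ij l a]
      show ?thesis
      proof (cases "l = j")
        case True
        have "tensor_lift H (\<lambda>u v. \<epsilon>H (\<iota> l j v) \<odot>\<^bsub>H\<^esub> \<iota> i l u) (comult i j l a)
            = tensor_lift H (\<lambda>u v. \<epsilon> (X j) v \<odot>\<^bsub>H\<^esub> \<iota> i j u) (comult i j l a)"
          by (rule tensor_lift_cong[OF m c]) (use True ij in \<open>simp add: total_counit_incl\<close>)
        then show ?thesis using lift_block_counit_right[OF ij a Hm incl_linear[OF ij]] True by simp
      next
        case False
        have "tensor_lift H (\<lambda>u v. \<epsilon>H (\<iota> l j v) \<odot>\<^bsub>H\<^esub> \<iota> i l u) (comult i j l a) = \<zero>\<^bsub>H\<^esub>"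
          by (rule tensor_lift_zero[OF m Hm c])
            (use False ij l in \<open>simp add: total_counit_incl incl_closed\<close>)
        with False show ?thesis by simp
      qed
    qed
    show "tensor_lift H (\<lambda>u v. \<epsilon>H v \<odot>\<^bsub>H\<^esub> u) (\<Delta>H (\<iota> i j a)) = \<iota> i j a"
      unfolding lift_comult_incl[OF Hm b' ij a]
      using ij a by (subst H.finsum_single[where a = j]) (auto simp: part incl_closed)
  qed
  finally show ?thesis .
qed

lemma total_counit_left:
  assumes "x \<in> carrier H"
  shows "tensor_lunit H (tensor_map K (scalar_algebra K) H \<epsilon>H (\<lambda>x. x) (\<Delta>H x)) = x"
proof -
  note b = smult_bilinear[OF total_module] and Hm = total_module
  note b' = bilinear_maps_precomp[OF b total_counit_linear linear_maps_id]
  have "tensor_lunit H (tensor_map K (scalar_algebra K) H \<epsilon>H (\<lambda>x. x) (\<Delta>H x))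
      = tensor_lift H (\<lambda>u v. \<epsilon>H u \<odot>\<^bsub>H\<^esub> v) (\<Delta>H x)"
    unfolding tensor_lunit_def
    by (rule tensor_lift_tensor_map[OF Hm Hm scalar_module Hm Hm total_counit_linear linear_maps_id b
          total_comult_closed[OF assms]])
  also have "\<dots> = x"
  proof (rule total_linear_eqI[OF Hm _ linear_maps_id _ assms])
    show "(\<lambda>x. tensor_lift H (\<lambda>u v. \<epsilon>H u \<odot>\<^bsub>H\<^esub> v) (\<Delta>H x)) \<in> linear_maps K H H"
      by (rule linear_maps_comp[OF tensor_universal(1)[OF Hm Hm Hm b'] total_comult_linear])
    fix i j a assume ij: "i \<in> J" "j \<in> J" and a: "a \<in> carrier (B i j)"
    have part: "tensor_lift H (\<lambda>u v. \<epsilon>H (\<iota> i l u) \<odot>\<^bsub>H\<^esub> \<iota> l j v) (comult i j l a)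
        = (if l = i then \<iota> i j a else \<zero>\<^bsub>H\<^esub>)" if l: "l \<in> J" for l
    proof -
      note m = block_module[OF ij(1) l] block_module[OF l ij(2)] and c = block_comult_closed[OF ij l a]
      show ?thesis
      proof (cases "l = i")
        case True
        have "tensor_lift H (\<lambda>u v. \<epsilon>H (\<iota> i l u) \<odot>\<^bsub>H\<^esub> \<iota> l j v) (comult i j l a)
            = tensor_lift H (\<lambda>u v. \<epsilon> (X i) u \<odot>\<^bsub>H\<^esub> \<iota> i j v) (comult i j l a)"
          by (rule tensor_lift_cong[OF m c]) (use True ij in \<open>simp add: total_counit_incl\<close>)
        then show ?thesis using lift_block_counit_left[OF ij a Hm incl_linear[OF ij]] True by simp
      next
        case False
        have "tensor_lift H (\<lambda>u v. \<epsilon>H (\<iota> i l u) \<odot>\<^bsub>H\<^esub> \<iota> l j v) (comult i j l a) = \<zero>\<^bsub>H\<^esub>"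
          by (rule tensor_lift_zero[OF m Hm c])
            (use False ij l in \<open>simp add: total_counit_incl incl_closed\<close>)
        with False show ?thesis by simp
      qed
    qed
    show "tensor_lift H (\<lambda>u v. \<epsilon>H u \<odot>\<^bsub>H\<^esub> v) (\<Delta>H (\<iota> i j a)) = \<iota> i j a"
      unfolding lift_comult_incl[OF Hm b' ij a]
      using ij a by (subst H.finsum_single[where a = i]) (auto simp: part incl_closed)
  qed
  finally show ?thesis .
qed

section \<open>Products and the coalgebra structure\<close>

lemma total_mult_bilinear: "mult H \<in> bilinear_maps K H H H"
  by (rule unital_algebra.mult_bilinear[OF total_algebra])

text \<open>Equal index triples: all three maps are multiplicative. Different triples: they differ in the index
pair of the first or of the second tensor factor, and these summands of \<open>H\<close> are orthogonal.\<close>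

lemma comult_part_mult:
  assumes "i \<in> J" "j \<in> J" "l \<in> J" "i' \<in> J" "j' \<in> J" "l' \<in> J"
    and "a \<in> carrier (B i j)" "b \<in> carrier (B i' j')"
  shows "\<iota>\<iota> i j l (comult i j l a) \<otimes>\<^bsub>HH\<^esub> \<iota>\<iota> i' j' l' (comult i' j' l' b)
    = (if i = i' \<and> j = j' \<and> l = l' then \<iota>\<iota> i j l (comult i j l (a \<otimes>\<^bsub>B i j\<^esub> b)) else \<zero>\<^bsub>HH\<^esub>)"
proof -
  note m = block_module[OF assms(1,3)] block_module[OF assms(3,2)]
    and il = incl_linear[OF assms(1,3)] incl_linear[OF assms(3,2)]
    and c = block_comult_closed[OF assms(1-3,7)]
    and Hm = total_module and mH = total_mult_bilinear
  show ?thesis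
  proof (cases "i = i' \<and> j = j' \<and> l = l'")
    case True
    then have b: "b \<in> carrier (B i j)" using assms(8) by simp
    note c' = block_comult_closed[OF assms(1-3) b]
    have "\<iota>\<iota> i j l (comult i j l (a \<otimes>\<^bsub>B i j\<^esub> b))
        = \<iota>\<iota> i j l (comult i j l a \<otimes>\<^bsub>tensor K (B i l) (B l j)\<^esub> comult i j l b)"
      by (simp only: ring_hom_mult[OF block_comult_hom[OF assms(1-3)] assms(7) b])
    also have "\<dots> = \<iota>\<iota> i j l (comult i j l a) \<otimes>\<^bsub>HH\<^esub> \<iota>\<iota> i j l (comult i j l b)"
    proof (rule tensor_map_mult[OF m Hm Hm block_mult_bilinear[OF assms(1,3)]
          block_mult_bilinear[OF assms(3,2)] mH mH il _ _ c c'])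
      show "\<iota> i l (x \<otimes>\<^bsub>B i l\<^esub> y) = \<iota> i l x \<otimes>\<^bsub>H\<^esub> \<iota> i l y"
        if "x \<in> carrier (B i l)" "y \<in> carrier (B i l)" for x y
        using incl_mult_incl[OF assms(1,3,1,3) that] by simp
      show "\<iota> l j (x \<otimes>\<^bsub>B l j\<^esub> y) = \<iota> l j x \<otimes>\<^bsub>H\<^esub> \<iota> l j y"
        if "x \<in> carrier (B l j)" "y \<in> carrier (B l j)" for x y
        using incl_mult_incl[OF assms(3,2,3,2) that] by simp
    qed
    finally show ?thesis using True by simp
  next
    case False
    note m' = block_module[OF assms(4,6)] block_module[OF assms(6,5)]
      and il' = incl_linear[OF assms(4,6)] incl_linear[OF assms(6,5)]
      and c' = block_comult_closed[OF assms(4-6,8)]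
    have "\<iota>\<iota> i j l (comult i j l a) \<otimes>\<^bsub>HH\<^esub> \<iota>\<iota> i' j' l' (comult i' j' l' b) = \<zero>\<^bsub>HH\<^esub>"
    proof (rule tensor_map_mult_zero[OF m m' Hm Hm mH mH il il' _ c c'])
      from False have "\<not> (i = i' \<and> l = l') \<or> \<not> (l = l' \<and> j = j')" by blast
      then show "(\<forall>x\<in>carrier (B i l). \<forall>y\<in>carrier (B i' l'). \<iota> i l x \<otimes>\<^bsub>H\<^esub> \<iota> i' l' y = \<zero>\<^bsub>H\<^esub>)
          \<or> (\<forall>x\<in>carrier (B l j). \<forall>y\<in>carrier (B l' j'). \<iota> l j x \<otimes>\<^bsub>H\<^esub> \<iota> l' j' y = \<zero>\<^bsub>H\<^esub>)"
        using incl_mult_incl[OF assms(1,3,4,6)] incl_mult_incl[OF assms(3,2,6,5)] by auto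
    qed
    then show ?thesis unfolding if_not_P[OF False] .
  qed
qed

lemma total_comult_mult:
  assumes x: "x \<in> carrier H" and y: "y \<in> carrier H"
  shows "\<Delta>H (x \<otimes>\<^bsub>H\<^esub> y) = \<Delta>H x \<otimes>\<^bsub>HH\<^esub> \<Delta>H y"
proof -
  note Hm = total_module and HHm = square_module and mH = total_mult_bilinear
  note mHH = tensor_mult_bilinear[OF Hm Hm mH mH]
  note l = bilinear_maps_postcomp[OF total_comult_linear mH]
    and r = bilinear_maps_precomp[OF mHH total_comult_linear total_comult_linear]
  show ?thesis
  proof (rule total_linear_eqI[OF HHm bilinear_maps_left[OF l y] bilinear_maps_left[OF r y] _ x])
    fix i j a assume ij: "i \<in> J" "j \<in> J" and a: "a \<in> carrier (B i j)"
    note \<iota>a = incl_closed[OF ij a]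
    show "\<Delta>H (\<iota> i j a \<otimes>\<^bsub>H\<^esub> y) = \<Delta>H (\<iota> i j a) \<otimes>\<^bsub>HH\<^esub> \<Delta>H y"
    proof (rule total_linear_eqI[OF HHm bilinear_maps_right[OF l \<iota>a] bilinear_maps_right[OF r \<iota>a] _ y])
      fix i' j' b assume ij': "i' \<in> J" "j' \<in> J" and b: "b \<in> carrier (B i' j')"
      note pa = linear_maps_closed[OF comult_part_linear[OF ij] a]
        and pb = linear_maps_closed[OF comult_part_linear[OF ij'] b]
      have row: "(\<Oplus>\<^bsub>HH\<^esub>l'\<in>J. \<iota>\<iota> i j l (comult i j l a) \<otimes>\<^bsub>HH\<^esub> \<iota>\<iota> i' j' l' (comult i' j' l' b))
          = (if i = i' \<and> j = j' then \<iota>\<iota> i j l (comult i j l (a \<otimes>\<^bsub>B i j\<^esub> b)) else \<zero>\<^bsub>HH\<^esub>)" if l: "l \<in> J" for l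
      proof (cases "i = i' \<and> j = j'")
        case True
        then have ab: "a \<otimes>\<^bsub>B i j\<^esub> b \<in> carrier (B i j)" using block_mult_closed[OF ij a] b by simp
        show ?thesis
          using True comult_part_mult[OF ij l ij' l a b] comult_part_mult[OF ij l ij' _ a b]
            linear_maps_closed[OF comult_part_linear[OF ij l] ab] l
          by (subst HH.finsum_single[where a = l]) auto
      next
        case False
        show ?thesis
          unfolding if_not_P[OF False]
          by (rule HH.add.finprod_one_eqI) (use False comult_part_mult[OF ij l ij' _ a b] in auto)
      qed
      have "\<Delta>H (\<iota> i j a) \<otimes>\<^bsub>HH\<^esub> \<Delta>H (\<iota> i' j' b)
          = (\<Oplus>\<^bsub>HH\<^esub>l\<in>J. \<Oplus>\<^bsub>HH\<^esub>l'\<in>J.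
              \<iota>\<iota> i j l (comult i j l a) \<otimes>\<^bsub>HH\<^esub> \<iota>\<iota> i' j' l' (comult i' j' l' b))"
        unfolding total_comult_incl[OF ij a] total_comult_incl[OF ij' b]
        by (rule bilinear_maps_finsum[OF HHm HHm HHm mHH pa pb])
      also have "\<dots> = \<Delta>H (\<iota> i j a \<otimes>\<^bsub>H\<^esub> \<iota> i' j' b)"
      proof (cases "i = i' \<and> j = j'")
        case True
        then have ab: "a \<otimes>\<^bsub>B i j\<^esub> b \<in> carrier (B i j)" using block_mult_closed[OF ij a] b by simp
        have "(\<Oplus>\<^bsub>HH\<^esub>l\<in>J. \<Oplus>\<^bsub>HH\<^esub>l'\<in>J.
              \<iota>\<iota> i j l (comult i j l a) \<otimes>\<^bsub>HH\<^esub> \<iota>\<iota> i' j' l' (comult i' j' l' b))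
            = (\<Oplus>\<^bsub>HH\<^esub>l\<in>J. \<iota>\<iota> i j l (comult i j l (a \<otimes>\<^bsub>B i j\<^esub> b)))"
          using row True linear_maps_closed[OF comult_part_linear[OF ij] ab]
          by (intro HH.finsum_cong'[OF HOL.refl] funcsetI) auto
        also have "\<dots> = \<Delta>H (\<iota> i j (a \<otimes>\<^bsub>B i j\<^esub> b))"
          by (rule total_comult_incl[OF ij ab, symmetric])
        finally show ?thesis using True incl_mult_incl[OF ij ij' a b] by simp
      next
        case False
        have "(\<Oplus>\<^bsub>HH\<^esub>l\<in>J. \<Oplus>\<^bsub>HH\<^esub>l'\<in>J.
              \<iota>\<iota> i j l (comult i j l a) \<otimes>\<^bsub>HH\<^esub> \<iota>\<iota> i' j' l' (comult i' j' l' b)) = \<zero>\<^bsub>HH\<^esub>"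
          by (rule HH.add.finprod_one_eqI) (simp only: row if_not_P[OF False])
        then show ?thesis
          unfolding incl_mult_incl[OF ij ij' a b] if_not_P[OF False]
            linear_maps_zero[OF Hm HHm total_comult_linear] .
      qed
      finally show "\<Delta>H (\<iota> i j a \<otimes>\<^bsub>H\<^esub> \<iota> i' j' b) = \<Delta>H (\<iota> i j a) \<otimes>\<^bsub>HH\<^esub> \<Delta>H (\<iota> i' j' b)" ..
    qed
  qed
qed

lemma scalar_mult_bilinear:
  "mult K \<in> bilinear_maps K (scalar_algebra K) (scalar_algebra K) (scalar_algebra K)"
  using smult_bilinear[OF scalar_module] by (simp add: scalar_algebra_def)

lemma total_counit_mult_incl:
  assumes "i \<in> J" "j \<in> J" "x \<in> carrier H" "b \<in> carrier (B i j)"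
  shows "\<epsilon>H (x \<otimes>\<^bsub>H\<^esub> \<iota> i j b) = (if i = j then \<epsilon> (X i) (x (i, i)) \<otimes> \<epsilon> (X i) b else \<zero>)"
    and "\<epsilon>H (\<iota> i j b \<otimes>\<^bsub>H\<^esub> x) = (if i = j then \<epsilon> (X i) b \<otimes> \<epsilon> (X i) (x (i, i)) else \<zero>)"
proof -
  note c = component_closed[OF assms(3,1,2)]
  show "\<epsilon>H (x \<otimes>\<^bsub>H\<^esub> \<iota> i j b) = (if i = j then \<epsilon> (X i) (x (i, i)) \<otimes> \<epsilon> (X i) b else \<zero>)"
    using total_counit_incl[OF assms(1,2) block_mult_closed[OF assms(1,2) c assms(4)]]
      block_counit_mult[OF assms(1), of "x (i, i)" b] c assms(4)
    by (auto simp: mult_incl_right[OF assms])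
  show "\<epsilon>H (\<iota> i j b \<otimes>\<^bsub>H\<^esub> x) = (if i = j then \<epsilon> (X i) b \<otimes> \<epsilon> (X i) (x (i, i)) else \<zero>)"
    using total_counit_incl[OF assms(1,2) block_mult_closed[OF assms(1,2) assms(4) c]]
      block_counit_mult[OF assms(1), of b "x (i, i)"] c assms(4)
    by (auto simp: mult_incl_left[OF assms])
qed

text \<open>Only \<open>y\<close> is decomposed: a product with an element of \<open>C(i,j)\<close> already selects the \<open>(i,j)\<close> components of
\<open>x\<close> and \<open>z\<close>. On \<open>C(i,i)\<close> the counit is an algebra map to a commutative field, which is why the two
ways of distributing \<open>y\<^sub>(\<^sub>1\<^sub>)\<close> and \<open>y\<^sub>(\<^sub>2\<^sub>)\<close> give the same value.\<close>

lemma total_counit_mult: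
  assumes x: "x \<in> carrier H" and y: "y \<in> carrier H" and z: "z \<in> carrier H"
  shows total_counit_mult1: "\<epsilon>H (x \<otimes>\<^bsub>H\<^esub> y \<otimes>\<^bsub>H\<^esub> z)
      = tensor_lift (scalar_algebra K) (\<lambda>y1 y2. \<epsilon>H (x \<otimes>\<^bsub>H\<^esub> y1) \<otimes> \<epsilon>H (y2 \<otimes>\<^bsub>H\<^esub> z)) (\<Delta>H y)" (is ?one)
    and total_counit_mult2: "\<epsilon>H (x \<otimes>\<^bsub>H\<^esub> y \<otimes>\<^bsub>H\<^esub> z)
      = tensor_lift (scalar_algebra K) (\<lambda>y1 y2. \<epsilon>H (x \<otimes>\<^bsub>H\<^esub> y2) \<otimes> \<epsilon>H (y1 \<otimes>\<^bsub>H\<^esub> z)) (\<Delta>H y)" (is ?two)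
proof -
  let ?k = "scalar_algebra K"
  note Hm = total_module and km = scalar_module
  interpret k: module K ?k by (rule km)
  have kc: "carrier ?k = carrier K" and k0: "\<zero>\<^bsub>?k\<^esub> = \<zero>" and kz: "smult ?k = mult K"
    by (simp_all add: scalar_algebra_def)
  note xl = linear_maps_comp[OF total_counit_linear bilinear_maps_right[OF total_mult_bilinear x]]
    and zl = linear_maps_comp[OF total_counit_linear bilinear_maps_left[OF total_mult_bilinear z]]
  note b1 = bilinear_maps_precomp[OF scalar_mult_bilinear xl zl]
    and b2 = bilinear_maps_flip[OF bilinear_maps_precomp[OF scalar_mult_bilinear xl zl]]
  have l: "(\<lambda>y. \<epsilon>H (x \<otimes>\<^bsub>H\<^esub> y \<otimes>\<^bsub>H\<^esub> z)) \<in> linear_maps K H ?k"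
    by (rule linear_maps_comp[OF zl bilinear_maps_right[OF total_mult_bilinear x]])
  \<comment> \<open>The common value of both sides on the summands.\<close>
  have triple: "\<epsilon>H (x \<otimes>\<^bsub>H\<^esub> \<iota> i j b \<otimes>\<^bsub>H\<^esub> z)
      = (if i = j then \<epsilon> (X i) (x (i, i)) \<otimes> \<epsilon> (X i) (z (i, i)) \<otimes> \<epsilon> (X i) b else \<zero>)"
    if ij: "i \<in> J" "j \<in> J" and b: "b \<in> carrier (B i j)" for i j b
  proof (cases "i = j")
    case True
    note xc = component_closed[OF x ij] and zc = component_closed[OF z ij]
    have "\<epsilon>H (x \<otimes>\<^bsub>H\<^esub> \<iota> i j b \<otimes>\<^bsub>H\<^esub> z)
        = \<epsilon> (X i) (x (i, i) \<otimes>\<^bsub>B i i\<^esub> b) \<otimes> \<epsilon> (X i) (z (i, i))"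
      using True total_counit_mult_incl(2)[OF ij z block_mult_closed[OF ij xc b]]
      unfolding mult_incl_right[OF ij x b] by simp
    then show ?thesis
      using True xc zc b ij block_counit_closed[OF ij(1)] block_counit_mult[OF ij(1)]
      by (simp add: m_ac)
  next
    case False
    then show ?thesis
      using total_counit_mult_incl(2)[OF ij z block_mult_closed[OF ij component_closed[OF x ij] b]]
      unfolding mult_incl_right[OF ij x b] by simp
  qed
  have scaled: "(\<lambda>u. \<epsilon> (X i) (x (i, i)) \<otimes> \<epsilon> (X i) (z (i, i)) \<otimes> \<epsilon> (X i) u) \<in> linear_maps K (B i i) ?k"
    if i: "i \<in> J" for i
    using linear_maps_comp[OF smult_linear[OF km] block_counit_linear[OF i],
        of "\<epsilon> (X i) (x (i, i)) \<otimes> \<epsilon> (X i) (z (i, i))"]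
      block_counit_closed[OF i] component_closed[OF x i i] component_closed[OF z i i]
    by (simp add: kz)
  show ?one
  proof (rule total_linear_eqI[OF km l _ _ y])
    show "(\<lambda>y. tensor_lift ?k (\<lambda>y1 y2. \<epsilon>H (x \<otimes>\<^bsub>H\<^esub> y1) \<otimes> \<epsilon>H (y2 \<otimes>\<^bsub>H\<^esub> z)) (\<Delta>H y)) \<in> linear_maps K H ?k"
      by (rule linear_maps_comp[OF tensor_universal(1)[OF Hm Hm km b1] total_comult_linear])
    fix i j b assume ij: "i \<in> J" "j \<in> J" and b: "b \<in> carrier (B i j)"
    have part: "tensor_lift ?k (\<lambda>u v. \<epsilon>H (x \<otimes>\<^bsub>H\<^esub> \<iota> i l u) \<otimes> \<epsilon>H (\<iota> l j v \<otimes>\<^bsub>H\<^esub> z)) (comult i j l b)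
        = (if l = i then \<epsilon>H (x \<otimes>\<^bsub>H\<^esub> \<iota> i j b \<otimes>\<^bsub>H\<^esub> z) else \<zero>\<^bsub>?k\<^esub>)" if l: "l \<in> J" for l
    proof -
      note m = block_module[OF ij(1) l] block_module[OF l ij(2)] and c = block_comult_closed[OF ij l b]
      show ?thesis
      proof (cases "i = j \<and> l = i")
        case True
        then have "tensor_lift ?k (\<lambda>u v. \<epsilon>H (x \<otimes>\<^bsub>H\<^esub> \<iota> i l u) \<otimes> \<epsilon>H (\<iota> l j v \<otimes>\<^bsub>H\<^esub> z)) (comult i j l b)
           = tensor_lift ?k (\<lambda>u v. \<epsilon> (X i) u \<odot>\<^bsub>?k\<^esub>
                (\<epsilon> (X i) (x (i, i)) \<otimes> \<epsilon> (X i) (z (i, i)) \<otimes> \<epsilon> (X i) v)) (comult i j l b)"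
          using ij x z component_closed[OF x ij(1,1)] component_closed[OF z ij(1,1)]
          by (intro tensor_lift_cong[OF m c])
            (auto simp: total_counit_mult_incl kz m_ac block_counit_closed)
        then show ?thesis
          using lift_block_counit_left[OF ij(1,1) _ km scaled[OF ij(1)], of b] True b triple[OF ij b] by simp
      next
        case False
        have "tensor_lift ?k (\<lambda>u v. \<epsilon>H (x \<otimes>\<^bsub>H\<^esub> \<iota> i l u) \<otimes> \<epsilon>H (\<iota> l j v \<otimes>\<^bsub>H\<^esub> z)) (comult i j l b) = \<zero>\<^bsub>?k\<^esub>"
          using False ij l x z component_closed[OF x ij(1,1)] component_closed[OF z l l]
          by (intro tensor_lift_zero[OF m km c])
            (auto simp: total_counit_mult_incl k0 block_counit_closed)
        then show ?thesis using False triple[OF ij b] k0 by auto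
      qed
    qed
    have "\<epsilon>H (x \<otimes>\<^bsub>H\<^esub> \<iota> i j b \<otimes>\<^bsub>H\<^esub> z) \<in> carrier ?k"
      by (rule linear_maps_closed[OF l incl_closed[OF ij b]])
    then show "\<epsilon>H (x \<otimes>\<^bsub>H\<^esub> \<iota> i j b \<otimes>\<^bsub>H\<^esub> z)
        = tensor_lift ?k (\<lambda>y1 y2. \<epsilon>H (x \<otimes>\<^bsub>H\<^esub> y1) \<otimes> \<epsilon>H (y2 \<otimes>\<^bsub>H\<^esub> z)) (\<Delta>H (\<iota> i j b))"
      unfolding lift_comult_incl[OF km b1 ij b]
      using ij(1) by (subst k.finsum_single[where a = i]) (auto simp: part)
  qed
  show ?two
  proof (rule total_linear_eqI[OF km l _ _ y])
    show "(\<lambda>y. tensor_lift ?k (\<lambda>y1 y2. \<epsilon>H (x \<otimes>\<^bsub>H\<^esub> y2) \<otimes> \<epsilon>H (y1 \<otimes>\<^bsub>H\<^esub> z)) (\<Delta>H y)) \<in> linear_maps K H ?k"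
      by (rule linear_maps_comp[OF tensor_universal(1)[OF Hm Hm km b2] total_comult_linear])
    fix i j b assume ij: "i \<in> J" "j \<in> J" and b: "b \<in> carrier (B i j)"
    have part: "tensor_lift ?k (\<lambda>u v. \<epsilon>H (x \<otimes>\<^bsub>H\<^esub> \<iota> l j v) \<otimes> \<epsilon>H (\<iota> i l u \<otimes>\<^bsub>H\<^esub> z)) (comult i j l b)
        = (if l = i then \<epsilon>H (x \<otimes>\<^bsub>H\<^esub> \<iota> i j b \<otimes>\<^bsub>H\<^esub> z) else \<zero>\<^bsub>?k\<^esub>)" if l: "l \<in> J" for l
    proof -
      note m = block_module[OF ij(1) l] block_module[OF l ij(2)] and c = block_comult_closed[OF ij l b]
      show ?thesis
      proof (cases "i = j \<and> l = i")
        case True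
        then have "tensor_lift ?k (\<lambda>u v. \<epsilon>H (x \<otimes>\<^bsub>H\<^esub> \<iota> l j v) \<otimes> \<epsilon>H (\<iota> i l u \<otimes>\<^bsub>H\<^esub> z)) (comult i j l b)
           = tensor_lift ?k (\<lambda>u v. \<epsilon> (X i) u \<odot>\<^bsub>?k\<^esub>
                (\<epsilon> (X i) (x (i, i)) \<otimes> \<epsilon> (X i) (z (i, i)) \<otimes> \<epsilon> (X i) v)) (comult i j l b)"
          using ij x z component_closed[OF x ij(1,1)] component_closed[OF z ij(1,1)]
          by (intro tensor_lift_cong[OF m c])
            (auto simp: total_counit_mult_incl kz m_ac block_counit_closed)
        then show ?thesis
          using lift_block_counit_left[OF ij(1,1) _ km scaled[OF ij(1)], of b] True b triple[OF ij b] by simp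
      next
        case False
        have "tensor_lift ?k (\<lambda>u v. \<epsilon>H (x \<otimes>\<^bsub>H\<^esub> \<iota> l j v) \<otimes> \<epsilon>H (\<iota> i l u \<otimes>\<^bsub>H\<^esub> z)) (comult i j l b) = \<zero>\<^bsub>?k\<^esub>"
          using False ij l x z component_closed[OF z ij(1,1)] component_closed[OF x l l]
          by (intro tensor_lift_zero[OF m km c])
            (auto simp: total_counit_mult_incl k0 block_counit_closed)
        then show ?thesis using False triple[OF ij b] k0 by auto
      qed
    qed
    have "\<epsilon>H (x \<otimes>\<^bsub>H\<^esub> \<iota> i j b \<otimes>\<^bsub>H\<^esub> z) \<in> carrier ?k"
      by (rule linear_maps_closed[OF l incl_closed[OF ij b]])
    then show "\<epsilon>H (x \<otimes>\<^bsub>H\<^esub> \<iota> i j b \<otimes>\<^bsub>H\<^esub> z)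
        = tensor_lift ?k (\<lambda>y1 y2. \<epsilon>H (x \<otimes>\<^bsub>H\<^esub> y2) \<otimes> \<epsilon>H (y1 \<otimes>\<^bsub>H\<^esub> z)) (\<Delta>H (\<iota> i j b))"
      unfolding lift_comult_incl[OF km b2 ij b]
      using ij(1) by (subst k.finsum_single[where a = i]) (auto simp: part)
  qed
qed

section \<open>The comultiplication of the unit\<close>

lemma total_one_component: "\<lbrakk>i \<in> J; j \<in> J\<rbrakk> \<Longrightarrow> \<one>\<^bsub>H\<^esub> (i, j) = \<one>\<^bsub>B i j\<^esub>"
  by (simp add: cog_algebra_def direct_sum_component(4) index_mem cog_block_pair)

lemma comult_part_one:
  assumes "i \<in> J" "j \<in> J" "l \<in> J"
  shows "\<iota>\<iota> i j l (comult i j l \<one>\<^bsub>B i j\<^esub>) = pure_tensor K H H (e i l) (e l j)"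
proof -
  have "comult i j l \<one>\<^bsub>B i j\<^esub> = pure_tensor K (B i l) (B l j) \<one>\<^bsub>B i l\<^esub> \<one>\<^bsub>B l j\<^esub>"
    using ring_hom_one[OF block_comult_hom[OF assms]] by (simp add: tensor_def)
  then show ?thesis
    using tensor_map_pure[OF block_module[OF assms(1,3)] block_module[OF assms(3,2)] total_module total_module
        incl_linear[OF assms(1,3)] incl_linear[OF assms(3,2)]
        block_one_closed[OF assms(1,3)] block_one_closed[OF assms(3,2)]]
    by simp
qed

lemma pure_e_closed:
  "\<lbrakk>i \<in> J; j \<in> J; l \<in> J\<rbrakk> \<Longrightarrow> pure_tensor K H H (e i l) (e l j) \<in> carrier HH"
  by (intro pure_tensor_closed e_closed)

lemma total_comult_e:
  assumes "i \<in> J" "j \<in> J"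
  shows "\<Delta>H (e i j) = (\<Oplus>\<^bsub>HH\<^esub>l\<in>J. pure_tensor K H H (e i l) (e l j))"
  unfolding total_comult_incl[OF assms block_one_closed[OF assms]]
  using comult_part_one[OF assms] pure_e_closed[OF assms]
  by (intro HH.finsum_cong'[OF HOL.refl] funcsetI)

text \<open>Since \<open>\<Delta>\<^sub>i\<^sub>j\<^sup>l\<close> preserves units, \<open>\<Delta>(1)\<close> is the sum of all \<open>e\<^sub>i\<^sub>l \<otimes> e\<^sub>l\<^sub>j\<close>. Stating this under a
linear map avoids threefold sums in \<open>H \<otimes> H\<close> later.\<close>

lemma linear_total_comult_one:
  assumes P: "module K P" and f: "f \<in> linear_maps K HH P"
  shows "f (\<Delta>H \<one>\<^bsub>H\<^esub>) = (\<Oplus>\<^bsub>P\<^esub>i\<in>J. \<Oplus>\<^bsub>P\<^esub>j\<in>J. \<Oplus>\<^bsub>P\<^esub>l\<in>J. f (pure_tensor K H H (e i l) (e l j)))"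
proof -
  interpret P: module K P by (rule P)
  let ?p = "\<lambda>i j l. pure_tensor K H H (e i l) (e l j)"
  have p: "?p i j l \<in> carrier HH" if "i \<in> J" "j \<in> J" "l \<in> J" for i j l
    using pure_e_closed[OF that] .
  have s1: "(\<Oplus>\<^bsub>HH\<^esub>l\<in>J. ?p i j l) \<in> carrier HH" if "i \<in> J" "j \<in> J" for i j
    using p[OF that] by (intro HH.finsum_closed funcsetI)
  have s2: "(\<Oplus>\<^bsub>HH\<^esub>j\<in>J. \<Oplus>\<^bsub>HH\<^esub>l\<in>J. ?p i j l) \<in> carrier HH" if "i \<in> J" for i
    by (rule HH.finsum_closed, rule funcsetI, rule s1[OF that])
  have fp: "f (?p i j l) \<in> carrier P" if "i \<in> J" "j \<in> J" "l \<in> J" for i j l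
    using linear_maps_closed[OF f p[OF that]] .
  have t1: "(\<Oplus>\<^bsub>P\<^esub>l\<in>J. f (?p i j l)) \<in> carrier P" if "i \<in> J" "j \<in> J" for i j
    using fp[OF that] by (intro P.finsum_closed funcsetI)
  have t2: "(\<Oplus>\<^bsub>P\<^esub>j\<in>J. \<Oplus>\<^bsub>P\<^esub>l\<in>J. f (?p i j l)) \<in> carrier P" if "i \<in> J" for i
    by (rule P.finsum_closed, rule funcsetI, rule t1[OF that])
  have part: "\<iota>\<iota> i j l (comult i j l (\<one>\<^bsub>H\<^esub> (i, j))) = ?p i j l" if "i \<in> J" "j \<in> J" "l \<in> J" for i j l
    using comult_part_one[OF that] that by (simp add: total_one_component)
  have expand: "\<Delta>H \<one>\<^bsub>H\<^esub> = (\<Oplus>\<^bsub>HH\<^esub>i\<in>J. \<Oplus>\<^bsub>HH\<^esub>j\<in>J. \<Oplus>\<^bsub>HH\<^esub>l\<in>J. ?p i j l)"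
    unfolding cog_comult_def Let_def J_def[symmetric]
    by (intro HH.finsum_cong'[OF HOL.refl] part p funcsetI HH.finsum_closed)
  have "f (\<Delta>H \<one>\<^bsub>H\<^esub>) = (\<Oplus>\<^bsub>P\<^esub>i\<in>J. f (\<Oplus>\<^bsub>HH\<^esub>j\<in>J. \<Oplus>\<^bsub>HH\<^esub>l\<in>J. ?p i j l))"
    unfolding expand by (rule linear_maps_finsum[OF square_module P f s2])
  also have "\<dots> = (\<Oplus>\<^bsub>P\<^esub>i\<in>J. \<Oplus>\<^bsub>P\<^esub>j\<in>J. f (\<Oplus>\<^bsub>HH\<^esub>l\<in>J. ?p i j l))"
  proof (rule P.finsum_cong'[OF HOL.refl])
    fix i assume i: "i \<in> J"
    show "f (\<Oplus>\<^bsub>HH\<^esub>j\<in>J. \<Oplus>\<^bsub>HH\<^esub>l\<in>J. ?p i j l) = (\<Oplus>\<^bsub>P\<^esub>j\<in>J. f (\<Oplus>\<^bsub>HH\<^esub>l\<in>J. ?p i j l))"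
      by (rule linear_maps_finsum[OF square_module P f s1[OF i]])
  qed (rule funcsetI, rule P.finsum_closed, rule funcsetI, rule linear_maps_closed[OF f s1])
  also have "\<dots> = (\<Oplus>\<^bsub>P\<^esub>i\<in>J. \<Oplus>\<^bsub>P\<^esub>j\<in>J. \<Oplus>\<^bsub>P\<^esub>l\<in>J. f (?p i j l))"
  proof (rule P.finsum_cong'[OF HOL.refl], rule_tac [2] P.finsum_cong'[OF HOL.refl])
    fix i j assume ij: "i \<in> J" "j \<in> J"
    show "f (\<Oplus>\<^bsub>HH\<^esub>l\<in>J. ?p i j l) = (\<Oplus>\<^bsub>P\<^esub>l\<in>J. f (?p i j l))"
      by (rule linear_maps_finsum[OF square_module P f p[OF ij]])
  qed (rule funcsetI, rule t2 t1, assumption+)+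
  finally show ?thesis .
qed

abbreviation e3 where
  "e3 x y z \<equiv> pure_tensor K H HH x (pure_tensor K H H y z)"

text \<open>Each \<open>\<Delta>(e\<^sub>i\<^sub>l)\<close> is the sum over \<open>k\<close> of \<open>e\<^sub>i\<^sub>k \<otimes> e\<^sub>k\<^sub>l\<close>. The order of summation is the one in which the
products of \<open>\<Delta>(1) \<otimes> 1\<close> and \<open>1 \<otimes> \<Delta>(1)\<close> produce the terms.\<close>

lemma total_comult_one_split:
  "tensor_assoc K H H H (tensor_map K HH H \<Delta>H (\<lambda>x. x) (\<Delta>H \<one>\<^bsub>H\<^esub>))
    = (\<Oplus>\<^bsub>tensor K H HH\<^esub>i\<in>J. \<Oplus>\<^bsub>tensor K H HH\<^esub>j\<in>J. \<Oplus>\<^bsub>tensor K H HH\<^esub>l\<in>J. \<Oplus>\<^bsub>tensor K H HH\<^esub>q\<in>J.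
        e3 (e i l) (e l j) (e j q))"
proof -
  note Hm = total_module and HHm = square_module
  let ?T = "tensor K H HH" and ?D = "tensor_map K HH H \<Delta>H (\<lambda>x. x)"
  have Tm: "module K ?T" by (rule module_tensor[OF Hm HHm])
  interpret T: module K ?T by (rule Tm)
  have D: "?D \<in> linear_maps K HH (tensor K HH H)"
    by (rule tensor_map_linear[OF Hm Hm HHm Hm total_comult_linear linear_maps_id])
  have assoc: "tensor_assoc K H H H \<in> linear_maps K (tensor K HH H) ?T"
    by (rule tensor_assoc_linear[OF Hm Hm Hm])
  have cl: "e3 (e i k) (e k l) (e l j) \<in> carrier ?T" if "i \<in> J" "j \<in> J" "k \<in> J" "l \<in> J" for i j k l
    using that by (intro pure_tensor_closed e_closed)
  have summand: "tensor_assoc K H H H (?D (pure_tensor K H H (e i l) (e l j)))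
      = (\<Oplus>\<^bsub>?T\<^esub>k\<in>J. e3 (e i k) (e k l) (e l j))" if i: "i \<in> J" and j: "j \<in> J" and l: "l \<in> J" for i j l
  proof -
    note elj = e_closed[OF l j]
    have lin: "(\<lambda>s. tensor_assoc K H H H (pure_tensor K HH H s (e l j))) \<in> linear_maps K HH ?T"
      by (rule linear_maps_comp[OF assoc bilinear_maps_left[OF pure_tensor_bilinear[OF HHm Hm] elj]])
    have "?D (pure_tensor K H H (e i l) (e l j)) = pure_tensor K HH H (\<Delta>H (e i l)) (e l j)"
      by (rule tensor_map_pure[OF Hm Hm HHm Hm total_comult_linear linear_maps_id e_closed[OF i l] elj])
    then have "tensor_assoc K H H H (?D (pure_tensor K H H (e i l) (e l j)))
        = tensor_assoc K H H H (pure_tensor K HH H (\<Oplus>\<^bsub>HH\<^esub>k\<in>J. pure_tensor K H H (e i k) (e k l)) (e l j))"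
      by (simp only: total_comult_e[OF i l])
    also have "\<dots> = (\<Oplus>\<^bsub>?T\<^esub>k\<in>J. tensor_assoc K H H H (pure_tensor K HH H (pure_tensor K H H (e i k) (e k l)) (e l j)))"
      by (rule linear_maps_finsum[OF HHm Tm lin pure_e_closed[OF i l]])
    also have "\<dots> = (\<Oplus>\<^bsub>?T\<^esub>k\<in>J. e3 (e i k) (e k l) (e l j))"
    proof (rule T.finsum_cong'[OF HOL.refl])
      fix k assume k: "k \<in> J"
      show "tensor_assoc K H H H (pure_tensor K HH H (pure_tensor K H H (e i k) (e k l)) (e l j))
          = e3 (e i k) (e k l) (e l j)"
        by (rule tensor_assoc_pure[OF Hm Hm Hm e_closed[OF i k] e_closed[OF k l] elj])
    qed (use cl i j l in auto)
    finally show ?thesis .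
  qed
  have "tensor_assoc K H H H (?D (\<Delta>H \<one>\<^bsub>H\<^esub>))
      = (\<Oplus>\<^bsub>?T\<^esub>i\<in>J. \<Oplus>\<^bsub>?T\<^esub>j\<in>J. \<Oplus>\<^bsub>?T\<^esub>l\<in>J. tensor_assoc K H H H (?D (pure_tensor K H H (e i l) (e l j))))"
    by (rule linear_total_comult_one[OF Tm linear_maps_comp[OF assoc D]])
  also have "\<dots> = (\<Oplus>\<^bsub>?T\<^esub>i\<in>J. \<Oplus>\<^bsub>?T\<^esub>j\<in>J. \<Oplus>\<^bsub>?T\<^esub>l\<in>J. \<Oplus>\<^bsub>?T\<^esub>k\<in>J. e3 (e i k) (e k l) (e l j))"
    using cl by (intro T.finsum_cong'[OF HOL.refl] summand funcsetI T.finsum_closed)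
  also have "\<dots> = (\<Oplus>\<^bsub>?T\<^esub>i\<in>J. \<Oplus>\<^bsub>?T\<^esub>l\<in>J. \<Oplus>\<^bsub>?T\<^esub>j\<in>J. \<Oplus>\<^bsub>?T\<^esub>k\<in>J. e3 (e i k) (e k l) (e l j))"
  proof (rule T.finsum_cong'[OF HOL.refl])
    fix i assume i: "i \<in> J"
    show "(\<Oplus>\<^bsub>?T\<^esub>j\<in>J. \<Oplus>\<^bsub>?T\<^esub>l\<in>J. \<Oplus>\<^bsub>?T\<^esub>k\<in>J. e3 (e i k) (e k l) (e l j))
        = (\<Oplus>\<^bsub>?T\<^esub>l\<in>J. \<Oplus>\<^bsub>?T\<^esub>j\<in>J. \<Oplus>\<^bsub>?T\<^esub>k\<in>J. e3 (e i k) (e k l) (e l j))"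
      by (rule T.finsum_swap[OF finite_J finite_J]) (intro T.finsum_closed funcsetI cl i)
  qed (intro T.finsum_closed funcsetI cl)
  \<comment> \<open>After this second interchange, renaming \<open>(l, k, j)\<close> to \<open>(j, l, q)\<close> gives the order of the claim.\<close>
  also have "\<dots> = (\<Oplus>\<^bsub>?T\<^esub>i\<in>J. \<Oplus>\<^bsub>?T\<^esub>l\<in>J. \<Oplus>\<^bsub>?T\<^esub>k\<in>J. \<Oplus>\<^bsub>?T\<^esub>j\<in>J. e3 (e i k) (e k l) (e l j))"
  proof (rule T.finsum_cong'[OF HOL.refl], rule_tac [2] T.finsum_cong'[OF HOL.refl])
    fix i l assume il: "i \<in> J" "l \<in> J"
    show "(\<Oplus>\<^bsub>?T\<^esub>j\<in>J. \<Oplus>\<^bsub>?T\<^esub>k\<in>J. e3 (e i k) (e k l) (e l j))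
        = (\<Oplus>\<^bsub>?T\<^esub>k\<in>J. \<Oplus>\<^bsub>?T\<^esub>j\<in>J. e3 (e i k) (e k l) (e l j))"
      by (rule T.finsum_swap[OF finite_J finite_J]) (intro cl il)
  qed (intro T.finsum_closed funcsetI cl, assumption+)+
  finally show ?thesis .
qed

text \<open>The map \<open>\<mu>\<close> stands for the multiplication of \<open>H \<otimes> (H \<otimes> H)\<close> and for its opposite, so that both identities
for \<open>\<Delta>(1)\<close> come from the same calculation. On the terms the two agree because the \<open>e\<^sub>i\<^sub>j\<close> commute.\<close>

lemma total_comult_one_product:
  assumes \<mu>: "\<mu> \<in> bilinear_maps K (tensor K H HH) (tensor K H HH) (tensor K H HH)"
    and terms: "\<And>i l j p r q. \<lbrakk>i \<in> J; l \<in> J; j \<in> J; p \<in> J; r \<in> J; q \<in> J\<rbrakk>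
      \<Longrightarrow> \<mu> (e3 (e i l) (e l j) \<one>\<^bsub>H\<^esub>) (e3 \<one>\<^bsub>H\<^esub> (e p r) (e r q))
        = (if l = p \<and> j = r then e3 (e i l) (e l j) (e j q) else \<zero>\<^bsub>tensor K H HH\<^esub>)"
  shows "\<mu> (tensor_assoc K H H H (pure_tensor K HH H (\<Delta>H \<one>\<^bsub>H\<^esub>) \<one>\<^bsub>H\<^esub>))
      (pure_tensor K H HH \<one>\<^bsub>H\<^esub> (\<Delta>H \<one>\<^bsub>H\<^esub>))
    = tensor_assoc K H H H (tensor_map K HH H \<Delta>H (\<lambda>x. x) (\<Delta>H \<one>\<^bsub>H\<^esub>))"
proof -
  note Hm = total_module and HHm = square_module and one = H.A.one_closed
  let ?T = "tensor K H HH"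
  have Tm: "module K ?T" by (rule module_tensor[OF Hm HHm])
  interpret T: module K ?T by (rule Tm)
  have assoc: "tensor_assoc K H H H \<in> linear_maps K (tensor K HH H) ?T"
    by (rule tensor_assoc_linear[OF Hm Hm Hm])
  have l: "(\<lambda>s. tensor_assoc K H H H (pure_tensor K HH H s \<one>\<^bsub>H\<^esub>)) \<in> linear_maps K HH ?T"
    by (rule linear_maps_comp[OF assoc bilinear_maps_left[OF pure_tensor_bilinear[OF HHm Hm] one]])
  have r: "pure_tensor K H HH \<one>\<^bsub>H\<^esub> \<in> linear_maps K HH ?T"
    by (rule bilinear_maps_right[OF pure_tensor_bilinear[OF Hm HHm] one])
  note b = bilinear_maps_precomp[OF \<mu> l r] and \<Delta>1 = total_comult_closed[OF one]
  have cl: "e3 (e i l) (e l j) (e j q) \<in> carrier ?T" if "i \<in> J" "j \<in> J" "l \<in> J" "q \<in> J" for i j l q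
    using that by (intro pure_tensor_closed e_closed)
  have inner: "\<mu> (tensor_assoc K H H H (pure_tensor K HH H (pure_tensor K H H (e i l) (e l j)) \<one>\<^bsub>H\<^esub>))
      (pure_tensor K H HH \<one>\<^bsub>H\<^esub> (\<Delta>H \<one>\<^bsub>H\<^esub>)) = (\<Oplus>\<^bsub>?T\<^esub>q\<in>J. e3 (e i l) (e l j) (e j q))"
    if ijl: "i \<in> J" "j \<in> J" "l \<in> J" for i j l
  proof -
    have as: "tensor_assoc K H H H (pure_tensor K HH H (pure_tensor K H H (e i l) (e l j)) \<one>\<^bsub>H\<^esub>)
        = e3 (e i l) (e l j) \<one>\<^bsub>H\<^esub>"
      by (rule tensor_assoc_pure[OF Hm Hm Hm e_closed[OF ijl(1,3)] e_closed[OF ijl(3,2)] one])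
    have col: "(\<Oplus>\<^bsub>?T\<^esub>r\<in>J. \<mu> (e3 (e i l) (e l j) \<one>\<^bsub>H\<^esub>) (e3 \<one>\<^bsub>H\<^esub> (e p r) (e r q)))
        = (if p = l then e3 (e i l) (e l j) (e j q) else \<zero>\<^bsub>?T\<^esub>)" if pq: "p \<in> J" "q \<in> J" for p q
    proof (cases "p = l")
      case True
      have "(\<Oplus>\<^bsub>?T\<^esub>r\<in>J. \<mu> (e3 (e i l) (e l j) \<one>\<^bsub>H\<^esub>) (e3 \<one>\<^bsub>H\<^esub> (e p r) (e r q)))
          = \<mu> (e3 (e i l) (e l j) \<one>\<^bsub>H\<^esub>) (e3 \<one>\<^bsub>H\<^esub> (e p j) (e j q))"
        using True ijl pq cl by (intro T.finsum_single finite_J) (simp_all add: terms)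
      then show ?thesis using True ijl pq by (simp add: terms)
    next
      case False
      show ?thesis unfolding if_not_P[OF False]
        by (rule T.add.finprod_one_eqI) (use False ijl pq in \<open>simp add: terms\<close>)
    qed
    have "\<mu> (e3 (e i l) (e l j) \<one>\<^bsub>H\<^esub>) (pure_tensor K H HH \<one>\<^bsub>H\<^esub> (\<Delta>H \<one>\<^bsub>H\<^esub>))
        = (\<Oplus>\<^bsub>?T\<^esub>p\<in>J. \<Oplus>\<^bsub>?T\<^esub>q\<in>J. \<Oplus>\<^bsub>?T\<^esub>r\<in>J. \<mu> (e3 (e i l) (e l j) \<one>\<^bsub>H\<^esub>) (e3 \<one>\<^bsub>H\<^esub> (e p r) (e r q)))"
      using linear_total_comult_one[OF Tm bilinear_maps_right[OF b pure_e_closed[OF ijl]]] by (simp only: as)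
    also have "\<dots> = (\<Oplus>\<^bsub>?T\<^esub>p\<in>J. \<Oplus>\<^bsub>?T\<^esub>q\<in>J. if p = l then e3 (e i l) (e l j) (e j q) else \<zero>\<^bsub>?T\<^esub>)"
      using cl ijl by (intro T.finsum_cong'[OF HOL.refl] col funcsetI T.finsum_closed) auto
    also have "\<dots> = (\<Oplus>\<^bsub>?T\<^esub>q\<in>J. if l = l then e3 (e i l) (e l j) (e j q) else \<zero>\<^bsub>?T\<^esub>)"
      using cl ijl by (intro T.finsum_single finite_J T.finsum_closed) auto
    finally show ?thesis by (simp add: as)
  qed
  have "\<mu> (tensor_assoc K H H H (pure_tensor K HH H (\<Delta>H \<one>\<^bsub>H\<^esub>) \<one>\<^bsub>H\<^esub>))
      (pure_tensor K H HH \<one>\<^bsub>H\<^esub> (\<Delta>H \<one>\<^bsub>H\<^esub>))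
      = (\<Oplus>\<^bsub>?T\<^esub>i\<in>J. \<Oplus>\<^bsub>?T\<^esub>j\<in>J. \<Oplus>\<^bsub>?T\<^esub>l\<in>J.
          \<mu> (tensor_assoc K H H H (pure_tensor K HH H (pure_tensor K H H (e i l) (e l j)) \<one>\<^bsub>H\<^esub>))
            (pure_tensor K H HH \<one>\<^bsub>H\<^esub> (\<Delta>H \<one>\<^bsub>H\<^esub>)))"
    by (rule linear_total_comult_one[OF Tm bilinear_maps_left[OF b \<Delta>1]])
  also have "\<dots> = (\<Oplus>\<^bsub>?T\<^esub>i\<in>J. \<Oplus>\<^bsub>?T\<^esub>j\<in>J. \<Oplus>\<^bsub>?T\<^esub>l\<in>J. \<Oplus>\<^bsub>?T\<^esub>q\<in>J. e3 (e i l) (e l j) (e j q))"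
    using cl by (intro T.finsum_cong'[OF HOL.refl] inner funcsetI T.finsum_closed)
  finally show ?thesis by (simp only: total_comult_one_split)
qed

lemma e3_mult:
  assumes "x \<in> carrier H" "y \<in> carrier H" "z \<in> carrier H" "x' \<in> carrier H" "y' \<in> carrier H" "z' \<in> carrier H"
  shows "e3 x y z \<otimes>\<^bsub>tensor K H HH\<^esub> e3 x' y' z' = e3 (x \<otimes>\<^bsub>H\<^esub> x') (y \<otimes>\<^bsub>H\<^esub> y') (z \<otimes>\<^bsub>H\<^esub> z')"
  using assms
  by (simp add: tensor_mult_pure total_module square_module total_mult_bilinear tensor_mult_bilinear
      pure_tensor_closed)

lemma e3_zero:
  assumes "x \<in> carrier H" "z \<in> carrier H"
  shows "e3 x \<zero>\<^bsub>H\<^esub> z = \<zero>\<^bsub>tensor K H HH\<^esub>"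
  using linear_maps_zero[OF total_module module_tensor[OF total_module square_module]
      linear_maps_comp[OF bilinear_maps_right[OF pure_tensor_bilinear[OF total_module square_module] assms(1)]
        bilinear_maps_left[OF pure_tensor_bilinear[OF total_module total_module] assms(2)]]] .

lemma total_comult_one:
  shows total_comult_one1: "tensor_assoc K H H H (tensor_map K HH H \<Delta>H (\<lambda>x. x) (\<Delta>H \<one>\<^bsub>H\<^esub>))
      = tensor_assoc K H H H (pure_tensor K HH H (\<Delta>H \<one>\<^bsub>H\<^esub>) \<one>\<^bsub>H\<^esub>)
        \<otimes>\<^bsub>tensor K H HH\<^esub> pure_tensor K H HH \<one>\<^bsub>H\<^esub> (\<Delta>H \<one>\<^bsub>H\<^esub>)"
    and total_comult_one2: "tensor_assoc K H H H (tensor_map K HH H \<Delta>H (\<lambda>x. x) (\<Delta>H \<one>\<^bsub>H\<^esub>))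
      = pure_tensor K H HH \<one>\<^bsub>H\<^esub> (\<Delta>H \<one>\<^bsub>H\<^esub>)
        \<otimes>\<^bsub>tensor K H HH\<^esub> tensor_assoc K H H H (pure_tensor K HH H (\<Delta>H \<one>\<^bsub>H\<^esub>) \<one>\<^bsub>H\<^esub>)"
proof -
  note Hm = total_module and HHm = square_module and mH = total_mult_bilinear
  note mT = tensor_mult_bilinear[OF Hm HHm mH tensor_mult_bilinear[OF Hm Hm mH mH]]
  show "tensor_assoc K H H H (tensor_map K HH H \<Delta>H (\<lambda>x. x) (\<Delta>H \<one>\<^bsub>H\<^esub>))
      = tensor_assoc K H H H (pure_tensor K HH H (\<Delta>H \<one>\<^bsub>H\<^esub>) \<one>\<^bsub>H\<^esub>)
        \<otimes>\<^bsub>tensor K H HH\<^esub> pure_tensor K H HH \<one>\<^bsub>H\<^esub> (\<Delta>H \<one>\<^bsub>H\<^esub>)"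
    by (rule total_comult_one_product[OF mT, symmetric])
      (auto simp: e3_mult e_closed e_mult e3_zero)
  show "tensor_assoc K H H H (tensor_map K HH H \<Delta>H (\<lambda>x. x) (\<Delta>H \<one>\<^bsub>H\<^esub>))
      = pure_tensor K H HH \<one>\<^bsub>H\<^esub> (\<Delta>H \<one>\<^bsub>H\<^esub>)
        \<otimes>\<^bsub>tensor K H HH\<^esub> tensor_assoc K H H H (pure_tensor K HH H (\<Delta>H \<one>\<^bsub>H\<^esub>) \<one>\<^bsub>H\<^esub>)"
    by (rule total_comult_one_product[OF bilinear_maps_flip[OF mT], symmetric])
      (auto simp: e3_mult e_closed e_mult e3_zero)
qed

section \<open>The antipode\<close>

lemma lift_total_comult_one:
  assumes "module K P" "\<beta> \<in> bilinear_maps K H H P"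
  shows "tensor_lift P \<beta> (\<Delta>H \<one>\<^bsub>H\<^esub>) = (\<Oplus>\<^bsub>P\<^esub>i\<in>J. \<Oplus>\<^bsub>P\<^esub>j\<in>J. \<Oplus>\<^bsub>P\<^esub>l\<in>J. \<beta> (e i l) (e l j))"
proof -
  interpret P: module K P by fact
  note b = bilinear_maps_closed[OF assms(2)] and Hm = total_module
  have "tensor_lift P \<beta> (\<Delta>H \<one>\<^bsub>H\<^esub>)
      = (\<Oplus>\<^bsub>P\<^esub>i\<in>J. \<Oplus>\<^bsub>P\<^esub>j\<in>J. \<Oplus>\<^bsub>P\<^esub>l\<in>J. tensor_lift P \<beta> (pure_tensor K H H (e i l) (e l j)))"
    by (rule linear_total_comult_one[OF assms(1) tensor_universal(1)[OF Hm Hm assms]])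
  also have "\<dots> = (\<Oplus>\<^bsub>P\<^esub>i\<in>J. \<Oplus>\<^bsub>P\<^esub>j\<in>J. \<Oplus>\<^bsub>P\<^esub>l\<in>J. \<beta> (e i l) (e l j))"
    by (intro P.finsum_cong'[OF HOL.refl] tensor_universal(2)[OF Hm Hm assms] funcsetI P.finsum_closed b e_closed)
  finally show ?thesis .
qed

text \<open>For \<open>x\<^sub>(\<^sub>1\<^sub>)\<close> in \<open>C(i,l)\<close> and \<open>x\<^sub>(\<^sub>2\<^sub>)\<close> in \<open>C(l,j)\<close> the element \<open>S(x\<^sub>(\<^sub>2\<^sub>))\<close> lies in \<open>C(j,l)\<close>, so the product vanishes
unless \<open>i = j\<close>, and then the antipode axiom of the cogroupoid applies for each \<open>l\<close>.\<close>

lemma lift_antipode_right_incl: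
  assumes ij: "i \<in> J" "j \<in> J" and a: "a \<in> carrier (B i j)"
  shows "tensor_lift H (\<lambda>x1 x2. x1 \<otimes>\<^bsub>H\<^esub> SH x2) (\<Delta>H (\<iota> i j a))
    = (if i = j then \<Oplus>\<^bsub>H\<^esub>l\<in>J. \<epsilon> (X i) a \<odot>\<^bsub>H\<^esub> e i l else \<zero>\<^bsub>H\<^esub>)"
proof -
  note Hm = total_module
  note b = bilinear_maps_precomp[OF total_mult_bilinear linear_maps_id total_antipode_linear]
  have part: "tensor_lift H (\<lambda>u v. \<iota> i l u \<otimes>\<^bsub>H\<^esub> SH (\<iota> l j v)) (comult i j l a)
      = (if i = j then \<epsilon> (X i) a \<odot>\<^bsub>H\<^esub> e i l else \<zero>\<^bsub>H\<^esub>)" if l: "l \<in> J" for l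
  proof -
    note m = block_module[OF ij(1) l] block_module[OF l ij(2)] and c = block_comult_closed[OF ij l a]
    have prod: "\<iota> i l u \<otimes>\<^bsub>H\<^esub> SH (\<iota> l j v) = (if i = j then \<iota> i l (u \<otimes>\<^bsub>B i l\<^esub> S (X l) (X j) v) else \<zero>\<^bsub>H\<^esub>)"
      if "u \<in> carrier (B i l)" "v \<in> carrier (B l j)" for u v
      using incl_mult_incl[OF ij(1) l ij(2) l that(1) block_antipode_closed[OF l ij(2) that(2)]]
      by (simp add: total_antipode_incl[OF l ij(2) that(2)])
    show ?thesis
    proof (cases "i = j")
      case True
      note bb = bilinear_maps_precomp[OF block_mult_bilinear[OF ij(1) l] linear_maps_id
          block_antipode_linear[OF l ij(1)]]
      have c': "comult i i l a \<in> carrier (tensor K (B i l) (B l i))" using c True by simp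
      have a': "a \<in> carrier (B i i)" using a True by simp
      have "tensor_lift H (\<lambda>u v. \<iota> i l u \<otimes>\<^bsub>H\<^esub> SH (\<iota> l j v)) (comult i j l a)
          = tensor_lift H (\<lambda>u v. \<iota> i l (u \<otimes>\<^bsub>B i l\<^esub> S (X l) (X i) v)) (comult i j l a)"
        by (rule tensor_lift_cong[OF m c]) (use prod True in simp)
      also have "\<dots> = tensor_lift H (\<lambda>u v. \<iota> i l (u \<otimes>\<^bsub>B i l\<^esub> S (X l) (X i) v)) (comult i i l a)"
        using True by simp
      also have "\<dots> = \<iota> i l (tensor_lift (B i l) (\<lambda>u v. u \<otimes>\<^bsub>B i l\<^esub> S (X l) (X i) v) (comult i i l a))"
        by (rule linear_tensor_lift[OF m(1) block_module[OF l ij(1)] m(1) Hm bb incl_linear[OF ij(1) l] c',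
              symmetric])
      also have "\<dots> = \<epsilon> (X i) a \<odot>\<^bsub>H\<^esub> e i l"
        unfolding lift_block_antipode_right[OF ij(1) l a']
        by (rule linear_maps_smult[OF incl_linear[OF ij(1) l] block_counit_closed[OF ij(1) a']
              block_one_closed[OF ij(1) l]])
      finally show ?thesis using True by simp
    next
      case False
      then have "tensor_lift H (\<lambda>u v. \<iota> i l u \<otimes>\<^bsub>H\<^esub> SH (\<iota> l j v)) (comult i j l a) = \<zero>\<^bsub>H\<^esub>"
        by (intro tensor_lift_zero[OF m Hm c]) (simp add: prod)
      with False show ?thesis by simp
    qed
  qed
  have "tensor_lift H (\<lambda>x1 x2. x1 \<otimes>\<^bsub>H\<^esub> SH x2) (\<Delta>H (\<iota> i j a))
      = (\<Oplus>\<^bsub>H\<^esub>l\<in>J. tensor_lift H (\<lambda>u v. \<iota> i l u \<otimes>\<^bsub>H\<^esub> SH (\<iota> l j v)) (comult i j l a))"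
    by (rule lift_comult_incl[OF Hm b ij a])
  also have "\<dots> = (\<Oplus>\<^bsub>H\<^esub>l\<in>J. if i = j then \<epsilon> (X i) a \<odot>\<^bsub>H\<^esub> e i l else \<zero>\<^bsub>H\<^esub>)"
    using a ij by (intro H.finsum_cong'[OF HOL.refl] part funcsetI) (auto simp: block_counit_closed e_closed)
  finally show ?thesis by (cases "i = j") (simp_all add: H.add.finprod_one_eqI)
qed

lemma lift_antipode_left_incl:
  assumes ij: "i \<in> J" "j \<in> J" and a: "a \<in> carrier (B i j)"
  shows "tensor_lift H (\<lambda>x1 x2. SH x1 \<otimes>\<^bsub>H\<^esub> x2) (\<Delta>H (\<iota> i j a))
    = (if i = j then \<Oplus>\<^bsub>H\<^esub>l\<in>J. \<epsilon> (X i) a \<odot>\<^bsub>H\<^esub> e l i else \<zero>\<^bsub>H\<^esub>)"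
proof -
  note Hm = total_module
  note b = bilinear_maps_precomp[OF total_mult_bilinear total_antipode_linear linear_maps_id]
  have part: "tensor_lift H (\<lambda>u v. SH (\<iota> i l u) \<otimes>\<^bsub>H\<^esub> \<iota> l j v) (comult i j l a)
      = (if i = j then \<epsilon> (X i) a \<odot>\<^bsub>H\<^esub> e l i else \<zero>\<^bsub>H\<^esub>)" if l: "l \<in> J" for l
  proof -
    note m = block_module[OF ij(1) l] block_module[OF l ij(2)] and c = block_comult_closed[OF ij l a]
    have prod: "SH (\<iota> i l u) \<otimes>\<^bsub>H\<^esub> \<iota> l j v = (if i = j then \<iota> l i (S (X i) (X l) u \<otimes>\<^bsub>B l i\<^esub> v) else \<zero>\<^bsub>H\<^esub>)"
      if "u \<in> carrier (B i l)" "v \<in> carrier (B l j)" for u v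
      using incl_mult_incl[OF l ij(1) l ij(2) block_antipode_closed[OF ij(1) l that(1)] that(2)]
      by (simp add: total_antipode_incl[OF ij(1) l that(1)])
    show ?thesis
    proof (cases "i = j")
      case True
      note bb = bilinear_maps_precomp[OF block_mult_bilinear[OF l ij(1)]
          block_antipode_linear[OF ij(1) l] linear_maps_id]
      have c': "comult i i l a \<in> carrier (tensor K (B i l) (B l i))" using c True by simp
      have a': "a \<in> carrier (B i i)" using a True by simp
      note m' = block_module[OF l ij(1)]
      have "tensor_lift H (\<lambda>u v. SH (\<iota> i l u) \<otimes>\<^bsub>H\<^esub> \<iota> l j v) (comult i j l a)
          = tensor_lift H (\<lambda>u v. \<iota> l i (S (X i) (X l) u \<otimes>\<^bsub>B l i\<^esub> v)) (comult i j l a)"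
        by (rule tensor_lift_cong[OF m c]) (use prod True in simp)
      also have "\<dots> = tensor_lift H (\<lambda>u v. \<iota> l i (S (X i) (X l) u \<otimes>\<^bsub>B l i\<^esub> v)) (comult i i l a)"
        using True by simp
      also have "\<dots> = \<iota> l i (tensor_lift (B l i) (\<lambda>u v. S (X i) (X l) u \<otimes>\<^bsub>B l i\<^esub> v) (comult i i l a))"
        by (rule linear_tensor_lift[OF m(1) m' m' Hm bb incl_linear[OF l ij(1)] c', symmetric])
      also have "\<dots> = \<epsilon> (X i) a \<odot>\<^bsub>H\<^esub> e l i"
        unfolding lift_block_antipode_left[OF ij(1) l a']
        by (rule linear_maps_smult[OF incl_linear[OF l ij(1)] block_counit_closed[OF ij(1) a']
              block_one_closed[OF l ij(1)]])
      finally show ?thesis using True by simp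
    next
      case False
      then have "tensor_lift H (\<lambda>u v. SH (\<iota> i l u) \<otimes>\<^bsub>H\<^esub> \<iota> l j v) (comult i j l a) = \<zero>\<^bsub>H\<^esub>"
        by (intro tensor_lift_zero[OF m Hm c]) (simp add: prod)
      with False show ?thesis by simp
    qed
  qed
  have "tensor_lift H (\<lambda>x1 x2. SH x1 \<otimes>\<^bsub>H\<^esub> x2) (\<Delta>H (\<iota> i j a))
      = (\<Oplus>\<^bsub>H\<^esub>l\<in>J. tensor_lift H (\<lambda>u v. SH (\<iota> i l u) \<otimes>\<^bsub>H\<^esub> \<iota> l j v) (comult i j l a))"
    by (rule lift_comult_incl[OF Hm b ij a])
  also have "\<dots> = (\<Oplus>\<^bsub>H\<^esub>l\<in>J. if i = j then \<epsilon> (X i) a \<odot>\<^bsub>H\<^esub> e l i else \<zero>\<^bsub>H\<^esub>)"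
    using a ij by (intro H.finsum_cong'[OF HOL.refl] part funcsetI) (auto simp: block_counit_closed e_closed)
  finally show ?thesis by (cases "i = j") (simp_all add: H.add.finprod_one_eqI)
qed

text \<open>The \<open>(i,i)\<close> component of \<open>e\<^sub>p\<^sub>l\<close> is \<open>1\<close> or \<open>0\<close>, and the counit takes these to \<open>1\<close> and \<open>0\<close>.\<close>

lemma counit_mult_e:
  assumes "i \<in> J" "j \<in> J" "p \<in> J" "l \<in> J" "a \<in> carrier (B i j)"
  shows "\<epsilon>H (e p l \<otimes>\<^bsub>H\<^esub> \<iota> i j a) = (if p = i \<and> l = j \<and> i = j then \<epsilon> (X i) a else \<zero>)"
    and "\<epsilon>H (\<iota> i j a \<otimes>\<^bsub>H\<^esub> e p l) = (if p = i \<and> l = j \<and> i = j then \<epsilon> (X i) a else \<zero>)"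
  using total_counit_mult_incl[OF assms(1,2) e_closed[OF assms(3,4)] assms(5)] assms
    incl_component[OF assms(1,1)] block_counit_one[OF assms(1)] block_counit_closed[OF assms(1)]
    linear_maps_zero[OF block_module[OF assms(1,1)] scalar_module block_counit_linear[OF assms(1)]]
  by (auto simp: scalar_algebra_def)

text \<open>On the right, \<open>\<epsilon>(e\<^sub>p\<^sub>l a)\<close> for \<open>a\<close> in \<open>C(i,j)\<close> can be nonzero only for \<open>p = i = j = l\<close>, which leaves \<open>\<epsilon>\<^sub>i(a)\<close>
times the sum of the \<open>e\<^sub>i\<^sub>q\<close>.\<close>

lemma total_antipode_right:
  assumes "x \<in> carrier H"
  shows "tensor_lift H (\<lambda>x1 x2. x1 \<otimes>\<^bsub>H\<^esub> SH x2) (\<Delta>H x)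
    = tensor_lift H (\<lambda>e1 e2. \<epsilon>H (e1 \<otimes>\<^bsub>H\<^esub> x) \<odot>\<^bsub>H\<^esub> e2) (\<Delta>H \<one>\<^bsub>H\<^esub>)"
proof -
  note Hm = total_module and one = total_comult_closed[OF H.A.one_closed]
  note b = bilinear_maps_precomp[OF total_mult_bilinear linear_maps_id total_antipode_linear]
  have r: "(\<lambda>e1 e2. \<epsilon>H (e1 \<otimes>\<^bsub>H\<^esub> x) \<odot>\<^bsub>H\<^esub> e2) \<in> bilinear_maps K H H H" if x: "x \<in> carrier H" for x
    by (rule bilinear_maps_precomp[OF smult_bilinear[OF Hm]
          linear_maps_comp[OF total_counit_linear bilinear_maps_left[OF total_mult_bilinear x]] linear_maps_id])
  show ?thesis
  proof (rule total_linear_eqI[OF Hm _ _ _ assms])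
    show "(\<lambda>x. tensor_lift H (\<lambda>x1 x2. x1 \<otimes>\<^bsub>H\<^esub> SH x2) (\<Delta>H x)) \<in> linear_maps K H H"
      by (rule linear_maps_comp[OF tensor_universal(1)[OF Hm Hm Hm b] total_comult_linear])
    show "(\<lambda>x. tensor_lift H (\<lambda>e1 e2. \<epsilon>H (e1 \<otimes>\<^bsub>H\<^esub> x) \<odot>\<^bsub>H\<^esub> e2) (\<Delta>H \<one>\<^bsub>H\<^esub>)) \<in> linear_maps K H H"
      by (rule tensor_lift_param_linear[OF Hm Hm Hm Hm r _ one], assumption)
        (rule scalar_multiples_linear[OF Hm linear_maps_comp[OF total_counit_linear
            bilinear_maps_right[OF total_mult_bilinear]]])
    fix i j a assume ij: "i \<in> J" "j \<in> J" and a: "a \<in> carrier (B i j)"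
    let ?t = "\<lambda>p q l. \<epsilon>H (e p l \<otimes>\<^bsub>H\<^esub> \<iota> i j a) \<odot>\<^bsub>H\<^esub> e l q"
    have t: "?t p q l = (if p = i \<and> l = j \<and> i = j then \<epsilon> (X i) a \<odot>\<^bsub>H\<^esub> e l q else \<zero>\<^bsub>H\<^esub>)"
      if "p \<in> J" "q \<in> J" "l \<in> J" for p q l
      using counit_mult_e(1)[OF ij that(1,3) a] e_closed[OF that(3,2)] by simp
    have lift: "tensor_lift H (\<lambda>e1 e2. \<epsilon>H (e1 \<otimes>\<^bsub>H\<^esub> \<iota> i j a) \<odot>\<^bsub>H\<^esub> e2) (\<Delta>H \<one>\<^bsub>H\<^esub>)
        = (\<Oplus>\<^bsub>H\<^esub>p\<in>J. \<Oplus>\<^bsub>H\<^esub>q\<in>J. \<Oplus>\<^bsub>H\<^esub>l\<in>J. ?t p q l)"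
      by (rule lift_total_comult_one[OF Hm r[OF incl_closed[OF ij a]]])
    have "(\<Oplus>\<^bsub>H\<^esub>p\<in>J. \<Oplus>\<^bsub>H\<^esub>q\<in>J. \<Oplus>\<^bsub>H\<^esub>l\<in>J. ?t p q l)
        = (if i = j then \<Oplus>\<^bsub>H\<^esub>q\<in>J. \<epsilon> (X i) a \<odot>\<^bsub>H\<^esub> e i q else \<zero>\<^bsub>H\<^esub>)"
    proof (cases "i = j")
      case True
      have s: "\<epsilon> (X i) a \<odot>\<^bsub>H\<^esub> e i q \<in> carrier H" if "q \<in> J" for q
        using True a ij that by (simp add: block_counit_closed e_closed)
      have t': "?t p q l = (if p = i \<and> l = i then \<epsilon> (X i) a \<odot>\<^bsub>H\<^esub> e l q else \<zero>\<^bsub>H\<^esub>)"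
        if "p \<in> J" "q \<in> J" "l \<in> J" for p q l
        using t[OF that] True by simp
      have l: "(\<Oplus>\<^bsub>H\<^esub>l\<in>J. ?t p q l) = (if p = i then \<epsilon> (X i) a \<odot>\<^bsub>H\<^esub> e i q else \<zero>\<^bsub>H\<^esub>)"
        if "p \<in> J" "q \<in> J" for p q
        using that ij(1) s by (subst H.finsum_single[where a = i]) (simp_all add: t')
      have "(\<Oplus>\<^bsub>H\<^esub>p\<in>J. \<Oplus>\<^bsub>H\<^esub>q\<in>J. \<Oplus>\<^bsub>H\<^esub>l\<in>J. ?t p q l)
          = (\<Oplus>\<^bsub>H\<^esub>p\<in>J. \<Oplus>\<^bsub>H\<^esub>q\<in>J. if p = i then \<epsilon> (X i) a \<odot>\<^bsub>H\<^esub> e i q else \<zero>\<^bsub>H\<^esub>)"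
        using s by (intro H.finsum_cong'[OF HOL.refl] l funcsetI H.finsum_closed) auto
      also have "\<dots> = (\<Oplus>\<^bsub>H\<^esub>q\<in>J. if i = i then \<epsilon> (X i) a \<odot>\<^bsub>H\<^esub> e i q else \<zero>\<^bsub>H\<^esub>)"
        using s ij by (intro H.finsum_single finite_J) (auto intro: H.finsum_closed)
      finally show ?thesis using True by simp
    next
      case False
      then show ?thesis by (simp add: t H.add.finprod_one_eqI)
    qed
    then show "tensor_lift H (\<lambda>x1 x2. x1 \<otimes>\<^bsub>H\<^esub> SH x2) (\<Delta>H (\<iota> i j a))
        = tensor_lift H (\<lambda>e1 e2. \<epsilon>H (e1 \<otimes>\<^bsub>H\<^esub> \<iota> i j a) \<odot>\<^bsub>H\<^esub> e2) (\<Delta>H \<one>\<^bsub>H\<^esub>)"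
      by (simp only: lift lift_antipode_right_incl[OF ij a])
  qed
qed

lemma total_antipode_left:
  assumes "x \<in> carrier H"
  shows "tensor_lift H (\<lambda>x1 x2. SH x1 \<otimes>\<^bsub>H\<^esub> x2) (\<Delta>H x)
    = tensor_lift H (\<lambda>e1 e2. \<epsilon>H (x \<otimes>\<^bsub>H\<^esub> e2) \<odot>\<^bsub>H\<^esub> e1) (\<Delta>H \<one>\<^bsub>H\<^esub>)"
proof -
  note Hm = total_module and one = total_comult_closed[OF H.A.one_closed]
  note b = bilinear_maps_precomp[OF total_mult_bilinear total_antipode_linear linear_maps_id]
  have r: "(\<lambda>e1 e2. \<epsilon>H (x \<otimes>\<^bsub>H\<^esub> e2) \<odot>\<^bsub>H\<^esub> e1) \<in> bilinear_maps K H H H" if x: "x \<in> carrier H" for x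
    by (rule bilinear_maps_flip[OF bilinear_maps_precomp[OF smult_bilinear[OF Hm]
          linear_maps_comp[OF total_counit_linear bilinear_maps_right[OF total_mult_bilinear x]] linear_maps_id]])
  show ?thesis
  proof (rule total_linear_eqI[OF Hm _ _ _ assms])
    show "(\<lambda>x. tensor_lift H (\<lambda>x1 x2. SH x1 \<otimes>\<^bsub>H\<^esub> x2) (\<Delta>H x)) \<in> linear_maps K H H"
      by (rule linear_maps_comp[OF tensor_universal(1)[OF Hm Hm Hm b] total_comult_linear])
    show "(\<lambda>x. tensor_lift H (\<lambda>e1 e2. \<epsilon>H (x \<otimes>\<^bsub>H\<^esub> e2) \<odot>\<^bsub>H\<^esub> e1) (\<Delta>H \<one>\<^bsub>H\<^esub>)) \<in> linear_maps K H H"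
      by (rule tensor_lift_param_linear[OF Hm Hm Hm Hm r _ one], assumption)
        (rule scalar_multiples_linear[OF Hm linear_maps_comp[OF total_counit_linear
            bilinear_maps_left[OF total_mult_bilinear]]])
    fix i j a assume ij: "i \<in> J" "j \<in> J" and a: "a \<in> carrier (B i j)"
    let ?t = "\<lambda>p q l. \<epsilon>H (\<iota> i j a \<otimes>\<^bsub>H\<^esub> e l q) \<odot>\<^bsub>H\<^esub> e p l"
    have t: "?t p q l = (if l = i \<and> q = j \<and> i = j then \<epsilon> (X i) a \<odot>\<^bsub>H\<^esub> e p l else \<zero>\<^bsub>H\<^esub>)"
      if "p \<in> J" "q \<in> J" "l \<in> J" for p q l
      using counit_mult_e(2)[OF ij that(3,2) a] e_closed[OF that(1,3)] by simp
    have lift: "tensor_lift H (\<lambda>e1 e2. \<epsilon>H (\<iota> i j a \<otimes>\<^bsub>H\<^esub> e2) \<odot>\<^bsub>H\<^esub> e1) (\<Delta>H \<one>\<^bsub>H\<^esub>)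
        = (\<Oplus>\<^bsub>H\<^esub>p\<in>J. \<Oplus>\<^bsub>H\<^esub>q\<in>J. \<Oplus>\<^bsub>H\<^esub>l\<in>J. ?t p q l)"
      by (rule lift_total_comult_one[OF Hm r[OF incl_closed[OF ij a]]])
    have "(\<Oplus>\<^bsub>H\<^esub>p\<in>J. \<Oplus>\<^bsub>H\<^esub>q\<in>J. \<Oplus>\<^bsub>H\<^esub>l\<in>J. ?t p q l)
        = (if i = j then \<Oplus>\<^bsub>H\<^esub>p\<in>J. \<epsilon> (X i) a \<odot>\<^bsub>H\<^esub> e p i else \<zero>\<^bsub>H\<^esub>)"
    proof (cases "i = j")
      case True
      have s: "\<epsilon> (X i) a \<odot>\<^bsub>H\<^esub> e p i \<in> carrier H" if "p \<in> J" for p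
        using True a ij that by (simp add: block_counit_closed e_closed)
      have t': "?t p q l = (if l = i \<and> q = i then \<epsilon> (X i) a \<odot>\<^bsub>H\<^esub> e p l else \<zero>\<^bsub>H\<^esub>)"
        if "p \<in> J" "q \<in> J" "l \<in> J" for p q l
        using t[OF that] True by simp
      have l: "(\<Oplus>\<^bsub>H\<^esub>l\<in>J. ?t p q l) = (if q = i then \<epsilon> (X i) a \<odot>\<^bsub>H\<^esub> e p i else \<zero>\<^bsub>H\<^esub>)"
        if "p \<in> J" "q \<in> J" for p q
        using that ij(1) s by (subst H.finsum_single[where a = i]) (simp_all add: t')
      have "(\<Oplus>\<^bsub>H\<^esub>q\<in>J. \<Oplus>\<^bsub>H\<^esub>l\<in>J. ?t p q l) = \<epsilon> (X i) a \<odot>\<^bsub>H\<^esub> e p i" if "p \<in> J" for p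
        using that ij(1) s by (subst H.finsum_single[where a = i]) (simp_all add: l)
      then have "(\<Oplus>\<^bsub>H\<^esub>p\<in>J. \<Oplus>\<^bsub>H\<^esub>q\<in>J. \<Oplus>\<^bsub>H\<^esub>l\<in>J. ?t p q l) = (\<Oplus>\<^bsub>H\<^esub>p\<in>J. \<epsilon> (X i) a \<odot>\<^bsub>H\<^esub> e p i)"
        using s by (intro H.finsum_cong'[OF HOL.refl] funcsetI)
      then show ?thesis using True by simp
    next
      case False
      then show ?thesis by (simp add: t H.add.finprod_one_eqI)
    qed
    then show "tensor_lift H (\<lambda>x1 x2. SH x1 \<otimes>\<^bsub>H\<^esub> x2) (\<Delta>H (\<iota> i j a))
        = tensor_lift H (\<lambda>e1 e2. \<epsilon>H (\<iota> i j a \<otimes>\<^bsub>H\<^esub> e2) \<odot>\<^bsub>H\<^esub> e1) (\<Delta>H \<one>\<^bsub>H\<^esub>)"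
      by (simp only: lift lift_antipode_left_incl[OF ij a])
  qed
qed

text \<open>With the bracketing \<open>(\<Delta> \<otimes> 1) \<Delta>\<close> the first two factors combine to \<open>S(x\<^sub>(\<^sub>1\<^sub>)) x\<^sub>(\<^sub>2\<^sub>)\<close>, which is already known on
each summand. Only \<open>l = i\<close> survives in \<open>\<Delta>(a)\<close>, and multiplication by an element of \<open>C(j,i)\<close> picks \<open>e\<^sub>j\<^sub>i\<close> from
the sum of the \<open>e\<^sub>k\<^sub>i\<close>.\<close>

lemma total_antipode_conv:
  assumes "x \<in> carrier H"
  shows "tensor_lift H (\<lambda>t x3. tensor_lift H (\<lambda>x1 x2. SH x1 \<otimes>\<^bsub>H\<^esub> x2 \<otimes>\<^bsub>H\<^esub> SH x3) t)
      (tensor_map K HH H \<Delta>H (\<lambda>x. x) (\<Delta>H x)) = SH x"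
proof -
  note Hm = total_module and HHm = square_module and mH = total_mult_bilinear
    and Sl = total_antipode_linear
  note b = bilinear_maps_precomp[OF mH Sl linear_maps_id]
  let ?L = "tensor_lift H (\<lambda>x1 x2. SH x1 \<otimes>\<^bsub>H\<^esub> x2)"
  have L: "?L \<in> linear_maps K HH H" by (rule tensor_universal(1)[OF Hm Hm Hm b])
  note b2 = bilinear_maps_precomp[OF mH L Sl]
  note b3 = bilinear_maps_precomp[OF mH linear_maps_comp[OF L total_comult_linear] Sl]
  have "tensor_lift H (\<lambda>t x3. tensor_lift H (\<lambda>x1 x2. SH x1 \<otimes>\<^bsub>H\<^esub> x2 \<otimes>\<^bsub>H\<^esub> SH x3) t)
      (tensor_map K HH H \<Delta>H (\<lambda>x. x) (\<Delta>H x))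
      = tensor_lift H (\<lambda>t x3. ?L t \<otimes>\<^bsub>H\<^esub> SH x3) (tensor_map K HH H \<Delta>H (\<lambda>x. x) (\<Delta>H x))"
  proof (rule tensor_lift_cong[OF HHm Hm])
    show "tensor_map K HH H \<Delta>H (\<lambda>x. x) (\<Delta>H x) \<in> carrier (tensor K HH H)"
      by (rule tensor_map_closed[OF Hm Hm HHm Hm total_comult_linear linear_maps_id total_comult_closed[OF assms]])
    fix t x3 assume t: "t \<in> carrier HH" and x3: "x3 \<in> carrier H"
    show "tensor_lift H (\<lambda>x1 x2. SH x1 \<otimes>\<^bsub>H\<^esub> x2 \<otimes>\<^bsub>H\<^esub> SH x3) t = ?L t \<otimes>\<^bsub>H\<^esub> SH x3"
      by (rule linear_tensor_lift[OF Hm Hm Hm Hm b bilinear_maps_left[OF mH linear_maps_closed[OF Sl x3]] t,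
            symmetric])
  qed
  also have "\<dots> = tensor_lift H (\<lambda>x1 x3. ?L (\<Delta>H x1) \<otimes>\<^bsub>H\<^esub> SH x3) (\<Delta>H x)"
    by (rule tensor_lift_tensor_map[OF Hm Hm HHm Hm Hm total_comult_linear linear_maps_id b2
          total_comult_closed[OF assms]])
  also have "\<dots> = SH x"
  proof (rule total_linear_eqI[OF Hm _ Sl _ assms])
    show "(\<lambda>x. tensor_lift H (\<lambda>x1 x3. ?L (\<Delta>H x1) \<otimes>\<^bsub>H\<^esub> SH x3) (\<Delta>H x)) \<in> linear_maps K H H"
      by (rule linear_maps_comp[OF tensor_universal(1)[OF Hm Hm Hm b3] total_comult_linear])
    fix i j a assume ij: "i \<in> J" "j \<in> J" and a: "a \<in> carrier (B i j)"
    have Sa: "\<iota> j i (S (X i) (X j) v) \<in> carrier H" if "v \<in> carrier (B i j)" for v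
      using linear_maps_closed[OF antipode_part_linear[OF ij] that] .
    have prod: "?L (\<Delta>H (\<iota> i l u)) \<otimes>\<^bsub>H\<^esub> SH (\<iota> l j v)
        = (if l = i then \<epsilon> (X i) u \<odot>\<^bsub>H\<^esub> \<iota> j i (S (X i) (X j) v) else \<zero>\<^bsub>H\<^esub>)"
      if l: "l \<in> J" and u: "u \<in> carrier (B i l)" and v: "v \<in> carrier (B l j)" for l u v
    proof (cases "l = i")
      case True
      have u': "u \<in> carrier (B i i)" and v': "v \<in> carrier (B i j)" using u v True by auto
      note \<epsilon>u = block_counit_closed[OF ij(1) u'] and Sv = block_antipode_closed[OF ij v']
      have "?L (\<Delta>H (\<iota> i l u)) \<otimes>\<^bsub>H\<^esub> SH (\<iota> l j v)
          = (\<Oplus>\<^bsub>H\<^esub>k\<in>J. \<epsilon> (X i) u \<odot>\<^bsub>H\<^esub> e k i) \<otimes>\<^bsub>H\<^esub> \<iota> j i (S (X i) (X j) v)"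
        using True lift_antipode_left_incl[OF ij(1,1) u'] total_antipode_incl[OF ij v'] by simp
      also have "\<dots> = (\<Oplus>\<^bsub>H\<^esub>k\<in>J. (\<epsilon> (X i) u \<odot>\<^bsub>H\<^esub> e k i) \<otimes>\<^bsub>H\<^esub> \<iota> j i (S (X i) (X j) v))"
        by (rule linear_maps_finsum[OF Hm Hm bilinear_maps_left[OF mH Sa[OF v']] H.smult_closed[OF \<epsilon>u e_closed[OF _ ij(1)]]])
      also have "\<dots> = (\<epsilon> (X i) u \<odot>\<^bsub>H\<^esub> e j i) \<otimes>\<^bsub>H\<^esub> \<iota> j i (S (X i) (X j) v)"
      proof (rule H.finsum_single[OF finite_J ij(2)])
        show "(\<epsilon> (X i) u \<odot>\<^bsub>H\<^esub> e j i) \<otimes>\<^bsub>H\<^esub> \<iota> j i (S (X i) (X j) v) \<in> carrier H"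
          by (intro H.A.m_closed H.smult_closed \<epsilon>u e_closed ij Sa v')
        fix k assume k: "k \<in> J" "k \<noteq> j"
        have "e k i \<otimes>\<^bsub>H\<^esub> \<iota> j i (S (X i) (X j) v) = \<zero>\<^bsub>H\<^esub>"
          using k incl_mult_incl[OF k(1) ij(1) ij(2,1) block_one_closed[OF k(1) ij(1)] Sv] by simp
        then show "(\<epsilon> (X i) u \<odot>\<^bsub>H\<^esub> e k i) \<otimes>\<^bsub>H\<^esub> \<iota> j i (S (X i) (X j) v) = \<zero>\<^bsub>H\<^esub>"
          using H.mult_smult_left[OF \<epsilon>u e_closed[OF k(1) ij(1)] Sa[OF v']] \<epsilon>u by simp
      qed
      also have "\<dots> = \<epsilon> (X i) u \<odot>\<^bsub>H\<^esub> \<iota> j i (S (X i) (X j) v)"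
        using H.mult_smult_left[OF \<epsilon>u e_closed[OF ij(2,1)] Sa[OF v']]
          incl_mult_incl[OF ij(2,1) ij(2,1) block_one_closed[OF ij(2,1)] Sv]
          ring.ring_simprules(12)[OF block_ring[OF ij(2,1)] Sv] by simp
      finally show ?thesis using True by simp
    next
      case False
      have "?L (\<Delta>H (\<iota> i l u)) = \<zero>\<^bsub>H\<^esub>"
        using lift_antipode_left_incl[OF ij(1) l u] False by simp
      moreover have "SH (\<iota> l j v) \<in> carrier H"
        by (rule linear_maps_closed[OF Sl incl_closed[OF l ij(2) v]])
      ultimately show ?thesis using False by simp
    qed
    have part: "tensor_lift H (\<lambda>u v. ?L (\<Delta>H (\<iota> i l u)) \<otimes>\<^bsub>H\<^esub> SH (\<iota> l j v)) (comult i j l a)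
        = (if l = i then \<iota> j i (S (X i) (X j) a) else \<zero>\<^bsub>H\<^esub>)" if l: "l \<in> J" for l
    proof -
      note m = block_module[OF ij(1) l] block_module[OF l ij(2)] and c = block_comult_closed[OF ij l a]
      show ?thesis
      proof (cases "l = i")
        case True
        have "tensor_lift H (\<lambda>u v. ?L (\<Delta>H (\<iota> i l u)) \<otimes>\<^bsub>H\<^esub> SH (\<iota> l j v)) (comult i j l a)
            = tensor_lift H (\<lambda>u v. \<epsilon> (X i) u \<odot>\<^bsub>H\<^esub> \<iota> j i (S (X i) (X j) v)) (comult i j l a)"
          by (rule tensor_lift_cong[OF m c]) (simp only: prod[OF l] if_P[OF True])
        then show ?thesis
          using True lift_block_counit_left[OF ij a Hm antipode_part_linear[OF ij]] by simp
      next
        case False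
        have "tensor_lift H (\<lambda>u v. ?L (\<Delta>H (\<iota> i l u)) \<otimes>\<^bsub>H\<^esub> SH (\<iota> l j v)) (comult i j l a) = \<zero>\<^bsub>H\<^esub>"
          by (rule tensor_lift_zero[OF m Hm c]) (simp only: prod[OF l] if_not_P[OF False])
        with False show ?thesis by simp
      qed
    qed
    show "tensor_lift H (\<lambda>x1 x3. ?L (\<Delta>H x1) \<otimes>\<^bsub>H\<^esub> SH x3) (\<Delta>H (\<iota> i j a)) = SH (\<iota> i j a)"
      unfolding lift_comult_incl[OF Hm b3 ij a] total_antipode_incl[OF ij a]
      using ij(1) Sa[OF a] by (subst H.finsum_single[where a = i]) (simp_all add: part)
  qed
  finally show ?thesis .
qed

theorem weak_hopf_algebra_total: "weak_hopf_algebra K H \<Delta>H \<epsilon>H SH"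
proof (intro weak_hopf_algebra.intro coalgebra.intro weak_hopf_algebra_axioms.intro coalgebra_axioms.intro)
qed (fact total_algebra field_axioms total_module total_comult_linear total_counit_linear total_coassoc
    total_counit_right total_counit_left total_antipode_linear total_comult_mult total_counit_mult1
    total_counit_mult2 total_comult_one1 total_comult_one2 total_antipode_right total_antipode_left
    total_antipode_conv)+

end

theorem proposition2p26:
  fixes K :: "('k, 'm) ring_scheme"
    and ob :: "'o set"
    and C :: "'o \<Rightarrow> 'o \<Rightarrow> ('k, 'a) module"
    and \<Delta> :: "'o \<Rightarrow> 'o \<Rightarrow> 'o \<Rightarrow> 'a \<Rightarrow> ('a \<times> 'a) list set"
    and \<epsilon> :: "'o \<Rightarrow> 'a \<Rightarrow> 'k"
    and S :: "'o \<Rightarrow> 'o \<Rightarrow> 'a \<Rightarrow> 'a"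
    and n :: nat
    and X :: "nat \<Rightarrow> 'o"
  assumes "cogroupoid K ob C \<Delta> \<epsilon> S"
    and "\<And>i. i \<in> {1..n} \<Longrightarrow> X i \<in> ob"
  shows "weak_hopf_algebra K (cog_algebra C n X)
    (cog_comult K C \<Delta> n X) (cog_counit K \<epsilon> n X) (cog_antipode C S n X)"
  by (rule cogroupoid_family.weak_hopf_algebra_total[where ob = ob])
    (intro cogroupoid_family.intro cogroupoid_family_axioms.intro assms)

end
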